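(* Let $\bar\ell\in H^1_0(0,T;\mathbb{R}^n)$ be a local optimum of (P) and let $\epsilon>0$. Let $\ell_\epsilon\in H^1_0(0,T;\mathbb{R}^n)$ be locally optimal for $(P_\epsilon)$ with associated state $q_\epsilon=S_\epsilon(\ell_\epsilon)\in H^2_0(0,T;\mathbb{R}^n)$. Then there exist a unique adjoint state $\xi_\epsilon\in H^1(0,T;\mathbb{R}^n)$ and a unique multiplier $\lambda_\epsilon\in L^\infty(0,T;\mathbb{R}^n)$ such that, with $z_\epsilon:=-\alpha q_\epsilon+\ell_\epsilon-\kappa(\mathcal{H}(q_\epsilon))$, the following system is satisfied: $$-\dot\xi_\epsilon+\alpha\lambda_\epsilon+[(\kappa\circ\mathcal{H})'(q_\epsilon)]^\star\lambda_\epsilon=j'(q_\epsilon)\ \text{ in }L^2(0,T;\mathbb{R}^n),\qquad \xi_\epsilon(T)=q_\epsilon(T)-q_d,$$ for all $i=1,\dots,n$, $$\lambda^i_\epsilon(t)=\tfrac1\epsilon\,\chi_{\{z^i_\epsilon>0\}}(t)\,\xi^i_\epsilon(t)\ \text{ a.e. where }z^i_\epsilon(t)\ne0,\qquad \lambda^i_\epsilon(t)\in\big[0,\tfrac1\epsilon\xi^i_\epsilon(t)\big]\ \text{ a.e. where }z^i_\epsilon(t)=0$$ (the latter meaning $0\le\lambda_\epsilon^i(t)\le\frac1\epsilon\xi_\epsilon^i(t)$), and $$\int_0^T\langle\lambda_\epsilon(t),v(t)\rangle_{\mathbb{R}^n}\,dt+(\ell_\epsilon,v)_{H^1(0,T;\mathbb{R}^n)}+(\ell_\epsilon-\bar\ell,v)_{H^1(0,T;\mathbb{R}^n)}=0\quad\forall\,v\in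 H^1_0(0,T;\mathbb{R}^n).$$
   Context: Fix $T>0$, $n\in\mathbb{N}$, $\alpha>0$. $H^1_0(0,T;\mathbb{R}^n):=\{y\in H^1(0,T;\mathbb{R}^n):y(0)=0\}$ (only the initial value vanishes) and $H^2_0(0,T;\mathbb{R}^n):=\{y\in H^2(0,T;\mathbb{R}^n):y(0)=0\}$. $(\cdot,\cdot)_{H^1(0,T;\mathbb{R}^n)}$ is the usual $H^1$ scalar product. Superscript $i$ denotes the $i$-th component; scalar functions act on vectors componentwise; $\chi_A$ is the characteristic function of $A$. Standing assumptions. The history operator is $\mathcal{H}(y)(t):=\int_0^t y(s)\,ds+y_0$, with fixed $y_0\in\mathbb{R}^n$. The function $\kappa:\mathbb{R}\to[0,\infty)$ is Lipschitz continuous, differentiable, and $\kappa'\in W^{1,2}(\mathbb{R})$. The derivative of $\kappa\circ\mathcal{H}$ is $[(\kappa\circ\mathcal{H})'(q)v](t)=\kappa'(\mathcal{H}(q)(t))\int_0^t v(s)\,ds$ (componentwise), and $[(\kappa\circ\mathcal{H})'(q)]^\star$ is its adjoint as a bounded linear operator on $L^2(0,T;\mathbb{R}^n)$. The functional $j:L^2(0,T;\mathbb{R}^n)\to\mathbb{R}$ is continuously differentiable; $j'(q)$ is identified with an element of $L^2(0,T;\mathbb{R}^n)$. The desired state $q_d\in\mathbb{R}^n$ has nonnegative components. State equations. Let $\mathcal{C}:=\{\eta\in\mathbb{R}^n:\eta_i\ge0\ \forall i\}$; $\mathcal{R}(\zeta,\eta):=\langle\kappa(\zeta),\eta\rangle_{\mathbb{R}^n}$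 and $\mathcal{R}_\epsilon(\zeta,\eta):=\langle\kappa(\zeta),\eta\rangle_{\mathbb{R}^n}+\frac\epsilon2\|\eta\|^2_{\mathbb{R}^n}$ if $\eta\in\mathcal{C}$, and both are $\infty$ otherwise. With $\partial_2$ the convex subdifferential in the second argument: (a) for $\ell\in H^1_0(0,T;\mathbb{R}^n)$, $S(\ell)\in H^1_0(0,T;\mathbb{R}^n)$ is the unique $q$ with $-\alpha q(t)+\ell(t)\in\partial_2\mathcal{R}(\mathcal{H}(q)(t),\dot q(t))$ a.e. in $(0,T)$, $q(0)=0$; (b) for $\ell\in L^2(0,T;\mathbb{R}^n)$, $S_\epsilon(\ell)\in H^1_0(0,T;\mathbb{R}^n)$ is the unique $q$ with $-\alpha q(t)+\ell(t)\in\partial_2\mathcal{R}_\epsilon(\mathcal{H}(q)(t),\dot q(t))$ a.e. in $(0,T)$, $q(0)=0$; equivalently (known), $\dot q(t)=\frac1\epsilon\max\{-\alpha q(t)+\ell(t)-\kappa(\mathcal{H}(q)(t)),0\}$, $q(0)=0$. (Unique solvability of both problems is known and may be assumed.) Control problems. (P): minimize $\mathcal{J}(\ell):=j(S(\ell))+\frac12\|S(\ell)(T)-q_d\|_{\mathbb{R}^n}^2+\frac12\|\ell\|^2_{H^1(0,T;\mathbb{R}^n)}$ over $\ell\in H^1_0(0,T;\mathbb{R}^n)$. $(P_\epsilon)$: for the fixed local optimum $\bar\ell$ of (P), minimize $\mathcal{J}_\epsilon(\ell):=j(S_\epsilon(\ell))+\frac12\|S_\epsilon(\ell)(T)-q_d\|_{\mathbb{R}^n}^2+\frac12\|\ell\|^2_{H^1(0,T;\mathbb{R}^n)}+\frac12\|\ell-\bar\ell\|^2_{H^1(0,T;\mathbb{R}^n)}$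 over $\ell\in H^1_0(0,T;\mathbb{R}^n)$. Local optimality means minimality on some ball of positive radius in $H^1_0(0,T;\mathbb{R}^n)$ (with respect to the $H^1$ norm) around the point. *)

theory Defs
  imports "HOL-Analysis.Analysis"
begin

text \<open>
  Elements of the Lebesgue and Sobolev spaces are represented by functions on the real line.
  Only their values on the interval in question matter, and equality in $L^p$ is equality
  almost everywhere.
\<close>

definition L2 :: "real set \<Rightarrow> (real \<Rightarrow> 'a::euclidean_space) set" where
  "L2 I = {f \<in> borel_measurable (lebesgue_on I). integrable (lebesgue_on I) (\<lambda>t. (norm (f t))\<^sup>2)}"

definition L2_inner :: "real set \<Rightarrow> (real \<Rightarrow> 'a::euclidean_space) \<Rightarrow> (real \<Rightarrow> 'a) \<Rightarrow> real" where
  "L2_inner I f g = (LINT t|lebesgue_on I. f t \<bullet> g t)"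

definition L2_norm :: "real set \<Rightarrow> (real \<Rightarrow> 'a::euclidean_space) \<Rightarrow> real" where
  "L2_norm I f = sqrt (L2_inner I f f)"

definition Linf :: "real set \<Rightarrow> (real \<Rightarrow> 'a::euclidean_space) set" where
  "Linf I = {f \<in> borel_measurable (lebesgue_on I). \<exists>C. AE t in lebesgue_on I. norm (f t) \<le> C}"


section \<open>Sobolev spaces on intervals\<close>

text \<open>
  Test functions are taken from $C^1_c(I)$, as usual for Sobolev spaces in one dimension;
  by mollification this gives the same weak derivatives as $C^\infty_c(I)$.
\<close>

definition test_functions :: "real set \<Rightarrow> (real \<Rightarrow> real) set" where
  "test_functions I = {\<phi>. (\<forall>x. \<phi> differentiable at x) \<and> continuous_on UNIV (deriv \<phi>) \<and>
     (\<exists>K. compact K \<and> K \<subseteq> I \<and> (\<forall>x. x \<notin> K \<longrightarrow> \<phi> x = 0))}"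

definition has_weak_derivative ::
    "real set \<Rightarrow> (real \<Rightarrow> 'a::euclidean_space) \<Rightarrow> (real \<Rightarrow> 'a) \<Rightarrow> bool" where
  "has_weak_derivative I u g \<longleftrightarrow> (\<forall>\<phi>\<in>test_functions I.
     (LINT t|lebesgue_on I. deriv \<phi> t *\<^sub>R u t) = - (LINT t|lebesgue_on I. \<phi> t *\<^sub>R g t))"

definition W12 :: "real set \<Rightarrow> (real \<Rightarrow> 'a::euclidean_space) set" where
  "W12 I = {u \<in> L2 I. \<exists>g\<in>L2 I. has_weak_derivative I u g}"

text \<open>For \<open>u \<in> W12 I\<close> the chosen function is determined up to a null set.\<close>

definition weak_deriv :: "real set \<Rightarrow> (real \<Rightarrow> 'a::euclidean_space) \<Rightarrow> real \<Rightarrow> 'a" where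
  "weak_deriv I u = (SOME g. g \<in> L2 I \<and> has_weak_derivative I u g)"

text \<open>
  On a bounded interval we always take the representative that is continuous on \<open>{0..T}\<close>,
  so that the boundary values \<open>y 0\<close> and \<open>y T\<close> are the traces.
\<close>

definition H1 :: "real \<Rightarrow> (real \<Rightarrow> 'a::euclidean_space) set" where
  "H1 T = {y \<in> W12 {0<..<T}. continuous_on {0..T} y}"

text \<open>Only the initial value vanishes.\<close>

definition H10 :: "real \<Rightarrow> (real \<Rightarrow> 'a::euclidean_space) set" where
  "H10 T = {y \<in> H1 T. y 0 = 0}"

definition H20 :: "real \<Rightarrow> (real \<Rightarrow> 'a::euclidean_space) set" where
  "H20 T = {y \<in> H10 T. weak_deriv {0<..<T} y \<in> W12 {0<..<T}}"

definition H1_inner :: "real \<Rightarrow> (real \<Rightarrow> 'a::euclidean_space) \<Rightarrow> (real \<Rightarrow> 'a) \<Rightarrow> real" where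
  "H1_inner T u v = L2_inner {0<..<T} u v
     + L2_inner {0<..<T} (weak_deriv {0<..<T} u) (weak_deriv {0<..<T} v)"

definition H1_norm :: "real \<Rightarrow> (real \<Rightarrow> 'a::euclidean_space) \<Rightarrow> real" where
  "H1_norm T u = sqrt (H1_inner T u u)"


section \<open>Differentiability and adjoints on $L^2$\<close>

text \<open>
  \<open>j\<close> is continuously Frechet differentiable on $L^2(I)$, its derivative at \<open>q\<close> being the
  functional represented by \<open>dj q\<close>. Applied to directions \<open>v\<close> of norm zero, the first
  condition also says that \<open>j\<close> depends only on the almost-everywhere class of its argument.
\<close>

definition L2_continuously_differentiable ::
    "real set \<Rightarrow> ((real \<Rightarrow> 'a::euclidean_space) \<Rightarrow> real) \<Rightarrow> ((real \<Rightarrow> 'a) \<Rightarrow> real \<Rightarrow> 'a) \<Rightarrow> bool" where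
  "L2_continuously_differentiable I j dj \<longleftrightarrow>
     (\<forall>q\<in>L2 I. dj q \<in> L2 I \<and>
        (\<forall>e>0. \<exists>d>0. \<forall>v\<in>L2 I. L2_norm I v < d \<longrightarrow>
           \<bar>j (\<lambda>t. q t + v t) - j q - L2_inner I (dj q) v\<bar> \<le> e * L2_norm I v)) \<and>
     (\<forall>q\<in>L2 I. \<forall>e>0. \<exists>d>0. \<forall>p\<in>L2 I. L2_norm I (\<lambda>t. p t - q t) < d \<longrightarrow>
        L2_norm I (\<lambda>t. dj p t - dj q t) < e)"

text \<open>
  The Hilbert space adjoint of a bounded linear operator on $L^2(I)$; its values are
  determined up to null sets.
\<close>

definition L2_adjoint ::
    "real set \<Rightarrow> ((real \<Rightarrow> 'a::euclidean_space) \<Rightarrow> real \<Rightarrow> 'a) \<Rightarrow> (real \<Rightarrow> 'a) \<Rightarrow> real \<Rightarrow> 'a" where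
  "L2_adjoint I A p = (SOME w. w \<in> L2 I \<and> (\<forall>v\<in>L2 I. L2_inner I (A v) p = L2_inner I v w))"


section \<open>The state equations\<close>

definition componentwise :: "(real \<Rightarrow> real) \<Rightarrow> real ^ 'n \<Rightarrow> real ^ 'n" where
  "componentwise f x = (\<chi> i. f (x $ i))"

definition history :: "real ^ 'n \<Rightarrow> (real \<Rightarrow> real ^ 'n) \<Rightarrow> real \<Rightarrow> real ^ 'n" where
  "history y0 y t = (LINT s|lebesgue_on {0..t}. y s) + y0"

text \<open>The derivative of $\kappa \circ {\cal H}$ at \<open>q\<close> in direction \<open>v\<close>.\<close>

definition kappa_history_deriv ::
    "(real \<Rightarrow> real) \<Rightarrow> real ^ 'n \<Rightarrow> (real \<Rightarrow> real ^ 'n) \<Rightarrow> (real \<Rightarrow> real ^ 'n) \<Rightarrow> real \<Rightarrow> real ^ 'n" where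
  "kappa_history_deriv \<kappa> y0 q v t =
     (\<chi> i. deriv \<kappa> (history y0 q t $ i) * (LINT s|lebesgue_on {0..t}. v s) $ i)"

definition nonneg_cone :: "(real ^ 'n) set" where
  "nonneg_cone = {\<eta>. \<forall>i. 0 \<le> \<eta> $ i}"

definition dissipation :: "(real \<Rightarrow> real) \<Rightarrow> real ^ 'n \<Rightarrow> real ^ 'n \<Rightarrow> ereal" where
  "dissipation \<kappa> \<zeta> \<eta> =
     (if \<eta> \<in> nonneg_cone then ereal (componentwise \<kappa> \<zeta> \<bullet> \<eta>) else \<infinity>)"

definition dissipation_eps :: "(real \<Rightarrow> real) \<Rightarrow> real \<Rightarrow> real ^ 'n \<Rightarrow> real ^ 'n \<Rightarrow> ereal" where
  "dissipation_eps \<kappa> \<epsilon> \<zeta> \<eta> =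
     (if \<eta> \<in> nonneg_cone then ereal (componentwise \<kappa> \<zeta> \<bullet> \<eta> + \<epsilon> / 2 * (norm \<eta>)\<^sup>2) else \<infinity>)"

definition subdifferential :: "('a::real_inner \<Rightarrow> ereal) \<Rightarrow> 'a \<Rightarrow> 'a set" where
  "subdifferential f x = {g. \<bar>f x\<bar> \<noteq> \<infinity> \<and> (\<forall>y. f x + ereal (g \<bullet> (y - x)) \<le> f y)}"

text \<open>
  The evolution \<open>- \<alpha> q + l \<in> \<partial>\<^sub>2 R(H(q), q')\<close> a.e., \<open>q 0 = 0\<close>, for a general
  dissipation functional \<open>R\<close>.
\<close>

definition is_state ::
    "real \<Rightarrow> real \<Rightarrow> real ^ 'n \<Rightarrow> (real ^ 'n \<Rightarrow> real ^ 'n \<Rightarrow> ereal) \<Rightarrow>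
     (real \<Rightarrow> real ^ 'n) \<Rightarrow> (real \<Rightarrow> real ^ 'n) \<Rightarrow> bool" where
  "is_state T \<alpha> y0 R l q \<longleftrightarrow> q \<in> H10 T \<and>
     (AE t in lebesgue_on {0<..<T}.
        - \<alpha> *\<^sub>R q t + l t \<in> subdifferential (R (history y0 q t)) (weak_deriv {0<..<T} q t))"

definition is_solution_operator ::
    "real \<Rightarrow> real \<Rightarrow> real ^ 'n \<Rightarrow> (real ^ 'n \<Rightarrow> real ^ 'n \<Rightarrow> ereal) \<Rightarrow>
     (real \<Rightarrow> real ^ 'n) set \<Rightarrow> ((real \<Rightarrow> real ^ 'n) \<Rightarrow> real \<Rightarrow> real ^ 'n) \<Rightarrow> bool" where
  "is_solution_operator T \<alpha> y0 R X S \<longleftrightarrow>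
     (\<forall>l\<in>X. is_state T \<alpha> y0 R l (S l) \<and>
        (\<forall>q. is_state T \<alpha> y0 R l q \<longrightarrow> (\<forall>t\<in>{0..T}. q t = S l t)))"


section \<open>The control problems\<close>

definition objective ::
    "real \<Rightarrow> ((real \<Rightarrow> real ^ 'n) \<Rightarrow> real) \<Rightarrow> real ^ 'n \<Rightarrow>
     ((real \<Rightarrow> real ^ 'n) \<Rightarrow> real \<Rightarrow> real ^ 'n) \<Rightarrow> (real \<Rightarrow> real ^ 'n) \<Rightarrow> real" where
  "objective T j qd S l =
     j (S l) + 1 / 2 * (norm (S l T - qd))\<^sup>2 + 1 / 2 * (H1_norm T l)\<^sup>2"

definition objective_eps ::
    "real \<Rightarrow> ((real \<Rightarrow> real ^ 'n) \<Rightarrow> real) \<Rightarrow> real ^ 'n \<Rightarrow>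
     ((real \<Rightarrow> real ^ 'n) \<Rightarrow> real \<Rightarrow> real ^ 'n) \<Rightarrow> (real \<Rightarrow> real ^ 'n) \<Rightarrow> (real \<Rightarrow> real ^ 'n) \<Rightarrow> real" where
  "objective_eps T j qd S_eps l_bar l =
     j (S_eps l) + 1 / 2 * (norm (S_eps l T - qd))\<^sup>2 + 1 / 2 * (H1_norm T l)\<^sup>2
       + 1 / 2 * (H1_norm T (\<lambda>t. l t - l_bar t))\<^sup>2"

definition locally_optimal ::
    "real \<Rightarrow> ((real \<Rightarrow> real ^ 'n) \<Rightarrow> real) \<Rightarrow> (real \<Rightarrow> real ^ 'n) \<Rightarrow> bool" where
  "locally_optimal T F l \<longleftrightarrow> l \<in> H10 T \<and>
     (\<exists>r>0. \<forall>k\<in>H10 T. H1_norm T (\<lambda>t. k t - l t) < r \<longrightarrow> F l \<le> F k)"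


section \<open>The optimality system\<close>

definition optimality_system ::
    "real \<Rightarrow> real \<Rightarrow> real \<Rightarrow> (real \<Rightarrow> real) \<Rightarrow> real ^ 'n \<Rightarrow>
     ((real \<Rightarrow> real ^ 'n) \<Rightarrow> real \<Rightarrow> real ^ 'n) \<Rightarrow> real ^ 'n \<Rightarrow>
     (real \<Rightarrow> real ^ 'n) \<Rightarrow> (real \<Rightarrow> real ^ 'n) \<Rightarrow> (real \<Rightarrow> real ^ 'n) \<Rightarrow>
     (real \<Rightarrow> real ^ 'n) \<Rightarrow> (real \<Rightarrow> real ^ 'n) \<Rightarrow> bool" where
  "optimality_system T \<alpha> \<epsilon> \<kappa> y0 dj qd l_bar l q \<xi> lam \<longleftrightarrow>
     (let z = (\<lambda>t. - \<alpha> *\<^sub>R q t + l t - componentwise \<kappa> (history y0 q t)) in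
     (AE t in lebesgue_on {0<..<T}.
        - weak_deriv {0<..<T} \<xi> t + \<alpha> *\<^sub>R lam t
          + L2_adjoint {0<..<T} (kappa_history_deriv \<kappa> y0 q) lam t = dj q t) \<and>
     \<xi> T = q T - qd \<and>
     (\<forall>i. (AE t in lebesgue_on {0<..<T}. z t $ i \<noteq> 0 \<longrightarrow>
              lam t $ i = 1 / \<epsilon> * indicator {s. z s $ i > 0} t * \<xi> t $ i) \<and>
          (AE t in lebesgue_on {0<..<T}. z t $ i = 0 \<longrightarrow>
              0 \<le> lam t $ i \<and> lam t $ i \<le> 1 / \<epsilon> * \<xi> t $ i)) \<and>
     (\<forall>v\<in>H10 T. L2_inner {0<..<T} lam v + H1_inner T l v
        + H1_inner T (\<lambda>t. l t - l_bar t) v = 0))"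

end

theory Submission
  imports Defs
begin

text \<open>
  By the local optimality of \<open>l\<close> and the Lipschitz estimate for the state in the $L^2$ norm of the
  load, the derivative of the load cost is bounded in the $L^2$ norm on \<open>H10\<close>. The Riesz
  representation theorem thus yields the multiplier \<open>\<lambda>\<close> in $L^2$, and \<open>\<xi>\<close> is the solution of the
  (backward) adjoint equation with this \<open>\<lambda>\<close>.

  For the sign conditions, the driving force $z = -\alpha q + l - \kappa(H(q))$ is used as the control:
  to $z + \tau w$ belongs the state with rate $\max(z + \tau w, 0) / \epsilon$ and an explicit load in
  $L^2$. Since \<open>H10\<close> is dense in $L^2$, local optimality may be tested with such loads. Their
  directional derivative at \<open>\<tau> = 0\<close> and the adjoint equation lead to
  \[ \int_0^T \langle\xi, \max'(z; w)\rangle / \epsilon - \langle\lambda, w\rangle \, dt \ge 0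
     \quad \mbox{for all } w \in L^2, \]
  which implies the pointwise conditions.
\<close>

section \<open>The space $L^2$\<close>

text \<open>The obstacle is the kink of the maximum at 0. Where a component of z vanishes on a set
  of positive measure, the rate responds to a perturbation w by max(w, 0) / \<epsilon>, which is not
  linear in w; so the multiplier cannot be read off as the coefficient of a linearised equation, and
  at the kink it is only confined to an interval. Two facts compensate for this. The state cost
  reacts to a load in the L2 norm, while the H1 terms of the objective involve no state; balancing
  the two bounds \<open>load_cost_deriv v\<close> in L2 although it contains the derivative of v.
  And the loads are unconstrained, so that a single direction w is enough: the violation of the
  wanted sign conditions itself (\<open>residual\<close>), for which the integrand of the inequality
  is minus its square. Sobolev functions are treated throughout as a constant plus a Lebesgue
  primitive \<open>prim\<close>. This turns weak derivatives, the density of \<open>H10\<close> and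
  the adjoint equation into statements about integrals.\<close>

lemma LIMSEQ_bounded_by_null:
  fixes f :: "nat \<Rightarrow> 'a::real_normed_vector"
  assumes "\<And>n. norm (f n - c) \<le> g n" and "g \<longlonglongrightarrow> 0"
  shows "f \<longlonglongrightarrow> c"
  by (rule LIM_zero_cancel, rule Lim_null_comparison) (use assms in auto)

lemma L2_measurable: "f \<in> L2 I \<Longrightarrow> f \<in> borel_measurable (lebesgue_on I)"
  by (simp add: L2_def)

lemma L2_norm_sq_integrable: "f \<in> L2 I \<Longrightarrow> integrable (lebesgue_on I) (\<lambda>t. (norm (f t))\<^sup>2)"
  by (simp add: L2_def)

lemma L2_majorant:
  assumes f: "f \<in> borel_measurable (lebesgue_on I)"
    and g: "integrable (lebesgue_on I) g"
    and le: "AE t in lebesgue_on I. (norm (f t))\<^sup>2 \<le> g t"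
  shows "f \<in> L2 I"
  unfolding L2_def
proof (intro CollectI conjI f)
  show "integrable (lebesgue_on I) (\<lambda>t. (norm (f t))\<^sup>2)"
    using f le by (intro Bochner_Integration.integrable_bound[OF g]) auto
qed

lemma L2_bound:
  assumes f: "f \<in> borel_measurable (lebesgue_on I)" and g: "g \<in> L2 I"
    and le: "AE t in lebesgue_on I. norm (f t) \<le> C * norm (g t)"
  shows "f \<in> L2 I"
proof (rule L2_majorant[OF f, of "\<lambda>t. C\<^sup>2 * (norm (g t))\<^sup>2"])
  show "integrable (lebesgue_on I) (\<lambda>t. C\<^sup>2 * (norm (g t))\<^sup>2)"
    using L2_norm_sq_integrable[OF g] by simp
  show "AE t in lebesgue_on I. (norm (f t))\<^sup>2 \<le> C\<^sup>2 * (norm (g t))\<^sup>2"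
    using le by eventually_elim (metis power_mono norm_ge_zero power_mult_distrib)
qed

lemma L2_scaleR: "f \<in> L2 I \<Longrightarrow> (\<lambda>t. c *\<^sub>R f t) \<in> L2 I"
  by (rule L2_bound[of _ _ f "\<bar>c\<bar>"]) (auto dest: L2_measurable)

lemma L2_add:
  assumes f: "f \<in> L2 I" and g: "g \<in> L2 I"
  shows "(\<lambda>t. f t + g t) \<in> L2 I"
proof (rule L2_majorant[of _ _ "\<lambda>t. 2 * (norm (f t))\<^sup>2 + 2 * (norm (g t))\<^sup>2"])
  show "(\<lambda>t. f t + g t) \<in> borel_measurable (lebesgue_on I)"
    using L2_measurable[OF f] L2_measurable[OF g] by measurable
  show "integrable (lebesgue_on I) (\<lambda>t. 2 * (norm (f t))\<^sup>2 + 2 * (norm (g t))\<^sup>2)"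
    using L2_norm_sq_integrable[OF f] L2_norm_sq_integrable[OF g] by simp
  have "(norm (a + b))\<^sup>2 \<le> 2 * (norm a)\<^sup>2 + 2 * (norm b)\<^sup>2" for a b :: 'a
  proof -
    have "(norm (a + b))\<^sup>2 \<le> (norm a + norm b)\<^sup>2"
      by (simp add: norm_triangle_ineq power_mono)
    also have "\<dots> \<le> 2 * (norm a)\<^sup>2 + 2 * (norm b)\<^sup>2"
      using sum_squares_bound[of "norm a" "norm b"] by (simp add: power2_sum)
    finally show ?thesis .
  qed
  then show "AE t in lebesgue_on I. (norm (f t + g t))\<^sup>2 \<le> 2 * (norm (f t))\<^sup>2 + 2 * (norm (g t))\<^sup>2"
    by simp
qed

lemma L2_minus: "f \<in> L2 I \<Longrightarrow> (\<lambda>t. - f t) \<in> L2 I"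
  using L2_scaleR[of f I "-1"] by simp

lemma L2_diff: "f \<in> L2 I \<Longrightarrow> g \<in> L2 I \<Longrightarrow> (\<lambda>t. f t - g t) \<in> L2 I"
  using L2_add[OF _ L2_minus] by force

lemma L2_zero: "(\<lambda>t. 0) \<in> L2 I"
  by (simp add: L2_def)

lemmas L2_intros = L2_add L2_diff L2_minus L2_scaleR L2_zero

section \<open>Inner product and norm of L2\<close>

lemma L2_inner_integrable:
  assumes f: "f \<in> L2 I" and g: "g \<in> L2 I"
  shows "integrable (lebesgue_on I) (\<lambda>t. f t \<bullet> g t)"
proof (rule Bochner_Integration.integrable_bound)
  show "integrable (lebesgue_on I) (\<lambda>t. (norm (f t))\<^sup>2 + (norm (g t))\<^sup>2)"
    using L2_norm_sq_integrable[OF f] L2_norm_sq_integrable[OF g] by simp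
  show "(\<lambda>t. f t \<bullet> g t) \<in> borel_measurable (lebesgue_on I)"
    using L2_measurable[OF f] L2_measurable[OF g] by measurable
  have "\<bar>a \<bullet> b\<bar> \<le> (norm a)\<^sup>2 + (norm b)\<^sup>2" for a b :: 'a
  proof -
    have "\<bar>a \<bullet> b\<bar> \<le> norm a * norm b" by (rule Cauchy_Schwarz_ineq2)
    moreover have "2 * (norm a * norm b) \<le> (norm a)\<^sup>2 + (norm b)\<^sup>2"
      using sum_squares_bound[of "norm a" "norm b"] by simp
    moreover have "0 \<le> norm a * norm b" by simp
    ultimately show ?thesis by linarith
  qed
  then show "AE t in lebesgue_on I. norm (f t \<bullet> g t) \<le> norm ((norm (f t))\<^sup>2 + (norm (g t))\<^sup>2)"
    by simp
qed

lemma L2_inner_commute: "L2_inner I f g = L2_inner I g f"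
  by (simp add: L2_inner_def inner_commute)

lemma L2_inner_add_left:
  "f \<in> L2 I \<Longrightarrow> g \<in> L2 I \<Longrightarrow> h \<in> L2 I \<Longrightarrow>
     L2_inner I (\<lambda>t. f t + g t) h = L2_inner I f h + L2_inner I g h"
  by (simp add: L2_inner_def inner_add_left L2_inner_integrable)

lemma L2_inner_scaleR_left: "L2_inner I (\<lambda>t. c *\<^sub>R f t) h = c * L2_inner I f h"
  by (simp add: L2_inner_def)

lemma L2_inner_minus_left: "L2_inner I (\<lambda>t. - f t) h = - L2_inner I f h"
  by (simp add: L2_inner_def)

lemma L2_inner_diff_left:
  "f \<in> L2 I \<Longrightarrow> g \<in> L2 I \<Longrightarrow> h \<in> L2 I \<Longrightarrow>
     L2_inner I (\<lambda>t. f t - g t) h = L2_inner I f h - L2_inner I g h"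
  by (simp add: L2_inner_def inner_diff_left L2_inner_integrable)

lemma L2_inner_add_right:
  "f \<in> L2 I \<Longrightarrow> g \<in> L2 I \<Longrightarrow> h \<in> L2 I \<Longrightarrow>
     L2_inner I h (\<lambda>t. f t + g t) = L2_inner I h f + L2_inner I h g"
  by (simp add: L2_inner_commute[of I h] L2_inner_add_left)

lemma L2_inner_diff_right:
  "f \<in> L2 I \<Longrightarrow> g \<in> L2 I \<Longrightarrow> h \<in> L2 I \<Longrightarrow>
     L2_inner I h (\<lambda>t. f t - g t) = L2_inner I h f - L2_inner I h g"
  by (simp add: L2_inner_commute[of I h] L2_inner_diff_left)

lemma L2_inner_scaleR_right: "L2_inner I h (\<lambda>t. c *\<^sub>R f t) = c * L2_inner I h f"
  by (simp add: L2_inner_def)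

lemmas L2_inner_simps = L2_inner_add_left L2_inner_diff_left L2_inner_scaleR_left
  L2_inner_minus_left L2_inner_add_right L2_inner_diff_right L2_inner_scaleR_right

lemma L2_inner_cong_AE:
  assumes "f \<in> borel_measurable (lebesgue_on I)" "g \<in> borel_measurable (lebesgue_on I)"
    "f' \<in> borel_measurable (lebesgue_on I)" "g' \<in> borel_measurable (lebesgue_on I)"
    and "AE t in lebesgue_on I. f t = f' t" "AE t in lebesgue_on I. g t = g' t"
  shows "L2_inner I f g = L2_inner I f' g'"
  unfolding L2_inner_def
proof (rule integral_cong_AE)
  show "AE t in lebesgue_on I. f t \<bullet> g t = f' t \<bullet> g' t"
    using assms(5,6) by eventually_elim simp
qed (use assms in measurable)

lemma L2_inner_self: "L2_inner I f f = (LINT t|lebesgue_on I. (norm (f t))\<^sup>2)"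
  by (simp add: L2_inner_def power2_norm_eq_inner)

lemma L2_inner_nonneg: "0 \<le> L2_inner I f f"
  by (simp add: L2_inner_def)

lemma L2_norm_nonneg: "0 \<le> L2_norm I f"
  by (simp add: L2_norm_def L2_inner_nonneg)

lemma L2_norm_power2: "(L2_norm I f)\<^sup>2 = L2_inner I f f"
  by (simp add: L2_norm_def L2_inner_nonneg)

lemma L2_norm_scaleR: "L2_norm I (\<lambda>t. c *\<^sub>R f t) = \<bar>c\<bar> * L2_norm I f"
  by (simp add: L2_norm_def L2_inner_simps real_sqrt_mult flip: mult.assoc power2_eq_square)

lemma L2_norm_minus_commute: "L2_norm I (\<lambda>t. f t - g t) = L2_norm I (\<lambda>t. g t - f t)"
  by (simp add: L2_norm_def L2_inner_self norm_minus_commute)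

lemma L2_Cauchy_Schwarz:
  assumes f: "f \<in> L2 I" and g: "g \<in> L2 I"
  shows "\<bar>L2_inner I f g\<bar> \<le> L2_norm I f * L2_norm I g"
proof -
  let ?a = "L2_inner I f f" and ?b = "L2_inner I f g" and ?c = "L2_inner I g g"
  have q: "0 \<le> ?a + 2 * x * ?b + x\<^sup>2 * ?c" for x
  proof -
    have "0 \<le> L2_inner I (\<lambda>t. f t + x *\<^sub>R g t) (\<lambda>t. f t + x *\<^sub>R g t)"
      by (rule L2_inner_nonneg)
    also have "\<dots> = ?a + 2 * x * ?b + x\<^sup>2 * ?c"
      using f g by (simp add: L2_inner_simps L2_intros L2_inner_commute[of I g f] power2_eq_square algebra_simps)
    finally show ?thesis .
  qed
  have "?b\<^sup>2 \<le> ?a * ?c"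
  proof (cases "?c = 0")
    case True
    \<comment> \<open>A function of norm zero need not be the zero function, so this case is
      genuine. The quadratic is then affine in x, and the x inserted below would give it the value
      -1.\<close>
    have "?b = 0"
    proof (rule ccontr)
      assume b: "?b \<noteq> 0"
      have "0 \<le> ?a + 2 * (- (?a + 1) / (2 * ?b)) * ?b"
        using q[of "- (?a + 1) / (2 * ?b)"] True by simp
      then show False using b by (simp add: field_simps)
    qed
    then show ?thesis using True by simp
  next
    case False
    then have c: "?c > 0" using L2_inner_nonneg[of I g] by simp
    have "0 \<le> ?a - ?b\<^sup>2 / ?c"
      using q[of "- ?b / ?c"] c by (simp add: power2_eq_square field_simps)
    then show ?thesis using c by (simp add: field_simps)
  qed
  then have "sqrt (?b\<^sup>2) \<le> sqrt (?a * ?c)" by (rule real_sqrt_le_mono)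
  then show ?thesis by (simp add: L2_norm_def real_sqrt_mult)
qed

lemma L2_norm_triangle:
  assumes f: "f \<in> L2 I" and g: "g \<in> L2 I"
  shows "L2_norm I (\<lambda>t. f t + g t) \<le> L2_norm I f + L2_norm I g"
proof (rule power2_le_imp_le)
  have "(L2_norm I (\<lambda>t. f t + g t))\<^sup>2 = L2_inner I f f + 2 * L2_inner I f g + L2_inner I g g"
    using f g by (simp add: L2_norm_power2 L2_inner_simps L2_intros L2_inner_commute[of I g f])
  also have "\<dots> \<le> (L2_norm I f + L2_norm I g)\<^sup>2"
    using L2_Cauchy_Schwarz[OF f g] by (simp add: power2_sum L2_norm_power2)
  finally show "(L2_norm I (\<lambda>t. f t + g t))\<^sup>2 \<le> (L2_norm I f + L2_norm I g)\<^sup>2" .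
qed (simp add: L2_norm_nonneg)

lemma L2_norm_triangle_diff:
  assumes f: "f \<in> L2 I" and g: "g \<in> L2 I"
  shows "L2_norm I (\<lambda>t. f t - g t) \<le> L2_norm I f + L2_norm I g"
  using L2_norm_triangle[OF f L2_minus[OF g]] L2_norm_scaleR[of I "-1" g] by simp

lemma L2_norm_zero_AE:
  assumes f: "f \<in> L2 I" and "L2_inner I f f = 0"
  shows "AE t in lebesgue_on I. f t = 0"
  using integral_nonneg_eq_0_iff_AE[OF L2_norm_sq_integrable[OF f]] assms(2)
  by (simp add: L2_inner_self)

lemma L2_norm_mono:
  assumes f: "f \<in> borel_measurable (lebesgue_on I)" and g: "g \<in> L2 I"
    and le: "AE t in lebesgue_on I. norm (f t) \<le> norm (g t)"
  shows "L2_norm I f \<le> L2_norm I g"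
  unfolding L2_norm_def L2_inner_self
proof (intro real_sqrt_le_mono integral_mono_AE)
  have "f \<in> L2 I" using L2_bound[OF f g, of 1] le by simp
  then show "integrable (lebesgue_on I) (\<lambda>t. (norm (f t))\<^sup>2)" by (rule L2_norm_sq_integrable)
  show "AE t in lebesgue_on I. (norm (f t))\<^sup>2 \<le> (norm (g t))\<^sup>2"
    using le by eventually_elim (simp add: power_mono)
qed (rule L2_norm_sq_integrable[OF g])

section \<open>Completeness and the Riesz representation\<close>

lemma L2_fast_Cauchy_convergent:
  fixes v :: "nat \<Rightarrow> real \<Rightarrow> 'a::euclidean_space"
  assumes v: "\<And>n. v n \<in> L2 I"
    and fast: "\<And>n. L2_inner I (\<lambda>t. v (Suc n) t - v n t) (\<lambda>t. v (Suc n) t - v n t) \<le> C * (1/64)^n"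
  obtains u where "u \<in> L2 I" "(\<lambda>n. L2_norm I (\<lambda>t. v n t - u t)) \<longlonglongrightarrow> 0"
proof -
  let ?M = "lebesgue_on I"
  note [measurable] = L2_measurable[OF v]
  \<comment> \<open>The weight splits the decay 64^-n: the integrals of \<open>f n\<close> keep 4^-n
    and are summable, and \<open>f n t\<close> \<le> \<open>S t\<close> bounds the increment at t by
    sqrt(\<open>S t\<close>) * 4^-n.\<close>
  define f where "f n t = 16^n * (norm (v (Suc n) t - v n t))\<^sup>2" for n t
  have f0: "0 \<le> f n t" for n t by (simp add: f_def)
  have fint: "integrable ?M (f n)" for n
    unfolding f_def by (intro integrable_mult_right L2_norm_sq_integrable L2_diff v)
  have fle: "(LINT t|?M. f n t) \<le> C * (1/4)^n" for n
  proof -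
    have "(LINT t|?M. f n t) = 16^n * L2_inner I (\<lambda>t. v (Suc n) t - v n t) (\<lambda>t. v (Suc n) t - v n t)"
      by (simp add: f_def L2_inner_self)
    also have "\<dots> \<le> 16^n * (C * (1/64)^n)"
      by (rule mult_left_mono[OF fast]) simp
    also have "\<dots> = C * (16 * (1/64))^n"
      unfolding power_mult_distrib by (simp only: mult_ac)
    also have "\<dots> = C * (1/4)^n" by simp
    finally show ?thesis .
  qed
  have sums: "summable (\<lambda>n. LINT t|?M. f n t)"
  proof (rule summable_comparison_test'[of "\<lambda>n. C * (1/4)^n" 0])
    show "summable (\<lambda>n. C * (1/4)^n)"
      by (intro summable_mult summable_geometric) simp
    show "norm (LINT t|?M. f n t) \<le> C * (1/4)^n" for n
      using fle[of n] f0 by (simp add: integral_nonneg_AE)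
  qed
  have "(\<integral>\<^sup>+ t. (\<Sum>n. ennreal (f n t)) \<partial>?M) = (\<Sum>n. \<integral>\<^sup>+ t. ennreal (f n t) \<partial>?M)"
    by (intro nn_integral_suminf) (simp add: f_def)
  also have "\<dots> = (\<Sum>n. ennreal (LINT t|?M. f n t))"
    by (simp add: nn_integral_eq_integral fint f0)
  also have "\<dots> < \<infinity>"
    using sums f0 by (simp add: ennreal_suminf_neq_top less_top[symmetric])
  finally have "AE t in ?M. (\<Sum>n. ennreal (f n t)) \<noteq> \<infinity>"
    by (intro nn_integral_PInf_AE) (auto simp: f_def)
  then have sf: "AE t in ?M. summable (\<lambda>n. f n t)"
  proof eventually_elim
    case (elim t)
    show ?case by (rule summable_suminf_not_top[OF f0]) (use elim in simp)
  qed
  define S where "S t = (\<Sum>n. f n t)" for t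
  have Sint: "integrable ?M S"
    unfolding S_def
  proof (rule integrable_suminf[OF fint])
    show "AE t in ?M. summable (\<lambda>n. norm (f n t))" using sf f0 by simp
    show "summable (\<lambda>n. LINT t|?M. norm (f n t))" using sums f0 by simp
  qed
  \<comment> \<open>Where the sequence diverges \<open>lim\<close> has some unspecified value; that
    happens only on a null set, and measurability does not suffer.\<close>
  define u where "u t = lim (\<lambda>n. v n t)" for t
  have um [measurable]: "u \<in> borel_measurable ?M"
    unfolding u_def by (rule borel_measurable_lim_metric) measurable
  have quarter: "((1/4::real)^n)\<^sup>2 = (1/16)^n" for n
    unfolding power2_eq_square power_mult_distrib[symmetric] by simp
  have bound: "AE t in ?M. \<forall>n. (norm (v n t - u t))\<^sup>2 \<le> 4 * S t * (1/16)^n"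
    using sf
  proof eventually_elim
    fix t assume st: "summable (\<lambda>n. f n t)"
    have S0: "0 \<le> S t" unfolding S_def using st f0 by (intro suminf_nonneg) auto
    have step: "norm (v (Suc n) t - v n t) \<le> sqrt (S t) * (1/4)^n" for n
    proof (rule power2_le_imp_le)
      have "f n t \<le> S t"
        using sum_le_suminf[OF st, of "{n}"] f0 by (simp add: S_def)
      then have "(norm (v (Suc n) t - v n t))\<^sup>2 \<le> S t / 16^n"
        by (simp add: f_def field_simps)
      also have "\<dots> = (sqrt (S t) * (1/4)^n)\<^sup>2"
        using S0 by (simp only: power_mult_distrib quarter) (simp add: power_one_over)
      finally show "(norm (v (Suc n) t - v n t))\<^sup>2 \<le> (sqrt (S t) * (1/4)^n)\<^sup>2" .
    qed (simp add: S0)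
    \<comment> \<open>The factor 1 - (1/4)^k is what lets the induction close; the exact geometric
      constant 4/3 is rounded up to 2.\<close>
    have inc: "norm (v (n + k) t - v n t) \<le> 2 * sqrt (S t) * (1/4)^n * (1 - (1/4)^k)" for n k
    proof (induction k)
      case 0 then show ?case by simp
    next
      case (Suc k)
      have "norm (v (n + Suc k) t - v n t) \<le> norm (v (Suc (n + k)) t - v (n + k) t) + norm (v (n + k) t - v n t)"
        by (metis add_Suc_right norm_triangle_ineq diff_add_cancel add_diff_eq)
      also have "\<dots> \<le> sqrt (S t) * (1/4)^(n+k) + 2 * sqrt (S t) * (1/4)^n * (1 - (1/4)^k)"
        using step Suc by (intro add_mono)
      also have "\<dots> = sqrt (S t) * (1/4)^n * (2 - (1/4)^k)"
        by (simp add: power_add algebra_simps)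
      also have "\<dots> \<le> sqrt (S t) * (1/4)^n * (2 * (1 - (1/4)^Suc k))"
        by (intro mult_left_mono) (use S0 in auto)
      finally show ?case by (simp add: algebra_simps)
    qed
    have inc2: "norm (v (n + k) t - v n t) \<le> 2 * sqrt (S t) * (1/4)^n" for n k
      by (rule order_trans[OF inc], rule mult_left_le) (use S0 in auto)
    have "Cauchy (\<lambda>n. v n t)"
    proof (rule CauchyI')
      fix e :: real assume e: "0 < e"
      have "(\<lambda>n. 2 * sqrt (S t) * (1/4)^n) \<longlonglongrightarrow> 2 * sqrt (S t) * 0"
        by (intro tendsto_intros LIMSEQ_realpow_zero) auto
      then obtain N where N: "\<And>n. n \<ge> N \<Longrightarrow> 2 * sqrt (S t) * (1/4)^n < e"
        using e by (metis (no_types, lifting) eventually_sequentially mult_zero_right order_tendstoD(2))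
      show "\<exists>M. \<forall>m\<ge>M. \<forall>n>m. dist (v m t) (v n t) < e"
      proof (intro exI allI impI)
        fix m n assume "N \<le> m" "m < n"
        then show "dist (v m t) (v n t) < e"
          using inc2[of m "n - m"] N[of m] by (simp add: dist_norm norm_minus_commute)
      qed
    qed
    then have lim: "(\<lambda>n. v n t) \<longlonglongrightarrow> u t"
      unfolding u_def by (simp add: Cauchy_convergent convergent_LIMSEQ_iff[symmetric])
    show "\<forall>n. (norm (v n t - u t))\<^sup>2 \<le> 4 * S t * (1/16)^n"
    proof
      fix n
      have "(\<lambda>k. norm (v (n + k) t - v n t)) \<longlonglongrightarrow> norm (u t - v n t)"
        using LIMSEQ_ignore_initial_segment[OF lim, of n] by (intro tendsto_intros) (simp add: add.commute)
      then have "norm (u t - v n t) \<le> 2 * sqrt (S t) * (1/4)^n"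
        by (rule LIMSEQ_le_const2) (use inc2 in auto)
      then have "(norm (u t - v n t))\<^sup>2 \<le> (2 * sqrt (S t) * (1/4)^n)\<^sup>2"
        by (rule power_mono) simp
      also have "\<dots> = 4 * S t * (1/16)^n"
        using S0 by (simp add: power_mult_distrib quarter)
      finally show "(norm (v n t - u t))\<^sup>2 \<le> 4 * S t * (1/16)^n"
        by (simp add: norm_minus_commute)
    qed
  qed
  have d: "(\<lambda>t. v n t - u t) \<in> L2 I" for n
  proof (rule L2_majorant[of _ _ "\<lambda>t. 4 * S t * (1/16)^n"])
    show "integrable ?M (\<lambda>t. 4 * S t * (1/16)^n)" using Sint by simp
    show "AE t in ?M. (norm (v n t - u t))\<^sup>2 \<le> 4 * S t * (1/16)^n"
      using bound by eventually_elim blast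
  qed measurable
  have uL: "u \<in> L2 I" using L2_diff[OF v[of 0] d[of 0]] by simp
  have "(\<lambda>n. L2_norm I (\<lambda>t. v n t - u t)) \<longlonglongrightarrow> 0"
  proof (rule LIMSEQ_bounded_by_null)
    show "norm (L2_norm I (\<lambda>t. v n t - u t) - 0) \<le> sqrt (4 * (LINT t|?M. S t) * (1/16)^n)" for n
    proof -
      have "L2_inner I (\<lambda>t. v n t - u t) (\<lambda>t. v n t - u t) \<le> (LINT t|?M. 4 * S t * (1/16)^n)"
        unfolding L2_inner_self
      proof (rule integral_mono_AE[OF L2_norm_sq_integrable[OF d]])
        show "integrable ?M (\<lambda>t. 4 * S t * (1/16)^n)" using Sint by simp
        show "AE t in ?M. (norm (v n t - u t))\<^sup>2 \<le> 4 * S t * (1/16)^n"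
          using bound by eventually_elim blast
      qed
      then show ?thesis by (simp add: L2_norm_def L2_inner_nonneg)
    qed
    have "(\<lambda>n. sqrt (4 * (LINT t|?M. S t) * (1/16)^n)) \<longlonglongrightarrow> sqrt (4 * (LINT t|?M. S t) * 0)"
      by (intro tendsto_intros LIMSEQ_realpow_zero) auto
    then show "(\<lambda>n. sqrt (4 * (LINT t|?M. S t) * (1/16)^n)) \<longlonglongrightarrow> 0" by simp
  qed
  then show ?thesis using uL that by blast
qed

text \<open>
  The minimising sequence of \<open>\<parallel>v\<parallel>\<^sup>2 - 2 F v\<close> over \<open>V\<close> is Cauchy by the parallelogram identity,
  and its limit represents \<open>F\<close>.
\<close>

theorem L2_Riesz:
  fixes V :: "(real \<Rightarrow> 'a::euclidean_space) set"
  assumes VL: "V \<subseteq> L2 I" and V0: "(\<lambda>t. 0) \<in> V"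
    and Vadd: "\<And>u v. u \<in> V \<Longrightarrow> v \<in> V \<Longrightarrow> (\<lambda>t. u t + v t) \<in> V"
    and Vscale: "\<And>c v. v \<in> V \<Longrightarrow> (\<lambda>t. c *\<^sub>R v t) \<in> V"
    and Fadd: "\<And>u v. u \<in> V \<Longrightarrow> v \<in> V \<Longrightarrow> F (\<lambda>t. u t + v t) = F u + F v"
    and Fscale: "\<And>c v. v \<in> V \<Longrightarrow> F (\<lambda>t. c *\<^sub>R v t) = c * F v"
    and Fbound: "\<And>v. v \<in> V \<Longrightarrow> F v \<le> C * L2_norm I v"
  obtains u v where "u \<in> L2 I" "\<And>w. w \<in> V \<Longrightarrow> F w = L2_inner I u w"
    "\<And>n::nat. v n \<in> V" "(\<lambda>n. L2_norm I (\<lambda>t. v n t - u t)) \<longlonglongrightarrow> 0"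
proof -
  define E where "E v = L2_inner I v v - 2 * F v" for v
  have VL': "v \<in> L2 I" if "v \<in> V" for v using VL that by blast
  have Elow: "- C\<^sup>2 \<le> E v" if "v \<in> V" for v
  proof -
    have "0 \<le> (L2_norm I v - C)\<^sup>2" by simp
    also have "\<dots> \<le> E v + C\<^sup>2"
      using Fbound[OF that] by (simp add: E_def power2_diff L2_norm_power2 mult.commute)
    finally show ?thesis by simp
  qed
  define m where "m = Inf (E ` V)"
  have bdd: "bdd_below (E ` V)" using Elow by (auto intro!: bdd_belowI)
  have mle: "m \<le> E v" if "v \<in> V" for v
    unfolding m_def using bdd that by (intro cInf_lower) auto
  \<comment> \<open>The tolerance 64^-n is dictated by \<open>L2_fast_Cauchy_convergent\<close>: by
    \<open>par\<close>, consecutive members then differ in squared norm by at most 4 *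
    64^-n.\<close>
  have "\<exists>v\<in>V. E v < m + (1/64)^n" for n :: nat
  proof -
    have "Inf (E ` V) < m + (1/64)^n" by (simp add: m_def)
    then show ?thesis using cInf_lessD[of "E ` V"] V0 by blast
  qed
  then obtain v where vV: "\<And>n::nat. v n \<in> V" and vE: "\<And>n. E (v n) < m + (1/64)^n" by metis
  have vL: "v n \<in> L2 I" for n by (rule VL'[OF vV])
  have par: "L2_inner I (\<lambda>t. a t - b t) (\<lambda>t. a t - b t) \<le> 2 * E a + 2 * E b - 4 * m"
    if a: "a \<in> V" and b: "b \<in> V" for a b
  proof -
    let ?h = "\<lambda>t. (1/2) *\<^sub>R (a t + b t)"
    have hV: "?h \<in> V" by (intro Vscale Vadd a b)
    have "L2_inner I (\<lambda>t. a t - b t) (\<lambda>t. a t - b t) = 2 * E a + 2 * E b - 4 * E ?h"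
      unfolding E_def Fscale[OF Vadd[OF a b]] Fadd[OF a b]
      using VL'[OF a] VL'[OF b]
      by (simp add: L2_inner_simps L2_intros L2_inner_commute[of I b a] field_simps)
    then show ?thesis using mle[OF hV] by simp
  qed
  have "L2_inner I (\<lambda>t. v (Suc n) t - v n t) (\<lambda>t. v (Suc n) t - v n t) \<le> 4 * (1/64)^n" for n
  proof -
    have "0 \<le> (1/64::real)^n" by simp
    moreover have "E (v (Suc n)) < m + (1/64) * (1/64)^n"
      using vE[of "Suc n"] by simp
    ultimately show ?thesis
      using par[OF vV[of "Suc n"] vV[of n]] vE[of n] by linarith
  qed
  from L2_fast_Cauchy_convergent[OF vL this]
  obtain u where uL: "u \<in> L2 I" and lim: "(\<lambda>n. L2_norm I (\<lambda>t. v n t - u t)) \<longlonglongrightarrow> 0" by blast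
  have rep: "F w = L2_inner I u w" if w: "w \<in> V" for w
  proof -
    have wL: "w \<in> L2 I" by (rule VL'[OF w])
    have lim_inner: "(\<lambda>n. L2_inner I (v n) w) \<longlonglongrightarrow> L2_inner I u w"
    proof (rule LIMSEQ_bounded_by_null)
      show "norm (L2_inner I (v n) w - L2_inner I u w) \<le> L2_norm I (\<lambda>t. v n t - u t) * L2_norm I w" for n
        using L2_Cauchy_Schwarz[OF L2_diff[OF vL uL] wL] vL uL wL
        by (simp add: L2_inner_simps)
      show "(\<lambda>n. L2_norm I (\<lambda>t. v n t - u t) * L2_norm I w) \<longlonglongrightarrow> 0"
        using tendsto_mult_left_zero[OF lim] .
    qed
    \<comment> \<open>The infimum need not be attained in \<open>V\<close>, which is not assumed
      closed. Near-minimality of \<open>v n\<close> is therefore tested in the direction w, with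
      error 64^-n, and the limit is taken afterwards.\<close>
    have q: "0 \<le> 2 * s * (L2_inner I u w - F w) + s\<^sup>2 * L2_inner I w w" for s
    proof (rule tendsto_lowerbound)
      have "(\<lambda>n. 2 * s * (L2_inner I (v n) w - F w) + s\<^sup>2 * L2_inner I w w + (1/64::real)^n)
          \<longlonglongrightarrow> 2 * s * (L2_inner I u w - F w) + s\<^sup>2 * L2_inner I w w + 0"
        by (intro tendsto_add tendsto_mult tendsto_diff lim_inner tendsto_const LIMSEQ_realpow_zero) auto
      then show "(\<lambda>n. 2 * s * (L2_inner I (v n) w - F w) + s\<^sup>2 * L2_inner I w w + (1/64)^n)
          \<longlonglongrightarrow> 2 * s * (L2_inner I u w - F w) + s\<^sup>2 * L2_inner I w w" by simp
      have "0 \<le> 2 * s * (L2_inner I (v n) w - F w) + s\<^sup>2 * L2_inner I w w + (1/64)^n" for n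
      proof -
        have "m \<le> E (\<lambda>t. v n t + s *\<^sub>R w t)"
          by (intro mle Vadd Vscale vV w)
        also have "\<dots> = E (v n) + 2 * s * (L2_inner I (v n) w - F w) + s\<^sup>2 * L2_inner I w w"
          unfolding E_def Fadd[OF vV Vscale[OF w]] Fscale[OF w] using vL wL
          by (simp add: L2_inner_simps L2_intros L2_inner_commute[of I w "v n"] power2_eq_square algebra_simps)
        finally show ?thesis using vE[of n] by simp
      qed
      then show "\<forall>\<^sub>F n in sequentially. 0 \<le> 2 * s * (L2_inner I (v n) w - F w) + s\<^sup>2 * L2_inner I w w + (1/64)^n"
        by simp
    qed simp
    \<comment> \<open>By \<open>q\<close> a quadratic in s that vanishes at 0 is nonnegative, so its
      linear coefficient \<open>d\<close> must be 0. The added 1 in \<open>c\<close> permits the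
      choice s = -d/c even if w has norm zero.\<close>
    define d where "d = L2_inner I u w - F w"
    define c where "c = L2_inner I w w + 1"
    have c: "c > 0" using L2_inner_nonneg[of I w] by (simp add: c_def)
    have "0 \<le> 2 * (- d / c) * d + (- d / c)\<^sup>2 * L2_inner I w w"
      using q[of "- d / c"] by (simp only: d_def)
    also have "\<dots> \<le> 2 * (- d / c) * d + (- d / c)\<^sup>2 * c"
      by (intro add_left_mono mult_left_mono) (auto simp: c_def)
    also have "\<dots> = - (d\<^sup>2 / c)" using c by (simp add: power2_eq_square field_simps)
    finally have "d\<^sup>2 \<le> 0" using c by (simp add: field_simps)
    then show ?thesis by (simp add: d_def)
  qed
  show ?thesis by (rule that[OF uL rep vV lim])
qed

section \<open>Primitives on an interval\<close>

abbreviation LM :: "real \<Rightarrow> real measure" where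
  "LM T \<equiv> lebesgue_on {0<..<T}"

lemma finite_measure_LM: "finite_measure (LM T)"
  by (rule finite_measure_lebesgue_on) (simp add: bounded_set_imp_lmeasurable)

lemma borel_imp_lebesgue_on: "f \<in> borel_measurable borel \<Longrightarrow> f \<in> borel_measurable (lebesgue_on I)"
  by (simp add: measurable_completion measurable_restrict_space1)

lemma continuous_on_borel_LM:
  fixes f :: "real \<Rightarrow> 'a::euclidean_space"
  assumes "continuous_on {0..T} f"
  shows "f \<in> borel_measurable (LM T)"
  by (rule continuous_imp_measurable_on_sets_lebesgue)
    (auto intro: continuous_on_subset[OF assms])

lemma indicator_atMost_measurable [measurable]:
  "(\<lambda>s. indicator {..t} s :: real) \<in> borel_measurable (lebesgue_on I)"
  for t :: real
  by (rule borel_imp_lebesgue_on) measurable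

lemma singleton_LM: "{x} \<in> sets (LM T)" if "x \<in> {0<..<T}"
  using that by (simp add: sets_restrict_space_iff)

lemma emeasure_singleton_LM: "emeasure (LM T) {x} = 0"
proof (cases "x \<in> {0<..<T}")
  case True
  then show ?thesis by (simp add: emeasure_restrict_space)
next
  case False
  then have "{x} \<notin> sets (LM T)" using sets.sets_into_space[of "{x}" "LM T"] by auto
  then show ?thesis by (rule emeasure_notin_sets)
qed

lemma AE_LM_neq: "AE s in LM T. s \<noteq> x"
proof (rule AE_I[where N = "{x} \<inter> {0<..<T}"])
  show "{x} \<inter> {0<..<T} \<in> sets (LM T)"
    by (cases "x \<in> {0<..<T}") (auto simp: singleton_LM)
  show "emeasure (LM T) ({x} \<inter> {0<..<T}) = 0"
    by (cases "x \<in> {0<..<T}") (auto simp: emeasure_singleton_LM)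
qed auto

lemma L2_integrable: "integrable (LM T) f" if f: "f \<in> L2 {0<..<T}"
proof (rule Bochner_Integration.integrable_bound)
  show "integrable (LM T) (\<lambda>t. 1 + (norm (f t))\<^sup>2)"
    by (intro Bochner_Integration.integrable_add L2_norm_sq_integrable[OF f]
        finite_measure.integrable_const[OF finite_measure_LM])
  show "f \<in> borel_measurable (LM T)" by (rule L2_measurable[OF f])
  have "x \<le> 1 + x\<^sup>2" for x :: real
    using sum_squares_bound[of x 1] zero_le_power2[of x] by (simp only: power_one mult_1_right)
  then show "AE t in LM T. norm (f t) \<le> norm (1 + (norm (f t))\<^sup>2)"
    by (simp add: add_nonneg_nonneg)
qed

lemma L2_AE_bounded:
  assumes "f \<in> borel_measurable (LM T)" "AE t in LM T. norm (f t) \<le> C"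
  shows "f \<in> L2 {0<..<T}"
proof (rule L2_majorant[OF assms(1), of "\<lambda>_. C\<^sup>2"])
  show "integrable (LM T) (\<lambda>_. C\<^sup>2)"
    by (rule finite_measure.integrable_const[OF finite_measure_LM])
  show "AE t in LM T. (norm (f t))\<^sup>2 \<le> C\<^sup>2"
    using assms(2) by eventually_elim (simp add: power_mono)
qed

lemma Linf_L2: "f \<in> Linf {0<..<T} \<Longrightarrow> f \<in> L2 {0<..<T}"
  unfolding Linf_def using L2_AE_bounded by blast

lemma continuous_on_L2:
  fixes f :: "real \<Rightarrow> 'a::euclidean_space"
  assumes "continuous_on {0..T} f"
  shows "f \<in> L2 {0<..<T}"
proof -
  have "bounded (f ` {0..T})"
    by (intro compact_imp_bounded compact_continuous_image assms compact_Icc)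
  then obtain C where "\<forall>x\<in>f ` {0..T}. norm x \<le> C"
    unfolding bounded_iff by blast
  then show ?thesis
    by (intro L2_AE_bounded[of _ _ C] continuous_on_borel_LM assms AE_I2) auto
qed

lemma integral_component:
  fixes f :: "'b \<Rightarrow> 'a::euclidean_space"
  assumes "integrable M f"
  shows "(LINT s|M. f s) \<bullet> b = (LINT s|M. f s \<bullet> b)"
  using assms by simp

lemma L2_norm_const: "L2_norm {0<..<T} (\<lambda>_. c) = sqrt T * norm c" if "0 \<le> T"
proof -
  have "measure (LM T) {0<..<T} = T"
    using that by (simp add: measure_restrict_space)
  then show ?thesis
    by (simp add: L2_norm_def L2_inner_def real_sqrt_mult norm_eq_sqrt_inner)
qed

lemma L2_norm_le_sup:
  assumes T: "0 \<le> T" and f: "f \<in> L2 {0<..<T}" and le: "\<And>t. t \<in> {0..T} \<Longrightarrow> norm (f t) \<le> c"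
  shows "L2_norm {0<..<T} f \<le> sqrt T * c"
proof -
  have c: "0 \<le> c" by (rule order_trans[OF norm_ge_zero le[of 0]]) (use T in simp)
  have "L2_norm {0<..<T} f \<le> L2_norm {0<..<T} (\<lambda>_. c)"
    by (rule L2_norm_mono[OF L2_measurable[OF f] continuous_on_L2], simp, rule AE_I2) (use le c in simp)
  then show ?thesis using L2_norm_const[OF T, of c] c by simp
qed

lemma L2_integral_norm_le:
  assumes "0 \<le> T" "f \<in> L2 {0<..<T}"
  shows "(LINT s|LM T. norm (f s)) \<le> sqrt T * L2_norm {0<..<T} f"
proof -
  have n: "(\<lambda>t. norm (f t)) \<in> L2 {0<..<T}"
    using L2_measurable[OF assms(2)] by (intro L2_bound[OF _ assms(2), of _ 1]) auto
  have c: "(\<lambda>t. 1::real) \<in> L2 {0<..<T}" by (rule continuous_on_L2) simp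
  have "(LINT s|LM T. norm (f s)) \<le> \<bar>L2_inner {0<..<T} (\<lambda>_. 1) (\<lambda>t. norm (f t))\<bar>"
    by (simp add: L2_inner_def)
  also have "\<dots> \<le> sqrt T * L2_norm {0<..<T} (\<lambda>t. norm (f t))"
    using L2_Cauchy_Schwarz[OF c n] L2_norm_const[OF assms(1), of "1::real"] by simp
  also have "L2_norm {0<..<T} (\<lambda>t. norm (f t)) = L2_norm {0<..<T} f"
    by (simp add: L2_norm_def L2_inner_self)
  finally show ?thesis .
qed

text \<open>The upper limit sits in an indicator, so the measure does not depend on t. Dominated
  convergence and Fubini then apply directly, and \<open>prim\<close> is defined for every real t;
  on [0, T] it is the integral occurring in \<open>history\<close>.\<close>

definition prim :: "real \<Rightarrow> (real \<Rightarrow> 'a::euclidean_space) \<Rightarrow> real \<Rightarrow> 'a" where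
  "prim T g t = (LINT s|LM T. indicator {..t} s *\<^sub>R g s)"

lemma indicator_integrable:
  fixes g :: "real \<Rightarrow> 'a::euclidean_space"
  assumes "integrable (LM T) g"
  shows "integrable (LM T) (\<lambda>s. indicator {..t} s *\<^sub>R g s)"
proof (rule Bochner_Integration.integrable_bound[OF assms])
  show "(\<lambda>s. indicator {..t} s *\<^sub>R g s) \<in> borel_measurable (LM T)"
    using borel_measurable_integrable[OF assms] by measurable
qed (auto simp: indicator_def)

lemma prim_eq_integral:
  assumes "t \<in> {0..T}"
  shows "prim T g t = (LINT s|lebesgue_on {0..t}. g s)"
proof -
  have "prim T g t = (LINT s|lebesgue. indicator {0<..<T} s *\<^sub>R indicator {..t} s *\<^sub>R g s)"
    unfolding prim_def by (subst integral_restrict_space) auto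
  also have "\<dots> = (LINT s|lebesgue. indicator {0..t} s *\<^sub>R g s)"
    by (rule integral_discrete_difference[of "{0,t}"]) (use assms in \<open>auto simp: indicator_def\<close>)
  also have "\<dots> = (LINT s|lebesgue_on {0..t}. g s)"
    by (subst integral_restrict_space) auto
  finally show ?thesis .
qed

lemma prim_0 [simp]: "prim T g 0 = 0"
proof -
  have "prim T g 0 = (LINT s|LM T. 0)"
    unfolding prim_def by (intro Bochner_Integration.integral_cong) (auto simp: indicator_def)
  then show ?thesis by simp
qed

lemma prim_T: "prim T g T = (LINT s|LM T. g s)"
  unfolding prim_def by (intro Bochner_Integration.integral_cong) (auto simp: indicator_def)

lemma prim_add:
  "integrable (LM T) f \<Longrightarrow> integrable (LM T) g \<Longrightarrow> prim T (\<lambda>t. f t + g t) t = prim T f t + prim T g t"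
  by (simp add: prim_def scaleR_add_right indicator_integrable)

lemma prim_diff:
  "integrable (LM T) f \<Longrightarrow> integrable (LM T) g \<Longrightarrow> prim T (\<lambda>t. f t - g t) t = prim T f t - prim T g t"
  by (simp add: prim_def scaleR_diff_right indicator_integrable)

lemma prim_scaleR: "prim T (\<lambda>t. c *\<^sub>R f t) t = c *\<^sub>R prim T f t"
proof -
  have "prim T (\<lambda>t. c *\<^sub>R f t) t = (LINT s|LM T. c *\<^sub>R indicator {..t} s *\<^sub>R f s)"
    by (simp add: prim_def mult.commute)
  then show ?thesis by (simp only: prim_def integral_scaleR_right)
qed

lemma prim_cong: "(\<And>s. s \<in> {0<..<T} \<Longrightarrow> f s = g s) \<Longrightarrow> prim T f t = prim T g t"
  unfolding prim_def by (rule Bochner_Integration.integral_cong) auto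

lemma prim_component: "integrable (LM T) f \<Longrightarrow> prim T (\<lambda>s. f s \<bullet> b) t = prim T f t \<bullet> b"
  using integral_component[OF indicator_integrable[of T f t], of b] by (simp add: prim_def)

lemma prim_cong_AE:
  assumes "f \<in> borel_measurable (LM T)" "g \<in> borel_measurable (LM T)" "AE t in LM T. f t = g t"
  shows "prim T f t = prim T g t"
  unfolding prim_def
proof (rule integral_cong_AE)
  show "AE s in LM T. indicator {..t} s *\<^sub>R f s = indicator {..t} s *\<^sub>R g s"
    using assms(3) by eventually_elim simp
qed (use assms in measurable)

lemma norm_prim_le:
  assumes f: "f \<in> borel_measurable (LM T)" and g: "integrable (LM T) g"
    and le: "AE s in LM T. s \<le> t \<longrightarrow> norm (f s) \<le> g s"
  shows "norm (prim T f t) \<le> prim T g t"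
proof -
  have "norm (prim T f t) \<le> (LINT s|LM T. norm (indicator {..t} s *\<^sub>R f s))"
    unfolding prim_def by (rule integral_norm_bound)
  also have "\<dots> \<le> prim T g t"
    unfolding prim_def
  proof (rule integral_mono_AE[OF _ indicator_integrable[OF g]])
    show ae: "AE s in LM T. norm (indicator {..t} s *\<^sub>R f s) \<le> indicator {..t} s *\<^sub>R g s"
      using le by eventually_elim (auto simp: indicator_def)
    show "integrable (LM T) (\<lambda>s. norm (indicator {..t} s *\<^sub>R f s))"
    proof (rule Bochner_Integration.integrable_bound[OF indicator_integrable[OF g, of t]])
      show "(\<lambda>s. norm (indicator {..t} s *\<^sub>R f s)) \<in> borel_measurable (LM T)"
        using f by measurable
      show "AE s in LM T. norm (norm (indicator {..t} s *\<^sub>R f s)) \<le> norm (indicator {..t} s *\<^sub>R g s)"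
        using ae by eventually_elim (simp del: norm_scaleR)
    qed
  qed
  finally show ?thesis .
qed

lemma norm_prim_le_integral:
  assumes "integrable (LM T) f"
  shows "norm (prim T f t) \<le> (LINT s|LM T. norm (f s))"
proof -
  have "norm (prim T f t) \<le> prim T (\<lambda>s. norm (f s)) t"
    using assms by (intro norm_prim_le) auto
  also have "\<dots> \<le> (LINT s|LM T. norm (f s))"
    unfolding prim_def
    using integrable_norm[OF assms]
    by (intro integral_mono indicator_integrable) (auto simp: indicator_def)
  finally show ?thesis .
qed

lemma norm_prim_le_const:
  fixes f :: "real \<Rightarrow> 'a::euclidean_space"
  assumes T: "0 \<le> T" and f: "integrable (LM T) f" and le: "\<And>s. s \<in> {0..T} \<Longrightarrow> norm (f s) \<le> c"
  shows "norm (prim T f t) \<le> T * c"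
proof -
  have "norm (prim T f t) \<le> (LINT s|LM T. norm (f s))" by (rule norm_prim_le_integral[OF f])
  also have "\<dots> \<le> (LINT s|LM T. c)"
    using f le by (intro integral_mono finite_measure.integrable_const[OF finite_measure_LM] integrable_norm) auto
  also have "\<dots> = T * c" using T by (simp add: measure_restrict_space)
  finally show ?thesis .
qed

lemma norm_prim_le_L2:
  assumes "0 \<le> T" "f \<in> L2 {0<..<T}"
  shows "norm (prim T f t) \<le> sqrt T * L2_norm {0<..<T} f"
  using norm_prim_le_integral[OF L2_integrable[OF assms(2)]] L2_integral_norm_le[OF assms]
  by (rule order_trans)

lemma continuous_on_prim:
  assumes "integrable (LM T) g"
  shows "continuous_on X (prim T g)"
proof -
  have "isCont (prim T g) t" for t
    unfolding continuous_at_sequentially comp_def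
  proof (intro allI impI)
    fix x assume x: "x \<longlonglongrightarrow> t"
    show "(\<lambda>n. prim T g (x n)) \<longlonglongrightarrow> prim T g t"
      unfolding prim_def
    proof (rule integral_dominated_convergence[where w = "\<lambda>s. norm (g s)"])
      note [measurable] = borel_measurable_integrable[OF assms]
      show "(\<lambda>s. indicator {..t} s *\<^sub>R g s) \<in> borel_measurable (LM T)" by measurable
      show "(\<lambda>s. indicator {..x n} s *\<^sub>R g s) \<in> borel_measurable (LM T)" for n by measurable
      show "integrable (LM T) (\<lambda>s. norm (g s))" using assms by simp
      show "AE s in LM T. norm (indicator {..x n} s *\<^sub>R g s) \<le> norm (g s)" for n
        by (auto simp: indicator_def)
      \<comment> \<open>For s different from t the indicators are eventually constant; the
        exceptional point s = t is null.\<close>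
      show "AE s in LM T. (\<lambda>n. indicator {..x n} s *\<^sub>R g s) \<longlonglongrightarrow> indicator {..t} s *\<^sub>R g s"
        using AE_LM_neq[of t T]
      proof eventually_elim
        case (elim s)
        have "\<forall>\<^sub>F n in sequentially. indicator {..x n} s *\<^sub>R g s = indicator {..t} s *\<^sub>R g s"
        proof (cases "s < t")
          case True
          then have "\<forall>\<^sub>F n in sequentially. s < x n" using order_tendstoD(1)[OF x] by blast
          then show ?thesis by eventually_elim (use True in \<open>auto simp: indicator_def\<close>)
        next
          case False
          then have "t < s" using elim by simp
          then have "\<forall>\<^sub>F n in sequentially. x n < s" using order_tendstoD(2)[OF x] by blast
          then show ?thesis by eventually_elim (use \<open>t < s\<close> in \<open>auto simp: indicator_def\<close>)
        qed
        then show ?case by (rule tendsto_eventually)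
      qed
    qed
  qed
  then show ?thesis by (simp add: continuous_at_imp_continuous_on)
qed

lemma prim_L2: "integrable (LM T) g \<Longrightarrow> prim T g \<in> L2 {0<..<T}"
  by (rule continuous_on_L2) (rule continuous_on_prim)

section \<open>Integration by parts and vanishing primitives\<close>

text \<open>The product f(s) g(t) is integrated over the square. The part with t \<le> s gives the
  first integral, and the part with s \<le> t, after exchanging the order, gives the second. The
  diagonal is counted twice but is null.\<close>

lemma prim_parts_real:
  fixes f g :: "real \<Rightarrow> real"
  assumes f: "integrable (LM T) f" and g: "integrable (LM T) g"
  shows "(LINT s|LM T. f s * prim T g s) + (LINT s|LM T. prim T f s * g s) = prim T f T * prim T g T"
proof -
  let ?M = "LM T"
  interpret finite_measure ?M by (rule finite_measure_LM)
  interpret P: pair_sigma_finite ?M ?M ..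
  note [measurable] = borel_measurable_integrable[OF f] borel_measurable_integrable[OF g]
  have idm [measurable]: "(\<lambda>x. x) \<in> ?M \<rightarrow>\<^sub>M (borel :: real measure)"
    by (rule borel_imp_lebesgue_on) simp
  have [measurable]: "fst \<in> ?M \<Otimes>\<^sub>M ?M \<rightarrow>\<^sub>M (borel :: real measure)" "snd \<in> ?M \<Otimes>\<^sub>M ?M \<rightarrow>\<^sub>M (borel :: real measure)"
    using measurable_compose[OF measurable_fst idm] measurable_compose[OF measurable_snd idm] by auto
  define K where "K s t = (if s \<le> t then f s * g t else 0)" for s t
  have Km: "case_prod K \<in> borel_measurable (?M \<Otimes>\<^sub>M ?M)"
    unfolding K_def by measurable
  have Kint: "integrable (?M \<Otimes>\<^sub>M ?M) (case_prod K)"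
  proof (rule Bochner_Integration.integrable_bound[OF _ Km])
    show "integrable (?M \<Otimes>\<^sub>M ?M) (\<lambda>(s,t). f s * g t)"
    proof (rule P.Fubini_integrable)
      have "(\<lambda>s. LINT t|?M. norm (case (s, t) of (s, t) \<Rightarrow> f s * g t)) = (\<lambda>s. \<bar>f s\<bar> * (LINT t|?M. \<bar>g t\<bar>))"
        by (simp add: abs_mult)
      then show "integrable ?M (\<lambda>s. LINT t|?M. norm (case (s, t) of (s, t) \<Rightarrow> f s * g t))"
        using f by simp
      show "AE s in ?M. integrable ?M (\<lambda>t. case (s, t) of (s, t) \<Rightarrow> f s * g t)"
        using g by simp
    qed measurable
  qed (auto simp: K_def)
  have pg: "f s * prim T g s = (LINT t|?M. f s * (indicator {..s} t * g t))" for s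
    unfolding prim_def by simp
  have pf: "prim T f t * g t = (LINT s|?M. K s t)" for t
  proof -
    have "prim T f t * g t = (LINT s|?M. (indicator {..t} s * f s) * g t)"
      by (simp add: prim_def)
    also have "\<dots> = (LINT s|?M. K s t)"
      by (intro Bochner_Integration.integral_cong) (auto simp: K_def indicator_def)
    finally show ?thesis .
  qed
  have "(LINT t|?M. prim T f t * g t) = (LINT s|?M. LINT t|?M. K s t)"
    unfolding pf by (rule P.Fubini_integral[OF Kint])
  moreover have "(LINT s|?M. f s * prim T g s) + (LINT s|?M. LINT t|?M. K s t)
    = (LINT s|?M. f s * prim T g s + (LINT t|?M. K s t))"
  proof (rule Bochner_Integration.integral_add[symmetric])
    show "integrable ?M (\<lambda>s. LINT t|?M. K s t)"
      using P.integrable_fst'[OF Kint] by simp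
    obtain C where C: "\<And>s. norm (prim T g s) \<le> C"
      using norm_prim_le_integral[OF g] by blast
    show "integrable ?M (\<lambda>s. f s * prim T g s)"
    proof (rule Bochner_Integration.integrable_bound)
      show "integrable ?M (\<lambda>s. C * f s)" using f by simp
      have "prim T g \<in> borel_measurable ?M" by (rule L2_measurable[OF prim_L2[OF g]])
      then show "(\<lambda>s. f s * prim T g s) \<in> borel_measurable ?M" by measurable
      show "AE s in ?M. norm (f s * prim T g s) \<le> norm (C * f s)"
      proof (rule AE_I2)
        fix s
        have "\<bar>prim T g s\<bar> \<le> \<bar>C\<bar>" using C[of s] by simp
        then show "norm (f s * prim T g s) \<le> norm (C * f s)"
          by (simp add: abs_mult mult.commute[of "\<bar>C\<bar>"] mult_left_mono)
      qed
    qed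
  qed
  moreover have "f s * prim T g s + (LINT t|?M. K s t) = f s * prim T g T" for s
  proof -
    have "f s * prim T g s + (LINT t|?M. K s t) = (LINT t|?M. f s * (indicator {..s} t * g t) + K s t)"
      unfolding pg
    proof (rule Bochner_Integration.integral_add[symmetric])
      show "integrable ?M (\<lambda>t. f s * (indicator {..s} t * g t))"
        using indicator_integrable[OF g, of s] by simp
      show "integrable ?M (K s)"
      proof (rule Bochner_Integration.integrable_bound)
        show "integrable ?M (\<lambda>t. f s * g t)" using g by simp
        show "K s \<in> borel_measurable ?M" unfolding K_def by measurable
      qed (auto simp: K_def)
    qed
    also have "\<dots> = (LINT t|?M. f s * g t)"
    proof (rule integral_cong_AE)
      show "AE t in ?M. f s * (indicator {..s} t * g t) + K s t = f s * g t"
        using AE_LM_neq[of s T] by eventually_elim (auto simp: K_def indicator_def)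
      show "(\<lambda>t. f s * (indicator {..s} t * g t) + K s t) \<in> borel_measurable ?M"
        unfolding K_def by measurable
    qed measurable
    also have "\<dots> = f s * prim T g T" by (simp add: prim_T)
    finally show ?thesis .
  qed
  ultimately show ?thesis by (simp add: prim_T)
qed

lemma L2_inner_components:
  assumes "f \<in> L2 I" "g \<in> L2 I"
  shows "L2_inner I f g = (\<Sum>b\<in>Basis. LINT s|lebesgue_on I. (f s \<bullet> b) * (g s \<bullet> b))"
proof -
  have c: "(\<lambda>s. h s \<bullet> b) \<in> L2 I" if "h \<in> L2 I" "b \<in> Basis" for h :: "real \<Rightarrow> 'a" and b
  proof (rule L2_bound[OF _ that(1), of _ 1])
    show "(\<lambda>s. h s \<bullet> b) \<in> borel_measurable (lebesgue_on I)"
      using L2_measurable[OF that(1)] by measurable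
  qed (use Basis_le_norm[OF that(2)] in simp)
  have "L2_inner I f g = (LINT s|lebesgue_on I. (\<Sum>b\<in>Basis. (f s \<bullet> b) * (g s \<bullet> b)))"
    unfolding L2_inner_def by (subst euclidean_inner) simp
  also have "\<dots> = (\<Sum>b\<in>Basis. LINT s|lebesgue_on I. (f s \<bullet> b) * (g s \<bullet> b))"
  proof (rule Bochner_Integration.integral_sum)
    fix b :: 'a assume "b \<in> Basis"
    then show "integrable (lebesgue_on I) (\<lambda>s. (f s \<bullet> b) * (g s \<bullet> b))"
      using L2_inner_integrable[OF c[OF assms(1)] c[OF assms(2)]] by simp
  qed
  finally show ?thesis .
qed

lemma prim_parts:
  assumes f: "f \<in> L2 {0<..<T}" and g: "g \<in> L2 {0<..<T}"
  shows "L2_inner {0<..<T} f (prim T g) + L2_inner {0<..<T} (prim T f) g = prim T f T \<bullet> prim T g T"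
proof -
  have fi: "integrable (LM T) f" and gi: "integrable (LM T) g"
    using f g by (auto intro: L2_integrable)
  have "(LINT s|LM T. (f s \<bullet> b) * (prim T g s \<bullet> b)) + (LINT s|LM T. (prim T f s \<bullet> b) * (g s \<bullet> b))
      = (prim T f T \<bullet> b) * (prim T g T \<bullet> b)" for b
    using prim_parts_real[of T "\<lambda>s. f s \<bullet> b" "\<lambda>s. g s \<bullet> b"] fi gi
    by (simp add: prim_component)
  then show ?thesis
    unfolding L2_inner_components[OF f prim_L2[OF gi]] L2_inner_components[OF prim_L2[OF fi] g]
      euclidean_inner[of "prim T f T" "prim T g T"]
    by (simp add: sum.distrib[symmetric])
qed

text \<open>The half-lines {..a} generate the Borel sets and are closed under intersection, so the
  integral of f vanishes over every Borel set. A Lebesgue set is a Borel set up to a null set, and a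
  density whose integral over every measurable set is 0 vanishes a.e.\<close>

lemma prim_eq_0_imp_AE:
  assumes T: "0 \<le> T" and f: "integrable (LM T) f" and 0: "\<And>t. t \<in> {0..T} \<Longrightarrow> prim T f t = 0"
  shows "AE t in LM T. f t = 0"
proof -
  let ?M = "LM T"
  interpret finite_measure ?M by (rule finite_measure_LM)
  note [measurable] = borel_measurable_integrable[OF f]
  have bm: "A \<inter> {0<..<T} \<in> sets ?M" if "A \<in> sets borel" for A
    using that by (auto simp: sets_restrict_space_iff intro!: sets_completionI_sets)
  have ii: "integrable ?M (\<lambda>s. indicator A s *\<^sub>R f s)" if "A \<in> sets borel" for A
  proof (rule Bochner_Integration.integrable_bound[OF f])
    have "(\<lambda>s. indicator A s :: real) \<in> borel_measurable ?M"
      using that by (intro borel_imp_lebesgue_on borel_measurable_indicator)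
    then show "(\<lambda>s. indicator A s *\<^sub>R f s) \<in> borel_measurable ?M" by measurable
  qed (auto simp: indicator_def)
  have tot: "(LINT s|?M. f s) = 0" using 0[of T] T by (simp add: prim_T)
  have borel0: "(LINT s|?M. indicator A s *\<^sub>R f s) = 0" if A: "A \<in> sets borel" for A
  proof -
    have A': "A \<in> sigma_sets UNIV (range (\<lambda>a::real. {..a}))"
      using A by (simp add: borel_eq_atMost)
    have sub: "X \<in> sets borel" if "X \<in> sigma_sets UNIV (range (\<lambda>a::real. {..a}))" for X
      using that by (simp add: borel_eq_atMost)
    have subset_Pow_UNIV: "range (\<lambda>a::real. {..a}) \<subseteq> Pow UNIV" by simp
    have St: "Int_stable (range (\<lambda>a::real. {..a}))"
      by (auto simp: Int_stable_def)
    show ?thesis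
      using St subset_Pow_UNIV A'
    proof (induction rule: sigma_sets_induct_disjoint)
      case (basic A)
      then obtain a where a: "A = {..a}" by auto
      consider "a < 0" | "0 \<le> a" "a \<le> T" | "T < a" by linarith
      then show ?case
      proof cases
        case 1
        then have "(LINT s|?M. indicator A s *\<^sub>R f s) = (LINT s|?M. 0)"
          by (intro Bochner_Integration.integral_cong) (auto simp: a indicator_def)
        then show ?thesis by simp
      next
        case 2
        then show ?thesis using 0[of a] by (simp add: prim_def a)
      next
        case 3
        then have "(LINT s|?M. indicator A s *\<^sub>R f s) = (LINT s|?M. f s)"
          by (intro Bochner_Integration.integral_cong) (auto simp: a indicator_def)
        then show ?thesis using tot by simp
      qed
    next
      case empty
      then show ?case by simp
    next
      case (compl A)
      have "(LINT s|?M. indicator (UNIV - A) s *\<^sub>R f s) = (LINT s|?M. f s - indicator A s *\<^sub>R f s)"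
        by (intro Bochner_Integration.integral_cong) (auto simp: indicator_def)
      then show ?case using compl tot ii[OF sub[OF compl(1)]] f by simp
    next
      case (union A)
      have Ab: "A i \<in> sets borel" for i by (rule sub) (use union in auto)
      let ?A = "\<lambda>i. A i \<inter> {0<..<T}"
      have c: "(LINT s:X \<inter> {0<..<T}|?M. f s) = (LINT s|?M. indicator X s *\<^sub>R f s)" for X
        unfolding set_lebesgue_integral_def
        by (intro Bochner_Integration.integral_cong) (auto simp: indicator_def)
      have "(LINT s:(\<Union>i. ?A i)|?M. f s) = (\<Sum>i. (LINT s:?A i|?M. f s))"
      proof (rule lebesgue_integral_countable_add)
        show m: "?A i \<in> sets ?M" for i by (rule bm[OF Ab])
        have "(\<Union>i. ?A i) \<in> sets ?M" by (rule sets.countable_UN) (use m in blast)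
        then show "set_integrable ?M (\<Union>i. ?A i) f"
          unfolding set_integrable_def by (rule integrable_mult_indicator[OF _ f])
        show "?A i \<inter> ?A j = {}" if "i \<noteq> j" for i j
          using union(1) that by (auto simp: disjoint_family_on_def)
      qed
      also have "(\<Union>i. ?A i) = (\<Union>i. A i) \<inter> {0<..<T}" by auto
      finally show ?case using union by (simp add: c)
    qed
  qed
  show ?thesis
  proof (rule density_zero[OF f])
    fix A assume A: "A \<in> sets ?M"
    then have "A \<in> sets lebesgue" by (simp add: sets_restrict_space_iff)
    then obtain S N N' where A': "A = S \<union> N" "N \<subseteq> N'" "N' \<in> null_sets lborel" "S \<in> sets lborel"
      by (rule sets_completionE)
    have "AE s in lebesgue. s \<notin> N'"
      using A'(3) by (intro AE_not_in) (auto intro: null_sets_completionI)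
    then have "AE s in lebesgue. s \<in> {0<..<T} \<longrightarrow> s \<notin> N'"
      by eventually_elim simp
    then have "AE s in ?M. s \<notin> N'"
      by (simp add: AE_restrict_space_iff)
    then have "AE s in ?M. indicator A s *\<^sub>R f s = indicator S s *\<^sub>R f s"
      by eventually_elim (use A' in \<open>auto simp: indicator_def\<close>)
    then have "(LINT s|?M. indicator A s *\<^sub>R f s) = (LINT s|?M. indicator S s *\<^sub>R f s)"
      using A A'(4) ii[of S] by (intro integral_cong_AE) auto
    then show "set_lebesgue_integral ?M A f = 0"
      using borel0[of S] A'(4) by (simp add: set_lebesgue_integral_def)
  qed
qed

section \<open>Sobolev functions on an interval\<close>

lemma integrable_LM_Icc:
  fixes g :: "real \<Rightarrow> 'a::euclidean_space"
  assumes g: "integrable (LM T) g" and t: "t \<in> {0..T}"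
  shows "integrable (lebesgue_on {0..t}) g"
proof -
  have "integrable lebesgue (\<lambda>s. indicator {0<..<T} s *\<^sub>R indicator {..t} s *\<^sub>R g s)"
    using indicator_integrable[OF g, of t] by (subst (asm) integrable_restrict_space) auto
  then have "integrable lebesgue (\<lambda>s. indicator {0..t} s *\<^sub>R g s)"
    by (subst (asm) integrable_discrete_difference[of "{0,t}" _ _ "\<lambda>s. indicator {0..t} s *\<^sub>R g s"])
      (use t in \<open>auto simp: indicator_def\<close>)
  then show ?thesis by (subst integrable_restrict_space) auto
qed

lemma prim_eq_HK:
  fixes g :: "real \<Rightarrow> 'a::euclidean_space"
  assumes "integrable (LM T) g" "t \<in> {0..T}"
  shows "prim T g t = integral {0..t} g"
  unfolding prim_eq_integral[OF assms(2)]
  by (rule lebesgue_integral_eq_integral[OF integrable_LM_Icc[OF assms]]) simp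

text \<open>Passing through the gauge integral avoids any continuity requirement on the derivative
  g. This matters where g contains \<open>deriv \<kappa>\<close>.\<close>

lemma prim_FTC:
  fixes u :: "real \<Rightarrow> 'a::euclidean_space"
  assumes g: "integrable (LM T) g" and u: "continuous_on {0..T} u"
    and d: "\<And>t. t \<in> {0<..<T} \<Longrightarrow> (u has_vector_derivative g t) (at t)"
    and t: "t \<in> {0..T}"
  shows "u t = u 0 + prim T g t"
proof -
  have "(g has_integral (u t - u 0)) {0..t}"
  proof (rule fundamental_theorem_of_calculus_interior)
    show "continuous_on {0..t} u" using t by (intro continuous_on_subset[OF u]) auto
  qed (use t d in auto)
  then show ?thesis using prim_eq_HK[OF g t] by (simp add: integral_unique)
qed

section \<open>Weak derivatives as densities of primitives\<close>

lemma L2_scaleR_integrable: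
  fixes \<phi> :: "real \<Rightarrow> real" and u :: "real \<Rightarrow> 'a::euclidean_space"
  assumes \<phi>: "\<phi> \<in> L2 I" and u: "u \<in> L2 I"
  shows "integrable (lebesgue_on I) (\<lambda>t. \<phi> t *\<^sub>R u t)"
proof (rule Bochner_Integration.integrable_bound)
  show "integrable (lebesgue_on I) (\<lambda>t. (norm (\<phi> t))\<^sup>2 + (norm (u t))\<^sup>2)"
    by (intro Bochner_Integration.integrable_add L2_norm_sq_integrable \<phi> u)
  show "(\<lambda>t. \<phi> t *\<^sub>R u t) \<in> borel_measurable (lebesgue_on I)"
    using L2_measurable[OF \<phi>] L2_measurable[OF u] by measurable
  have "\<bar>a\<bar> * b \<le> a\<^sup>2 + b\<^sup>2" if "0 \<le> b" for a b :: real
  proof -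
    have "2 * (\<bar>a\<bar> * b) \<le> a\<^sup>2 + b\<^sup>2" using sum_squares_bound[of "\<bar>a\<bar>" b] by simp
    moreover have "0 \<le> \<bar>a\<bar> * b" using that by simp
    ultimately show ?thesis by linarith
  qed
  then show "AE t in lebesgue_on I. norm (\<phi> t *\<^sub>R u t) \<le> norm ((norm (\<phi> t))\<^sup>2 + (norm (u t))\<^sup>2)"
    by simp
qed

lemma test_function_prim:
  assumes \<phi>: "\<phi> \<in> test_functions {0<..<T}"
  shows "continuous_on {0..T} (deriv \<phi>)" and "\<And>t. t \<in> {0..T} \<Longrightarrow> \<phi> t = prim T (deriv \<phi>) t"
    and "prim T (deriv \<phi>) T = 0"
proof -
  have z: "\<phi> x = 0" if "x \<notin> {0<..<T}" for x
    using \<phi> that by (auto simp: test_functions_def)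
  have d: "(\<phi> has_real_derivative deriv \<phi> x) (at x)" for x
    using \<phi> by (auto simp: test_functions_def DERIV_deriv_iff_real_differentiable)
  show c: "continuous_on {0..T} (deriv \<phi>)"
    using \<phi> by (auto simp: test_functions_def intro: continuous_on_subset)
  show p: "\<phi> t = prim T (deriv \<phi>) t" if "t \<in> {0..T}" for t
  proof -
    have "\<phi> t = \<phi> 0 + prim T (deriv \<phi>) t"
    proof (rule prim_FTC[OF _ _ _ that])
      show "integrable (LM T) (deriv \<phi>)" by (rule L2_integrable[OF continuous_on_L2[OF c]])
      show "continuous_on {0..T} \<phi>"
        using d by (intro continuous_at_imp_continuous_on ballI) (rule DERIV_isCont)
      show "(\<phi> has_vector_derivative deriv \<phi> t) (at t)" for t
        using d by (simp add: has_real_derivative_iff_has_vector_derivative)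
    qed
    then show ?thesis by (simp add: z)
  qed
  show "prim T (deriv \<phi>) T = 0"
  proof (cases "0 \<le> T")
    case True then show ?thesis using p[of T] z[of T] by simp
  next
    case False
    then have "{0<..<T} = {}" by auto
    then show ?thesis by (simp add: prim_def)
  qed
qed

text \<open>Integration by parts against a test function, itself the primitive of its derivative.
  That derivative has total integral 0, which removes the constant c as well as the boundary
  term.\<close>

lemma has_weak_derivative_prim:
  fixes u :: "real \<Rightarrow> 'a::euclidean_space"
  assumes g: "g \<in> L2 {0<..<T}" and u: "\<And>t. t \<in> {0<..<T} \<Longrightarrow> u t = c + prim T g t"
  shows "has_weak_derivative {0<..<T} u g"
  unfolding has_weak_derivative_def
proof
  fix \<phi> assume "\<phi> \<in> test_functions {0<..<T}"
  note \<phi> = test_function_prim[OF this]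
  have gi: "integrable (LM T) g" by (rule L2_integrable[OF g])
  have dL: "deriv \<phi> \<in> L2 {0<..<T}" by (rule continuous_on_L2[OF \<phi>(1)])
  have di: "integrable (LM T) (deriv \<phi>)" by (rule L2_integrable[OF dL])
  have pL: "prim T (deriv \<phi>) \<in> L2 {0<..<T}" by (rule prim_L2[OF di])
  have "(LINT t|LM T. deriv \<phi> t *\<^sub>R u t) = (LINT t|LM T. deriv \<phi> t *\<^sub>R c + deriv \<phi> t *\<^sub>R prim T g t)"
    by (intro Bochner_Integration.integral_cong) (auto simp: u scaleR_add_right)
  also have "\<dots> = (LINT t|LM T. deriv \<phi> t *\<^sub>R c) + (LINT t|LM T. deriv \<phi> t *\<^sub>R prim T g t)"
    by (intro Bochner_Integration.integral_add L2_scaleR_integrable[OF dL] prim_L2 gi)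
      (simp add: continuous_on_L2)
  also have "(LINT t|LM T. deriv \<phi> t *\<^sub>R c) = prim T (deriv \<phi>) T *\<^sub>R c"
    using di by (simp add: prim_T)
  also have "\<dots> = 0" by (simp add: \<phi>(3))
  also have "0 + (LINT t|LM T. deriv \<phi> t *\<^sub>R prim T g t) = - (LINT t|LM T. prim T (deriv \<phi>) t *\<^sub>R g t)"
  proof (rule euclidean_eqI)
    fix b :: 'a
    have "(LINT t|LM T. deriv \<phi> t *\<^sub>R prim T g t) \<bullet> b = (LINT t|LM T. deriv \<phi> t * prim T (\<lambda>s. g s \<bullet> b) t)"
      using integral_component[OF L2_scaleR_integrable[OF dL prim_L2[OF gi]]]
      by (simp add: prim_component[OF gi])
    also have "\<dots> = - (LINT t|LM T. prim T (deriv \<phi>) t * (g t \<bullet> b))"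
      using prim_parts_real[OF di, of "\<lambda>s. g s \<bullet> b"] gi \<phi>(3) by simp
    also have "\<dots> = - (LINT t|LM T. prim T (deriv \<phi>) t *\<^sub>R g t) \<bullet> b"
      using integral_component[OF L2_scaleR_integrable[OF pL g]] by simp
    finally show "(0 + (LINT t|LM T. deriv \<phi> t *\<^sub>R prim T g t)) \<bullet> b = - (LINT t|LM T. prim T (deriv \<phi>) t *\<^sub>R g t) \<bullet> b"
      by simp
  qed
  also have "(LINT t|LM T. prim T (deriv \<phi>) t *\<^sub>R g t) = (LINT t|LM T. \<phi> t *\<^sub>R g t)"
    by (intro Bochner_Integration.integral_cong) (auto simp: \<phi>(2))
  finally show "(LINT t|LM T. deriv \<phi> t *\<^sub>R u t) = - (LINT t|LM T. \<phi> t *\<^sub>R g t)" .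
qed

lemma AE_zero_continuous:
  fixes f :: "real \<Rightarrow> 'a::euclidean_space"
  assumes f: "continuous_on {0<..<T} f" and ae: "AE t in LM T. f t = 0" and t: "t \<in> {0<..<T}"
  shows "f t = 0"
proof (rule ccontr)
  assume "f t \<noteq> 0"
  let ?U = "{0<..<T} \<inter> f -` (- {0})"
  have "open ?U" by (rule continuous_open_preimage[OF f open_greaterThanLessThan]) (simp add: open_Compl)
  moreover have "AE x in lebesgue. x \<in> {0<..<T} \<longrightarrow> f x = 0"
    using ae by (simp add: AE_restrict_space_iff)
  then have "AE x in lebesgue. x \<in> ?U \<longrightarrow> x \<in> {}"
    by eventually_elim auto
  moreover have "t \<in> ?U" using t \<open>f t \<noteq> 0\<close> by simp
  ultimately have "t \<in> {}"
    by (rule mem_closed_if_AE_lebesgue_open[OF _ closed_empty])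
  then show False by simp
qed

lemma integral_zero_continuous:
  fixes f :: "real \<Rightarrow> real"
  assumes f: "continuous_on {0..T} f" and nn: "\<And>t. t \<in> {0<..<T} \<Longrightarrow> 0 \<le> f t"
    and 0: "(LINT t|LM T. f t) = 0" and t: "t \<in> {0<..<T}"
  shows "f t = 0"
proof (rule AE_zero_continuous[OF _ _ t])
  show "continuous_on {0<..<T} f" by (rule continuous_on_subset[OF f]) auto
  have "AE t in LM T. 0 \<le> f t" by (rule AE_I2) (use nn in simp)
  then show "AE t in LM T. f t = 0"
    using integral_nonneg_eq_0_iff_AE[OF L2_integrable[OF continuous_on_L2[OF f]]] 0 by simp
qed

lemma prim_has_derivative:
  fixes \<psi> :: "real \<Rightarrow> real"
  assumes \<psi>: "continuous_on {0..T} \<psi>" and x: "x \<in> {0<..<T}"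
  shows "(prim T \<psi> has_real_derivative \<psi> x) (at x)"
proof -
  have i: "integrable (LM T) \<psi>" by (rule L2_integrable[OF continuous_on_L2[OF \<psi>]])
  have "((\<lambda>u. integral {0..u} \<psi>) has_real_derivative \<psi> x) (at x within {0..T})"
    using x by (intro integral_has_real_derivative \<psi>) auto
  moreover have "at x within {0..T} = at x" using x by (intro at_within_Icc_at) auto
  ultimately have "((\<lambda>u. integral {0..u} \<psi>) has_real_derivative \<psi> x) (at x)" by simp
  then show ?thesis
    by (rule has_field_derivative_transform_within_open[where S = "{0<..<T}"])
      (use x in \<open>auto simp: prim_eq_HK[OF i]\<close>)
qed

text \<open>
  Du Bois-Reymond: testing with a primitive of \<open>\<eta> (w - c)\<close>, where \<open>\<eta>\<close> is a cutoff and \<open>c\<close> the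
  \<open>\<eta>\<close>-weighted mean of \<open>w\<close>, gives \<open>\<integral> \<eta> (w - c)\<^sup>2 = 0\<close>.
\<close>

lemma weak_derivative_zero_imp_constant:
  fixes w :: "real \<Rightarrow> 'a::euclidean_space"
  assumes w: "continuous_on {0..T} w"
    and weak: "\<And>\<phi>. \<phi> \<in> test_functions {0<..<T} \<Longrightarrow> (LINT t|LM T. deriv \<phi> t *\<^sub>R w t) = 0"
    and s: "s \<in> {0<..<T}" and t: "t \<in> {0<..<T}"
  shows "w s = w t"
proof (rule euclidean_eqI)
  fix b :: 'a
  \<comment> \<open>Half the least distance of s and t from the endpoints: the cutoff
    \<open>\<eta>\<close> can vanish outside [\<delta>, T - \<delta>] and still be positive at both
    points.\<close>
  define \<delta> where "\<delta> = min (min s t) (min (T - s) (T - t)) / 2"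
  have \<delta>: "0 < \<delta>" "\<delta> < s" "\<delta> < t" "s < T - \<delta>" "t < T - \<delta>"
    using s t by (auto simp: \<delta>_def min_def field_simps)
  \<comment> \<open>Clamping the argument to [0, T] makes \<open>h\<close> continuous on the whole
    line, where test functions have to be continuously differentiable.\<close>
  define h where "h x = w (max 0 (min T x)) \<bullet> b" for x
  have h: "continuous_on UNIV h"
    unfolding h_def using s
    by (intro continuous_intros continuous_on_compose2[OF w]) auto
  have hw: "h x = w x \<bullet> b" if "x \<in> {0<..<T}" for x using that by (simp add: h_def)
  define \<eta> where "\<eta> x = max 0 (min (x - \<delta>) (T - \<delta> - x))" for x
  have \<eta>: "continuous_on UNIV \<eta>" unfolding \<eta>_def by (intro continuous_intros)
  have \<eta>0: "0 \<le> \<eta> x" for x by (simp add: \<eta>_def)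
  have \<eta>s: "0 < \<eta> s" "0 < \<eta> t" using \<delta> by (auto simp: \<eta>_def)
  have cont: "continuous_on {0..T} f" if "continuous_on UNIV f" for f :: "real \<Rightarrow> real"
    using that by (rule continuous_on_subset) auto
  have int: "integrable (LM T) f" if "continuous_on UNIV f" for f :: "real \<Rightarrow> real"
    by (rule L2_integrable[OF continuous_on_L2[OF cont[OF that]]])
  define c where "c = (LINT x|LM T. \<eta> x * h x) / (LINT x|LM T. \<eta> x)"
  have \<eta>i: "(LINT x|LM T. \<eta> x) \<noteq> 0"
    using integral_zero_continuous[OF cont[OF \<eta>] \<eta>0 _ s] \<eta>s by auto
  define \<psi> where "\<psi> x = \<eta> x * (h x - c)" for x
  have \<psi>: "continuous_on UNIV \<psi>" unfolding \<psi>_def by (intro continuous_intros h \<eta>)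
  \<comment> \<open>Mean zero, due to the choice of \<open>c\<close>, brings the primitive of
    \<open>\<psi>\<close> back to 0 at T - \<delta>; this makes its support compact.\<close>
  have \<psi>int: "(LINT x|LM T. \<psi> x) = 0"
  proof -
    have "(LINT x|LM T. \<psi> x) = (LINT x|LM T. \<eta> x * h x - c * \<eta> x)"
      by (simp add: \<psi>_def algebra_simps)
    also have "\<dots> = (LINT x|LM T. \<eta> x * h x) - c * (LINT x|LM T. \<eta> x)"
      using int[OF continuous_on_mult[OF \<eta> h]] int[OF \<eta>] by simp
    also have "\<dots> = 0" using \<eta>i by (simp add: c_def)
    finally show ?thesis .
  qed
  have \<psi>0: "\<psi> x = 0" if "x \<le> \<delta> \<or> T - \<delta> \<le> x" for x
    using that by (auto simp: \<psi>_def \<eta>_def)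
  have left: "prim T \<psi> x = 0" if "x \<le> \<delta>" for x
  proof -
    have "prim T \<psi> x = (LINT s|LM T. 0)"
      unfolding prim_def using that \<psi>0 by (intro Bochner_Integration.integral_cong) (auto simp: indicator_def)
    then show ?thesis by simp
  qed
  have right: "prim T \<psi> x = 0" if "T - \<delta> \<le> x" for x
  proof -
    have "prim T \<psi> x = (LINT s|LM T. \<psi> s)"
      unfolding prim_def using that \<psi>0 by (intro Bochner_Integration.integral_cong) (auto simp: indicator_def)
    then show ?thesis by (simp add: \<psi>int)
  qed
  have deriv: "(prim T \<psi> has_real_derivative \<psi> x) (at x)" for x
  proof -
    consider "x < \<delta>" | "0 < x" "x < T" | "T - \<delta> < x" using \<delta> by linarith
    then show ?thesis
    proof cases
      case 1
      have "((\<lambda>_. 0) has_real_derivative \<psi> x) (at x)" using 1 by (simp add: \<psi>0)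
      then show ?thesis
        by (rule has_field_derivative_transform_within_open[OF _ open_lessThan[of \<delta>]]) (use 1 left in auto)
    next
      case 2
      then show ?thesis by (intro prim_has_derivative[OF cont[OF \<psi>]]) simp
    next
      case 3
      have "((\<lambda>_. 0) has_real_derivative \<psi> x) (at x)" using 3 by (simp add: \<psi>0)
      then show ?thesis
        by (rule has_field_derivative_transform_within_open[OF _ open_greaterThan[of "T - \<delta>"]]) (use 3 right in auto)
    qed
  qed
  have d: "deriv (prim T \<psi>) = \<psi>" using deriv DERIV_imp_deriv by blast
  have "prim T \<psi> \<in> test_functions {0<..<T}"
    unfolding test_functions_def
  proof (intro CollectI conjI allI exI[of _ "{\<delta>..T-\<delta>}"])
    show "prim T \<psi> differentiable (at x)" for x
      using deriv real_differentiable_def by blast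
    show "continuous_on UNIV (deriv (prim T \<psi>))" by (simp add: d \<psi>)
    show "{\<delta>..T - \<delta>} \<subseteq> {0<..<T}" using \<delta> by auto
    show "x \<notin> {\<delta>..T - \<delta>} \<longrightarrow> prim T \<psi> x = 0" for x
      using left[of x] right[of x] by auto
  qed simp
  from weak[OF this] have "(LINT t|LM T. \<psi> t *\<^sub>R w t) \<bullet> b = 0" by (simp add: d)
  then have "(LINT t|LM T. \<psi> t * h t) = 0"
  proof -
    have "(LINT t|LM T. \<psi> t *\<^sub>R w t) \<bullet> b = (LINT t|LM T. (\<psi> t *\<^sub>R w t) \<bullet> b)"
      by (intro integral_component L2_scaleR_integrable continuous_on_L2 w cont \<psi>)
    also have "\<dots> = (LINT t|LM T. \<psi> t * h t)"
      by (intro Bochner_Integration.integral_cong) (auto simp: hw)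
    finally show ?thesis using \<open>(LINT t|LM T. \<psi> t *\<^sub>R w t) \<bullet> b = 0\<close> by simp
  qed
  moreover have "(LINT t|LM T. \<eta> t * (h t - c)\<^sup>2) = (LINT t|LM T. \<psi> t * h t - c * \<psi> t)"
    by (simp add: \<psi>_def power2_eq_square algebra_simps)
  moreover have "\<dots> = (LINT t|LM T. \<psi> t * h t) - c * (LINT t|LM T. \<psi> t)"
    using int[OF continuous_on_mult[OF \<psi> h]] int[OF \<psi>] by simp
  ultimately have z: "(LINT t|LM T. \<eta> t * (h t - c)\<^sup>2) = 0" using \<psi>int by simp
  have "continuous_on {0..T} (\<lambda>t. \<eta> t * (h t - c)\<^sup>2)"
    by (intro cont continuous_intros \<eta> h)
  from integral_zero_continuous[OF this _ z] \<eta>0 have "\<eta> x * (h x - c)\<^sup>2 = 0" if "x \<in> {0<..<T}" for x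
    using that by simp
  from this[OF s] this[OF t] \<eta>s have "h s = c" "h t = c" by auto
  then show "w s \<bullet> b = w t \<bullet> b" using s t by (simp add: hw)
qed

text \<open>Subtracting the primitive of g leaves a continuous function with weak derivative 0. It
  is constant in the open interval by the du Bois-Reymond argument, and up to the endpoints by
  continuity.\<close>

lemma weak_derivative_imp_prim:
  fixes u :: "real \<Rightarrow> 'a::euclidean_space"
  assumes u: "continuous_on {0..T} u" and g: "g \<in> L2 {0<..<T}"
    and weak: "has_weak_derivative {0<..<T} u g" and t: "t \<in> {0..T}"
  shows "u t = u 0 + prim T g t"
proof (cases "T = 0")
  case True
  then show ?thesis using t by simp
next
  case False
  then have T: "0 < T" using t by auto
  have gi: "integrable (LM T) g" by (rule L2_integrable[OF g])
  define w where "w t = u t - prim T g t" for t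
  have w: "continuous_on {0..T} w"
    unfolding w_def by (intro continuous_intros u continuous_on_prim gi)
  have z: "(LINT t|LM T. deriv \<phi> t *\<^sub>R w t) = 0" if \<phi>: "\<phi> \<in> test_functions {0<..<T}" for \<phi>
  proof -
    have dL: "deriv \<phi> \<in> L2 {0<..<T}" by (rule continuous_on_L2[OF test_function_prim(1)[OF \<phi>]])
    have "(LINT t|LM T. deriv \<phi> t *\<^sub>R w t) = (LINT t|LM T. deriv \<phi> t *\<^sub>R u t) - (LINT t|LM T. deriv \<phi> t *\<^sub>R prim T g t)"
      unfolding w_def scaleR_diff_right
      by (intro Bochner_Integration.integral_diff L2_scaleR_integrable dL prim_L2 gi continuous_on_L2 u)
    then show ?thesis
      using weak has_weak_derivative_prim[OF g, of "prim T g" 0] \<phi>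
      by (simp add: has_weak_derivative_def)
  qed
  have half: "T / 2 \<in> {0<..<T}" using T by simp
  have cl: "closure {0<..<T} = {0..T}" using T by simp
  have "w x = w (T/2)" if "x \<in> {0..T}" for x
  proof (rule continuous_constant_on_closure[of "{0<..<T}"])
    show "continuous_on (closure {0<..<T}) w" using w by (simp only: cl)
    show "w x = w (T/2)" if "x \<in> {0<..<T}" for x
      by (rule weak_derivative_zero_imp_constant[OF w z that half])
    show "x \<in> closure {0<..<T}" using that by (simp only: cl)
  qed
  from this[OF t] this[of 0] T have "w t = w 0" by simp
  then show ?thesis by (simp add: w_def algebra_simps)
qed

section \<open>Calculus in H1 and H10\<close>

lemma H1_weak_deriv:
  assumes "u \<in> H1 T"
  shows "weak_deriv {0<..<T} u \<in> L2 {0<..<T}"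
    and "has_weak_derivative {0<..<T} u (weak_deriv {0<..<T} u)"
proof -
  have "\<exists>g. g \<in> L2 {0<..<T} \<and> has_weak_derivative {0<..<T} u g"
    using assms by (auto simp: H1_def W12_def)
  then have "weak_deriv {0<..<T} u \<in> L2 {0<..<T} \<and> has_weak_derivative {0<..<T} u (weak_deriv {0<..<T} u)"
    unfolding weak_deriv_def by (rule someI_ex)
  then show "weak_deriv {0<..<T} u \<in> L2 {0<..<T}"
    and "has_weak_derivative {0<..<T} u (weak_deriv {0<..<T} u)" by auto
qed

lemma H1_continuous: "u \<in> H1 T \<Longrightarrow> continuous_on {0..T} u"
  by (simp add: H1_def)

lemma H1_L2: "u \<in> H1 T \<Longrightarrow> u \<in> L2 {0<..<T}"
  by (simp add: H1_def W12_def)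

lemma H10_H1: "u \<in> H10 T \<Longrightarrow> u \<in> H1 T"
  by (simp add: H10_def)

lemma H10_L2: "u \<in> H10 T \<Longrightarrow> u \<in> L2 {0<..<T}"
  by (simp add: H10_H1 H1_L2)

lemma H1_eq_prim:
  assumes "u \<in> H1 T" "t \<in> {0..T}"
  shows "u t = u 0 + prim T (weak_deriv {0<..<T} u) t"
  by (rule weak_derivative_imp_prim[OF H1_continuous H1_weak_deriv]) (use assms in auto)

lemma H1_I:
  assumes g: "g \<in> L2 {0<..<T}" and u: "\<And>t. t \<in> {0..T} \<Longrightarrow> u t = c + prim T g t"
  shows "u \<in> H1 T"
proof -
  have "continuous_on {0..T} (\<lambda>t. c + prim T g t)"
    by (intro continuous_intros continuous_on_prim L2_integrable[OF g])
  then have c: "continuous_on {0..T} u" by (rule continuous_on_eq) (simp add: u)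
  have "has_weak_derivative {0<..<T} u g"
    by (rule has_weak_derivative_prim[OF g]) (simp add: u)
  then show ?thesis using g c continuous_on_L2[OF c] by (auto simp: H1_def W12_def)
qed

lemma H10_prim: "g \<in> L2 {0<..<T} \<Longrightarrow> prim T g \<in> H10 T"
  using H1_I[of g T "prim T g" 0] by (simp add: H10_def)

text \<open>\<open>weak_deriv\<close> is a choice among functions that agree a.e. Later computations
  of it pass through this lemma: once a function is written as a constant plus a primitive, its
  chosen derivative is the density.\<close>

lemma weak_deriv_unique:
  assumes T: "0 \<le> T" and g: "g \<in> L2 {0<..<T}" and u: "\<And>t. t \<in> {0..T} \<Longrightarrow> u t = c + prim T g t"
  shows "AE t in LM T. weak_deriv {0<..<T} u t = g t"
proof -
  let ?w = "weak_deriv {0<..<T} u"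
  have uH: "u \<in> H1 T" by (rule H1_I[OF g u])
  have w: "?w \<in> L2 {0<..<T}" by (rule H1_weak_deriv[OF uH])
  have u0: "u 0 = c" using u[of 0] T by simp
  have "AE t in LM T. ?w t - g t = 0"
  proof (rule prim_eq_0_imp_AE[OF T])
    show "integrable (LM T) (\<lambda>t. ?w t - g t)" by (rule L2_integrable[OF L2_diff[OF w g]])
    show "prim T (\<lambda>t. ?w t - g t) t = 0" if "t \<in> {0..T}" for t
      using H1_eq_prim[OF uH that] u[OF that] u0
      by (simp add: prim_diff L2_integrable w g)
  qed
  then show ?thesis by eventually_elim simp
qed

lemma
  assumes u: "u \<in> H1 T" and v: "v \<in> H1 T"
  shows H1_add: "(\<lambda>t. u t + v t) \<in> H1 T"
    and weak_deriv_add: "0 \<le> T \<Longrightarrow>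
      AE t in LM T. weak_deriv {0<..<T} (\<lambda>t. u t + v t) t = weak_deriv {0<..<T} u t + weak_deriv {0<..<T} v t"
proof -
  let ?g = "\<lambda>t. weak_deriv {0<..<T} u t + weak_deriv {0<..<T} v t"
  have g: "?g \<in> L2 {0<..<T}" by (intro L2_add H1_weak_deriv u v)
  have eq: "u t + v t = (u 0 + v 0) + prim T ?g t" if "t \<in> {0..T}" for t
    using H1_eq_prim[OF u that] H1_eq_prim[OF v that]
    by (simp add: prim_add L2_integrable H1_weak_deriv u v)
  show "(\<lambda>t. u t + v t) \<in> H1 T" by (rule H1_I[OF g eq])
  show "AE t in LM T. weak_deriv {0<..<T} (\<lambda>t. u t + v t) t = ?g t" if "0 \<le> T"
    by (rule weak_deriv_unique[OF that g eq])
qed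

lemma
  assumes u: "u \<in> H1 T"
  shows H1_scaleR: "(\<lambda>t. c *\<^sub>R u t) \<in> H1 T"
    and weak_deriv_scaleR: "0 \<le> T \<Longrightarrow>
      AE t in LM T. weak_deriv {0<..<T} (\<lambda>t. c *\<^sub>R u t) t = c *\<^sub>R weak_deriv {0<..<T} u t"
proof -
  let ?g = "\<lambda>t. c *\<^sub>R weak_deriv {0<..<T} u t"
  have g: "?g \<in> L2 {0<..<T}" by (intro L2_scaleR H1_weak_deriv u)
  have eq: "c *\<^sub>R u t = c *\<^sub>R u 0 + prim T ?g t" if "t \<in> {0..T}" for t
    unfolding prim_scaleR scaleR_add_right[symmetric] H1_eq_prim[OF u that, symmetric] ..
  show "(\<lambda>t. c *\<^sub>R u t) \<in> H1 T" by (rule H1_I[OF g eq])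
  show "AE t in LM T. weak_deriv {0<..<T} (\<lambda>t. c *\<^sub>R u t) t = ?g t" if "0 \<le> T"
    by (rule weak_deriv_unique[OF that g eq])
qed

lemma H1_diff: "u \<in> H1 T \<Longrightarrow> v \<in> H1 T \<Longrightarrow> (\<lambda>t. u t - v t) \<in> H1 T"
  using H1_add[OF _ H1_scaleR, of u T v "-1"] by simp

lemma H10_add: "u \<in> H10 T \<Longrightarrow> v \<in> H10 T \<Longrightarrow> (\<lambda>t. u t + v t) \<in> H10 T"
  by (simp add: H10_def H1_add)

lemma H10_scaleR: "u \<in> H10 T \<Longrightarrow> (\<lambda>t. c *\<^sub>R u t) \<in> H10 T"
  by (simp add: H10_def H1_scaleR)

lemma H10_zero: "(\<lambda>t. 0) \<in> H10 T"
  using H1_I[OF L2_zero, of T "\<lambda>t. 0" 0] by (simp add: H10_def prim_def)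

lemma H1_inner_commute: "H1_inner T u v = H1_inner T v u"
  by (simp add: H1_inner_def L2_inner_commute)

lemma H1_inner_add_right:
  assumes T: "0 \<le> T" and u: "u \<in> H1 T" and v: "v \<in> H1 T" and w: "w \<in> H1 T"
  shows "H1_inner T w (\<lambda>t. u t + v t) = H1_inner T w u + H1_inner T w v"
proof -
  note d = H1_weak_deriv(1)
  have "L2_inner {0<..<T} (weak_deriv {0<..<T} w) (weak_deriv {0<..<T} (\<lambda>t. u t + v t))
    = L2_inner {0<..<T} (weak_deriv {0<..<T} w) (\<lambda>t. weak_deriv {0<..<T} u t + weak_deriv {0<..<T} v t)"
    by (intro L2_inner_cong_AE L2_measurable d L2_add H1_add weak_deriv_add u v w T) simp
  then show ?thesis using d[OF u] d[OF v] d[OF w] H1_L2[OF u] H1_L2[OF v] H1_L2[OF w]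
    by (simp add: H1_inner_def L2_inner_simps)
qed

lemma H1_inner_scaleR_right:
  assumes T: "0 \<le> T" and u: "u \<in> H1 T" and w: "w \<in> H1 T"
  shows "H1_inner T w (\<lambda>t. c *\<^sub>R u t) = c * H1_inner T w u"
proof -
  note d = H1_weak_deriv(1)
  have "L2_inner {0<..<T} (weak_deriv {0<..<T} w) (weak_deriv {0<..<T} (\<lambda>t. c *\<^sub>R u t))
    = L2_inner {0<..<T} (weak_deriv {0<..<T} w) (\<lambda>t. c *\<^sub>R weak_deriv {0<..<T} u t)"
    by (intro L2_inner_cong_AE L2_measurable d L2_scaleR H1_scaleR weak_deriv_scaleR u w T) simp
  then show ?thesis
    by (simp add: H1_inner_def L2_inner_simps algebra_simps)
qed

lemma H1_norm_power2: "(H1_norm T u)\<^sup>2 = H1_inner T u u"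
  by (simp add: H1_norm_def H1_inner_def L2_inner_nonneg)

lemma H1_norm_scaleR:
  assumes T: "0 \<le> T" and u: "u \<in> H1 T"
  shows "H1_norm T (\<lambda>t. c *\<^sub>R u t) = \<bar>c\<bar> * H1_norm T u"
proof -
  have "H1_inner T (\<lambda>t. c *\<^sub>R u t) (\<lambda>t. c *\<^sub>R u t) = c * H1_inner T u (\<lambda>t. c *\<^sub>R u t)"
    by (subst H1_inner_scaleR_right[OF T u H1_scaleR[OF u]]) (simp add: H1_inner_commute)
  also have "\<dots> = c\<^sup>2 * H1_inner T u u"
    by (subst H1_inner_scaleR_right[OF T u u]) (simp add: power2_eq_square)
  finally show ?thesis by (simp add: H1_norm_def real_sqrt_mult)
qed

lemma H1_norm_add_scaleR:
  assumes T: "0 \<le> T" and u: "u \<in> H1 T" and v: "v \<in> H1 T"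
  shows "(H1_norm T (\<lambda>t. u t + c *\<^sub>R v t))\<^sup>2
    = (H1_norm T u)\<^sup>2 + 2 * c * H1_inner T u v + c\<^sup>2 * (H1_norm T v)\<^sup>2"
proof -
  let ?c = "\<lambda>t. c *\<^sub>R v t"
  have cv: "?c \<in> H1 T" by (rule H1_scaleR[OF v])
  have "H1_inner T (\<lambda>t. u t + ?c t) (\<lambda>t. u t + ?c t)
      = H1_inner T u (\<lambda>t. u t + ?c t) + H1_inner T ?c (\<lambda>t. u t + ?c t)"
    by (subst H1_inner_add_right[OF T u cv H1_add[OF u cv]]) (simp add: H1_inner_commute)
  also have "\<dots> = H1_inner T u u + H1_inner T u ?c + (H1_inner T ?c u + H1_inner T ?c ?c)"
    by (simp only: H1_inner_add_right[OF T u cv u] H1_inner_add_right[OF T u cv cv])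
  also have "\<dots> = H1_inner T u u + 2 * H1_inner T u ?c + H1_inner T ?c ?c"
    by (simp add: H1_inner_commute)
  also have "H1_inner T ?c ?c = c\<^sup>2 * (H1_norm T v)\<^sup>2"
    using H1_norm_scaleR[OF T v, of c] by (simp add: H1_norm_power2[symmetric] power_mult_distrib)
  finally show ?thesis by (simp add: H1_norm_power2 H1_inner_scaleR_right[OF T v u])
qed

section \<open>Density of H10 in L2\<close>

text \<open>Elements of \<open>H10\<close> are free at T, so the test function may be the primitive
  of \<open>G\<close>, minus the integral of f over the remaining time. Integration by parts turns
  the hypothesis into orthogonality of \<open>G\<close> to itself. Then \<open>G\<close> is 0, first
  at time 0, which makes the total integral of f vanish, and hence so is the primitive of f.\<close>

lemma H10_fundamental:
  fixes f :: "real \<Rightarrow> 'a::euclidean_space"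
  assumes T: "0 < T" and f: "f \<in> L2 {0<..<T}"
    and z: "\<And>v. v \<in> H10 T \<Longrightarrow> L2_inner {0<..<T} f v = 0"
  shows "AE t in LM T. f t = 0"
proof -
  have fi: "integrable (LM T) f" by (rule L2_integrable[OF f])
  define G where "G t = prim T f t - prim T f T" for t
  have G: "continuous_on {0..T} G"
    unfolding G_def by (intro continuous_intros continuous_on_prim fi)
  have GL: "G \<in> L2 {0<..<T}" by (rule continuous_on_L2[OF G])
  have GI: "integrable (LM T) G" by (rule L2_integrable[OF GL])
  have cL: "(\<lambda>t. prim T f T) \<in> L2 {0<..<T}" by (rule continuous_on_L2) simp
  have "prim T f T \<bullet> prim T G T = L2_inner {0<..<T} (\<lambda>_. prim T f T) G"
    using GI by (simp add: prim_T[of T G] L2_inner_def)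
  moreover have "prim T f T \<bullet> prim T G T = L2_inner {0<..<T} (prim T f) G"
    using prim_parts[OF f GL] z[OF H10_prim[OF GL]] by simp
  moreover have "L2_inner {0<..<T} (\<lambda>t. prim T f t - prim T f T) G
      = L2_inner {0<..<T} (prim T f) G - L2_inner {0<..<T} (\<lambda>_. prim T f T) G"
    by (rule L2_inner_diff_left[OF prim_L2[OF fi] cL GL])
  moreover have "(\<lambda>t. prim T f t - prim T f T) = G" by (simp add: G_def fun_eq_iff)
  ultimately have "L2_inner {0<..<T} G G = 0" by simp
  then have "AE t in LM T. G t = 0" by (rule L2_norm_zero_AE[OF GL])
  then have G0: "G t = 0" if "t \<in> {0<..<T}" for t
    by (intro AE_zero_continuous[OF continuous_on_subset[OF G] _ that]) auto
  have cl: "closure {0<..<T} = {0..T}" using T by simp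
  have G1: "G t = 0" if "t \<in> {0..T}" for t
  proof (rule continuous_constant_on_closure[of "{0<..<T}"])
    show "continuous_on (closure {0<..<T}) G" using G by (simp only: cl)
    show "t \<in> closure {0<..<T}" using that by (simp only: cl)
  qed (rule G0)
  from G1[of 0] T have "prim T f T = 0" by (simp add: G_def)
  with G1 have "prim T f t = 0" if "t \<in> {0..T}" for t using that by (simp add: G_def)
  then show ?thesis by (rule prim_eq_0_imp_AE[OF less_imp_le[OF T] fi])
qed

text \<open>The Riesz theorem is applied to the functional of f restricted to \<open>H10\<close>.
  The representing u is by construction an L2 limit of elements of \<open>H10\<close>, and u - f is
  orthogonal to \<open>H10\<close>, hence 0 a.e.\<close>

lemma H10_dense:
  fixes f :: "real \<Rightarrow> 'a::euclidean_space"
  assumes T: "0 < T" and f: "f \<in> L2 {0<..<T}" and e: "0 < e"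
  obtains v where "v \<in> H10 T" "L2_norm {0<..<T} (\<lambda>t. v t - f t) < e"
proof -
  let ?I = "{0<..<T}"
  obtain u v where u: "u \<in> L2 ?I" and rep: "\<And>w. w \<in> H10 T \<Longrightarrow> L2_inner ?I f w = L2_inner ?I u w"
    and v: "\<And>n::nat. v n \<in> H10 T" and lim: "(\<lambda>n. L2_norm ?I (\<lambda>t. v n t - u t)) \<longlonglongrightarrow> 0"
  proof (rule L2_Riesz[of "H10 T" ?I "L2_inner ?I f" "L2_norm ?I f"])
    show "L2_inner ?I f w \<le> L2_norm ?I f * L2_norm ?I w" if "w \<in> H10 T" for w
      using L2_Cauchy_Schwarz[OF f H10_L2[OF that]] by simp
  qed (auto simp: H10_zero H10_add H10_scaleR H10_L2 L2_inner_simps f)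
  have "AE t in LM T. u t - f t = 0"
  proof (rule H10_fundamental[OF T L2_diff[OF u f]])
    show "L2_inner ?I (\<lambda>t. u t - f t) w = 0" if "w \<in> H10 T" for w
      using rep[OF that] by (simp add: L2_inner_diff_left u f H10_L2[OF that])
  qed
  then have eq: "AE t in LM T. v n t - f t = v n t - u t" for n by eventually_elim simp
  have "L2_norm ?I (\<lambda>t. v n t - f t) = L2_norm ?I (\<lambda>t. v n t - u t)" for n
  proof -
    have m: "(\<lambda>t. v n t - f t) \<in> borel_measurable (LM T)" "(\<lambda>t. v n t - u t) \<in> borel_measurable (LM T)"
      by (intro L2_measurable L2_diff H10_L2 v f u)+
    show ?thesis
      unfolding L2_norm_def by (subst L2_inner_cong_AE[OF m(1) m(1) m(2) m(2) eq eq]) simp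
  qed
  moreover obtain n where "L2_norm ?I (\<lambda>t. v n t - u t) < e"
    using order_tendstoD(2)[OF lim e] by (auto dest: eventually_happens)
  ultimately show ?thesis using that[OF v[of n]] by simp
qed

section \<open>Chain rule and positive part for functions with L2 derivative\<close>

text \<open>For a continuous density the classical chain rule and \<open>prim_FTC\<close> suffice. A
  general g is approximated in L2 by elements of \<open>H10\<close>, whose primitives converge
  uniformly.\<close>

lemma prim_chain:
  fixes f f' :: "real \<Rightarrow> real" and g :: "real \<Rightarrow> real"
  assumes T: "0 < T" and g: "g \<in> L2 {0<..<T}"
    and f: "\<And>x. (f has_real_derivative f' x) (at x)" and f': "continuous_on UNIV f'"
    and C: "\<And>x. \<bar>f' x\<bar> \<le> C" and t: "t \<in> {0..T}"
  shows "f (c + prim T g t) = f c + prim T (\<lambda>s. f' (c + prim T g s) * g s) t"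
proof -
  let ?I = "{0<..<T}"
  have "\<exists>v. v \<in> H10 T \<and> L2_norm ?I (\<lambda>t. v t - g t) < 1 / real (Suc n)" for n
    using H10_dense[OF T g, of "1 / real (Suc n)"] by auto
  then obtain v where v: "\<And>n. v n \<in> H10 T" and vn: "\<And>n. L2_norm ?I (\<lambda>t. v n t - g t) < 1 / real (Suc n)"
    by metis
  let ?e = "\<lambda>n. L2_norm ?I (\<lambda>t. v n t - g t)"
  have lim0: "?e \<longlonglongrightarrow> 0"
  proof (rule LIMSEQ_bounded_by_null[OF _ LIMSEQ_inverse_real_of_nat])
    show "norm (?e n - 0) \<le> inverse (real (Suc n))" for n
      using vn[of n] by (simp add: inverse_eq_divide L2_norm_nonneg)
  qed
  have gi: "integrable (LM T) g" by (rule L2_integrable[OF g])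
  have vc: "continuous_on {0..T} (v n)" for n by (rule H1_continuous[OF H10_H1[OF v]])
  have vL: "v n \<in> L2 ?I" for n by (rule H10_L2[OF v])
  have vi: "integrable (LM T) (v n)" for n by (rule L2_integrable[OF vL])
  define z where "z t = c + prim T g t" for t
  define zn where "zn n t = c + prim T (v n) t" for n t
  let ?p = "\<lambda>n. prim T (\<lambda>s. f' (zn n s) * v n s) t" and ?r = "\<lambda>n. prim T (\<lambda>s. f' (zn n s) * g s) t"
  have znc: "continuous_on {0..T} (zn n)" for n
    unfolding zn_def by (intro continuous_intros continuous_on_prim vi)
  have zc: "continuous_on {0..T} z"
    unfolding z_def by (intro continuous_intros continuous_on_prim gi)
  have fc: "continuous_on UNIV f"
    using f by (intro continuous_at_imp_continuous_on ballI) (rule DERIV_isCont)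
  have f'zn: "continuous_on {0..T} (\<lambda>t. f' (zn n t))" for n
    by (intro continuous_on_compose2[OF f' znc]) auto
  have f'z: "continuous_on {0..T} (\<lambda>t. f' (z t))"
    by (intro continuous_on_compose2[OF f' zc]) auto
  have FTC: "f (zn n t) = f c + ?p n" for n
  proof -
    have "f (zn n t) = f (zn n 0) + ?p n"
    proof (rule prim_FTC[OF _ _ _ t])
      show "integrable (LM T) (\<lambda>s. f' (zn n s) * v n s)"
        by (intro L2_integrable continuous_on_L2 continuous_on_mult f'zn vc)
      show "continuous_on {0..T} (\<lambda>t. f (zn n t))"
        by (intro continuous_on_compose2[OF fc znc]) auto
      fix x assume x: "x \<in> ?I"
      have "(zn n has_real_derivative v n x) (at x)"
        unfolding zn_def using prim_has_derivative[OF vc x] by (auto intro!: derivative_eq_intros)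
      then have "((\<lambda>t. f (zn n t)) has_real_derivative f' (zn n x) * v n x) (at x)"
        by (rule DERIV_chain2[OF f])
      then show "((\<lambda>t. f (zn n t)) has_vector_derivative f' (zn n x) * v n x) (at x)"
        by (simp add: has_real_derivative_iff_has_vector_derivative)
    qed
    then show ?thesis by (simp add: zn_def)
  qed
  have zlim: "(\<lambda>n. zn n s) \<longlonglongrightarrow> z s" for s
  proof (rule LIMSEQ_bounded_by_null)
    show "norm (zn n s - z s) \<le> sqrt T * ?e n" for n
      using norm_prim_le_L2[OF _ L2_diff[OF vL g]] T
      by (simp add: zn_def z_def prim_diff vi gi)
    show "(\<lambda>n. sqrt T * ?e n) \<longlonglongrightarrow> 0"
      using tendsto_mult_right_zero[OF lim0] .
  qed
  have m: "(\<lambda>s. f' (zn n s)) \<in> borel_measurable (LM T)" "(\<lambda>s. f' (z s)) \<in> borel_measurable (LM T)" for n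
    by (intro continuous_on_borel_LM f'zn f'z)+
  note [measurable] = m L2_measurable[OF g] L2_measurable[OF vL]
  have bL: "(\<lambda>s. f' (zn n s) * w s) \<in> L2 ?I" if "w \<in> L2 ?I" for n w
  proof (rule L2_bound[OF _ that, of _ C])
    show "(\<lambda>s. f' (zn n s) * w s) \<in> borel_measurable (LM T)"
      using L2_measurable[OF that] by measurable
  qed (use C in \<open>simp add: abs_mult mult_right_mono\<close>)
  have lim1: "?r \<longlonglongrightarrow> prim T (\<lambda>s. f' (z s) * g s) t"
    unfolding prim_def
  proof (rule integral_dominated_convergence[where w = "\<lambda>s. C * \<bar>g s\<bar>"])
    show "integrable (LM T) (\<lambda>s. C * \<bar>g s\<bar>)" using gi by simp
    show "AE s in LM T. norm (indicator {..t} s *\<^sub>R (f' (zn n s) * g s)) \<le> C * \<bar>g s\<bar>" for n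
    proof (rule AE_I2)
      fix s
      have "norm (indicator {..t} s *\<^sub>R (f' (zn n s) * g s)) \<le> \<bar>f' (zn n s)\<bar> * \<bar>g s\<bar>"
        by (simp add: indicator_def abs_mult)
      also have "\<dots> \<le> C * \<bar>g s\<bar>" using C by (intro mult_right_mono) auto
      finally show "norm (indicator {..t} s *\<^sub>R (f' (zn n s) * g s)) \<le> C * \<bar>g s\<bar>" .
    qed
    show "AE s in LM T. (\<lambda>n. indicator {..t} s *\<^sub>R (f' (zn n s) * g s)) \<longlonglongrightarrow> indicator {..t} s *\<^sub>R (f' (z s) * g s)"
      using f' by (intro AE_I2 tendsto_intros isCont_tendsto_compose[OF _ zlim])
        (simp add: continuous_on_eq_continuous_at)
  qed measurable
  \<comment> \<open>The error is split. Replacing \<open>v n\<close> by g costs at most a multiple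
    of their L2 distance, because f' is bounded; replacing \<open>zn n\<close> by \<open>z\<close>
    inside f' is the dominated convergence of \<open>lim1\<close>.\<close>
  have lim2: "(\<lambda>n. ?p n - ?r n) \<longlonglongrightarrow> 0"
  proof (rule LIMSEQ_bounded_by_null)
    show "norm (?p n - ?r n - 0)
        \<le> sqrt T * (\<bar>C\<bar> * ?e n)" for n
    proof -
      have "?p n - ?r n
          = prim T (\<lambda>s. f' (zn n s) * (v n s - g s)) t"
        unfolding right_diff_distrib by (intro prim_diff[symmetric] L2_integrable bL vL g)
      also have "norm \<dots> \<le> sqrt T * L2_norm ?I (\<lambda>s. f' (zn n s) * (v n s - g s))"
        using T by (intro norm_prim_le_L2 bL L2_diff vL g) simp
      also have "L2_norm ?I (\<lambda>s. f' (zn n s) * (v n s - g s)) \<le> L2_norm ?I (\<lambda>s. C *\<^sub>R (v n s - g s))"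
        using C by (intro L2_norm_mono L2_scaleR L2_diff vL g AE_I2 L2_measurable[OF bL])
          (auto simp: abs_mult intro!: mult_right_mono order_trans[OF C])
      also have "\<dots> = \<bar>C\<bar> * ?e n" by (rule L2_norm_scaleR)
      finally show ?thesis using T by (simp add: mult_left_mono)
    qed
    show "(\<lambda>n. sqrt T * (\<bar>C\<bar> * ?e n)) \<longlonglongrightarrow> 0"
      by (intro tendsto_mult_right_zero lim0)
  qed
  have "(\<lambda>n. f c + (?p n - ?r n
      + ?r n)) \<longlonglongrightarrow> f c + (0 + prim T (\<lambda>s. f' (z s) * g s) t)"
    by (intro tendsto_add tendsto_const lim1 lim2)
  then have "(\<lambda>n. f (zn n t)) \<longlonglongrightarrow> f c + prim T (\<lambda>s. f' (z s) * g s) t" by (simp add: FTC)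
  moreover have "(\<lambda>n. f (zn n t)) \<longlonglongrightarrow> f (z t)"
    by (rule isCont_tendsto_compose[OF DERIV_isCont[OF f] zlim])
  ultimately show ?thesis unfolding z_def by (rule LIMSEQ_unique[rotated])
qed

text \<open>The maximum is approximated by (x + sqrt(x^2 + \<delta>^2)) / 2, whose derivative is
  continuous and bounded by 1, so \<open>prim_chain\<close> applies with the majorant |g|. The lemma
  keeps positive parts in H1, as the H2 regularity of the state requires.\<close>

lemma prim_max:
  fixes g :: "real \<Rightarrow> real"
  assumes T: "0 < T" and g: "g \<in> L2 {0<..<T}"
  obtains h where "h \<in> L2 {0<..<T}"
    "\<And>t. t \<in> {0..T} \<Longrightarrow> max (c + prim T g t) 0 = max c 0 + prim T h t"
proof -
  let ?I = "{0<..<T}"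
  have gi: "integrable (LM T) g" by (rule L2_integrable[OF g])
  define z where "z t = c + prim T g t" for t
  have zc: "continuous_on {0..T} z"
    unfolding z_def by (intro continuous_intros continuous_on_prim gi)
  define \<delta> where "\<delta> n = inverse (real (Suc n))" for n
  have \<delta>: "0 < \<delta> n" for n by (simp add: \<delta>_def)
  have \<delta>lim: "\<delta> \<longlonglongrightarrow> 0" unfolding \<delta>_def by (rule LIMSEQ_inverse_real_of_nat)
  define f where "f n x = (x + sqrt (x\<^sup>2 + (\<delta> n)\<^sup>2)) / 2" for n x
  define f' where "f' n x = (1 + x / sqrt (x\<^sup>2 + (\<delta> n)\<^sup>2)) / 2" for n x
  have pos: "0 < x\<^sup>2 + (\<delta> n)\<^sup>2" for x n
    using \<delta>[of n] by (simp add: add_nonneg_pos)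
  have deriv: "(f n has_real_derivative f' n x) (at x)" for n x
    unfolding f_def f'_def using pos[of x n]
    by (auto intro!: derivative_eq_intros simp: field_simps)
  have f'c: "continuous_on UNIV (f' n)" for n
  proof -
    have "sqrt (x\<^sup>2 + (\<delta> n)\<^sup>2) \<noteq> 0" for x
      using pos[of x n] by (metis real_sqrt_eq_zero_cancel_iff less_irrefl)
    then show ?thesis unfolding f'_def by (intro continuous_intros) auto
  qed
  have f'b: "\<bar>f' n x\<bar> \<le> 1" for n x
  proof -
    have "\<bar>x\<bar> = sqrt (x\<^sup>2)" by simp
    also have "\<dots> \<le> sqrt (x\<^sup>2 + (\<delta> n)\<^sup>2)" by (rule real_sqrt_le_mono) simp
    finally have "\<bar>x / sqrt (x\<^sup>2 + (\<delta> n)\<^sup>2)\<bar> \<le> 1" using pos[of x n] by simp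
    then show ?thesis unfolding f'_def abs_le_iff by auto
  qed
  have flim: "(\<lambda>n. f n x) \<longlonglongrightarrow> max x 0" for x
  proof -
    have "(\<lambda>n. f n x) \<longlonglongrightarrow> (x + sqrt (x\<^sup>2 + 0\<^sup>2)) / 2"
      unfolding f_def by (intro tendsto_intros \<delta>lim) simp
    moreover have "(x + sqrt (x\<^sup>2 + 0\<^sup>2)) / 2 = max x 0" by (auto simp: max_def abs_if)
    ultimately show ?thesis by simp
  qed
  \<comment> \<open>At x = 0 every smoothed slope is 1/2. The limit density inherits this value, so
    no separate argument on the set where \<open>z\<close> vanishes is called for.\<close>
  have f'lim: "(\<lambda>n. f' n x) \<longlonglongrightarrow> (1 + sgn x) / 2" for x
  proof (cases "x = 0")
    case True
    then show ?thesis by (simp add: f'_def)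
  next
    case False
    then have "(\<lambda>n. f' n x) \<longlonglongrightarrow> (1 + x / sqrt (x\<^sup>2 + 0\<^sup>2)) / 2"
      unfolding f'_def by (intro tendsto_intros \<delta>lim) auto
    then show ?thesis by (simp add: real_sgn_eq)
  qed
  define h where "h s = (1 + sgn (z s)) / 2 * g s" for s
  note [measurable] = L2_measurable[OF g] continuous_on_borel_LM[OF zc]
  have sgnm: "(sgn :: real \<Rightarrow> real) \<in> borel_measurable borel"
    unfolding sgn_if[abs_def] by measurable
  have hm [measurable]: "h \<in> borel_measurable (LM T)"
    unfolding h_def using measurable_compose[OF continuous_on_borel_LM[OF zc] sgnm] by measurable
  have hL: "h \<in> L2 ?I"
  proof (rule L2_bound[OF hm g, of 1], rule AE_I2)
    fix s
    have "\<bar>(1 + sgn (z s)) / 2\<bar> \<le> 1" by (simp add: sgn_if)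
    from mult_right_mono[OF this, of "\<bar>g s\<bar>"]
    show "norm (h s) \<le> 1 * norm (g s)" by (simp add: h_def abs_mult)
  qed
  have eq: "max (z t) 0 = max c 0 + prim T h t" if t: "t \<in> {0..T}" for t
  proof -
    have f'm: "(\<lambda>s. f' n (z s)) \<in> borel_measurable (LM T)" for n
      by (intro continuous_on_borel_LM continuous_on_compose2[OF f'c zc]) auto
    have "(\<lambda>n. prim T (\<lambda>s. f' n (z s) * g s) t) \<longlonglongrightarrow> prim T h t"
      unfolding prim_def
    proof (rule integral_dominated_convergence[where w = "\<lambda>s. \<bar>g s\<bar>"])
      show "(\<lambda>s. indicator {..t} s *\<^sub>R h s) \<in> borel_measurable (LM T)" by measurable
      show "(\<lambda>s. indicator {..t} s *\<^sub>R (f' n (z s) * g s)) \<in> borel_measurable (LM T)" for n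
        using f'm[of n] by measurable
      show "integrable (LM T) (\<lambda>s. \<bar>g s\<bar>)" using gi by simp
      show "AE s in LM T. (\<lambda>n. indicator {..t} s *\<^sub>R (f' n (z s) * g s))
          \<longlonglongrightarrow> indicator {..t} s *\<^sub>R h s"
        unfolding h_def by (intro AE_I2 tendsto_scaleR tendsto_mult tendsto_const f'lim)
      show "AE s in LM T. norm (indicator {..t} s *\<^sub>R (f' n (z s) * g s)) \<le> \<bar>g s\<bar>" for n
      proof (rule AE_I2)
        fix s
        have "norm (indicator {..t} s *\<^sub>R (f' n (z s) * g s)) \<le> \<bar>f' n (z s)\<bar> * \<bar>g s\<bar>"
          by (simp add: indicator_def abs_mult)
        also have "\<dots> \<le> 1 * \<bar>g s\<bar>" by (rule mult_right_mono[OF f'b]) simp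
        finally show "norm (indicator {..t} s *\<^sub>R (f' n (z s) * g s)) \<le> \<bar>g s\<bar>" by simp
      qed
    qed
    then have "(\<lambda>n. f n c + prim T (\<lambda>s. f' n (z s) * g s) t) \<longlonglongrightarrow> max c 0 + prim T h t"
      by (intro tendsto_add flim)
    moreover have "f n (z t) = f n c + prim T (\<lambda>s. f' n (z s) * g s) t" for n
      unfolding z_def by (rule prim_chain[OF T g deriv f'c f'b t])
    ultimately have "(\<lambda>n. f n (z t)) \<longlonglongrightarrow> max c 0 + prim T h t" by simp
    then show ?thesis using flim[of "z t"] by (rule LIMSEQ_unique[rotated])
  qed
  show ?thesis by (rule that[OF hL]) (use eq in \<open>simp only: z_def\<close>)
qed

section \<open>Vector-valued functions\<close>

lemma borel_measurable_vec:
  fixes f :: "'b \<Rightarrow> real ^ 'n"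
  assumes "\<And>i. (\<lambda>s. f s $ i) \<in> borel_measurable M"
  shows "f \<in> borel_measurable M"
  using assms by (subst borel_measurable_euclidean_space) (auto simp: Basis_vec_def inner_axis)

lemma L2_nth:
  fixes f :: "real \<Rightarrow> real ^ 'n"
  assumes "f \<in> L2 I"
  shows "(\<lambda>s. f s $ i) \<in> L2 I"
proof (rule L2_bound[OF _ assms, of _ 1])
  have "(\<lambda>s. f s \<bullet> axis i 1) \<in> borel_measurable (lebesgue_on I)"
    using L2_measurable[OF assms] by measurable
  then show "(\<lambda>s. f s $ i) \<in> borel_measurable (lebesgue_on I)" by (simp add: inner_axis)
qed (simp add: component_le_norm_cart)

lemma L2_vec:
  fixes f :: "real \<Rightarrow> real ^ 'n"
  assumes "\<And>i. (\<lambda>s. f s $ i) \<in> L2 I"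
  shows "f \<in> L2 I"
proof (rule L2_majorant[of _ _ "\<lambda>s. \<Sum>i\<in>UNIV. (norm (f s $ i))\<^sup>2"])
  show "f \<in> borel_measurable (lebesgue_on I)"
    by (intro borel_measurable_vec L2_measurable assms)
  show "integrable (lebesgue_on I) (\<lambda>s. \<Sum>i\<in>UNIV. (norm (f s $ i))\<^sup>2)"
    by (intro Bochner_Integration.integrable_sum L2_norm_sq_integrable assms)
  show "AE t in lebesgue_on I. (norm (f t))\<^sup>2 \<le> (\<Sum>i\<in>UNIV. (norm (f t $ i))\<^sup>2)"
    by (simp add: norm_vec_def L2_set_def sum_nonneg)
qed

lemma prim_nth:
  fixes g :: "real \<Rightarrow> real ^ 'n"
  assumes "integrable (LM T) g"
  shows "prim T g t $ i = prim T (\<lambda>s. g s $ i) t"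
  using prim_component[OF assms, of "axis i 1"] by (simp add: inner_axis)

definition positive_part :: "real ^ 'n \<Rightarrow> real ^ 'n" where
  "positive_part x = (\<chi> i. max (x $ i) 0)"

lemma norm_positive_part_diff: "norm (positive_part x - positive_part y) \<le> norm (x - y)"
  by (rule norm_le_componentwise_cart) (auto simp: positive_part_def)

lemma continuous_positive_part: "continuous_on X positive_part"
  unfolding positive_part_def by (intro continuous_intros)

lemma borel_measurable_positive_part:
  "f \<in> borel_measurable M \<Longrightarrow> (\<lambda>s. positive_part (f s)) \<in> borel_measurable M"
  by (rule borel_measurable_continuous_on[OF continuous_positive_part])

lemma norm_positive_part: "norm (positive_part x) \<le> norm x"
  using norm_positive_part_diff[of x 0] by (simp add: positive_part_def zero_vec_def[symmetric])

lemma L2_positive_part: "(\<lambda>s. positive_part (f s)) \<in> L2 I" if f: "f \<in> L2 I"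
proof (rule L2_bound[OF _ f])
  show "AE s in lebesgue_on I. norm (positive_part (f s)) \<le> 1 * norm (f s)"
    by (simp add: norm_positive_part)
qed (intro borel_measurable_positive_part L2_measurable f)

lemma H1_positive_part:
  fixes z :: "real \<Rightarrow> real ^ 'n"
  assumes T: "0 < T" and z: "z \<in> H1 T"
  shows "(\<lambda>t. positive_part (z t)) \<in> H1 T"
proof -
  let ?g = "weak_deriv {0<..<T} z"
  have g: "?g \<in> L2 {0<..<T}" by (rule H1_weak_deriv[OF z])
  have "\<exists>h. h \<in> L2 {0<..<T} \<and> (\<forall>t\<in>{0..T}. max (z 0 $ i + prim T (\<lambda>s. ?g s $ i) t) 0 = max (z 0 $ i) 0 + prim T h t)" for i
    by (rule prim_max[OF T L2_nth[OF g], where c = "z 0 $ i"]) blast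
  then obtain h where h: "\<And>i. h i \<in> L2 {0<..<T}"
    and eq: "\<And>i t. t \<in> {0..T} \<Longrightarrow> max (z 0 $ i + prim T (\<lambda>s. ?g s $ i) t) 0 = max (z 0 $ i) 0 + prim T (h i) t"
    by metis
  have hL: "(\<lambda>s. \<chi> i. h i s) \<in> L2 {0<..<T}" by (rule L2_vec) (simp add: h)
  show ?thesis
  proof (rule H1_I[OF hL])
    fix t assume t: "t \<in> {0..T}"
    show "positive_part (z t) = positive_part (z 0) + prim T (\<lambda>s. \<chi> i. h i s) t"
    proof (subst vec_eq_iff, rule allI)
      fix i
      have "z t $ i = z 0 $ i + prim T (\<lambda>s. ?g s $ i) t"
        by (subst H1_eq_prim[OF z t]) (simp add: prim_nth L2_integrable g)
      then show "positive_part (z t) $ i = (positive_part (z 0) + prim T (\<lambda>s. \<chi> i. h i s) t) $ i"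
        using eq[OF t, of i] by (simp add: positive_part_def prim_nth[OF L2_integrable[OF hL]])
    qed
  qed
qed

lemma difference_quotient_limit:
  fixes f :: "real \<Rightarrow> real"
  assumes "f differentiable (at x)" and "h \<longlonglongrightarrow> 0" "\<And>n. h n \<noteq> 0"
  shows "(\<lambda>n. (f (x + h n) - f x) / h n) \<longlonglongrightarrow> deriv f x"
proof -
  have "(f has_real_derivative deriv f x) (at x)"
    using assms(1) by (simp add: DERIV_deriv_iff_real_differentiable)
  then have "(\<lambda>h. (f (x + h) - f x) / h) \<midarrow>0\<rightarrow> deriv f x" by (simp add: DERIV_def)
  moreover have "filterlim h (at 0) sequentially"
    using assms(2,3) by (simp add: filterlim_at)
  ultimately show ?thesis by (rule filterlim_compose)
qed

text \<open>A pointwise limit of continuous difference quotients. It makes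
  \<open>deriv \<kappa>\<close> along the history measurable.\<close>

lemma borel_measurable_deriv:
  fixes f :: "real \<Rightarrow> real"
  assumes f: "\<And>x. f differentiable (at x)"
  shows "deriv f \<in> borel_measurable borel"
proof (rule borel_measurable_LIMSEQ_metric)
  have "continuous_on UNIV f"
    using f by (intro continuous_at_imp_continuous_on ballI differentiable_imp_continuous_within)
  then have [measurable]: "f \<in> borel_measurable borel" by (rule borel_measurable_continuous_onI)
  show "(\<lambda>x. (f (x + inverse (real (Suc n))) - f x) / inverse (real (Suc n))) \<in> borel_measurable borel" for n
    by measurable
  show "(\<lambda>n. (f (x + inverse (real (Suc n))) - f x) / inverse (real (Suc n))) \<longlonglongrightarrow> deriv f x" for x
    by (rule difference_quotient_limit[OF f LIMSEQ_inverse_real_of_nat]) simp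
qed

section \<open>The regularised state equation\<close>

text \<open>The vector p = positive_part(m) / \<epsilon> is the projection of m / \<epsilon> onto
  the cone, and \<open>proj\<close> is its variational inequality. For the uniqueness direction, the
  subgradient inequality at x tested with p leaves the factor \<epsilon>/2 in front of |p - x|^2
  while \<open>proj\<close> tested with x demands \<epsilon>, so p = x.\<close>

lemma subdifferential_dissipation_eps:
  assumes \<epsilon>: "0 < \<epsilon>"
  shows "g \<in> subdifferential (dissipation_eps \<kappa> \<epsilon> \<zeta>) x
    \<longleftrightarrow> x = (1 / \<epsilon>) *\<^sub>R positive_part (g - componentwise \<kappa> \<zeta>)"
proof -
  define k where "k = componentwise \<kappa> \<zeta>"
  define m where "m = g - k"
  define p where "p = (1 / \<epsilon>) *\<^sub>R positive_part m"
  have gm: "g = m + k" by (simp add: m_def)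
  have pc: "p \<in> nonneg_cone" using \<epsilon> by (simp add: p_def positive_part_def nonneg_cone_def)
  have proj: "(m - \<epsilon> *\<^sub>R p) \<bullet> (y - p) \<le> 0" if "y \<in> nonneg_cone" for y
    unfolding inner_vec_def
  proof (rule sum_nonpos)
    fix i
    have "0 \<le> y $ i" using that by (simp add: nonneg_cone_def)
    then show "(m - \<epsilon> *\<^sub>R p) $ i \<bullet> (y - p) $ i \<le> 0"
      using \<epsilon> by (auto simp: p_def positive_part_def max_def mult_nonpos_nonneg)
  qed
  have sq: "(norm y)\<^sup>2 = (norm u)\<^sup>2 + 2 * (u \<bullet> (y - u)) + (norm (y - u))\<^sup>2" for y u :: "real ^ 'a"
    by (simp add: power2_norm_eq_inner inner_diff_left inner_diff_right inner_commute)
  show ?thesis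
    unfolding k_def[symmetric] m_def[symmetric] p_def[symmetric]
  proof
    assume g: "g \<in> subdifferential (dissipation_eps \<kappa> \<epsilon> \<zeta>) x"
    then have xc: "x \<in> nonneg_cone"
      by (auto simp: subdifferential_def dissipation_eps_def split: if_splits)
    have "dissipation_eps \<kappa> \<epsilon> \<zeta> x + ereal (g \<bullet> (p - x)) \<le> dissipation_eps \<kappa> \<epsilon> \<zeta> p"
      using g by (simp add: subdifferential_def)
    then have "k \<bullet> x + \<epsilon> / 2 * (norm x)\<^sup>2 + g \<bullet> (p - x) \<le> k \<bullet> p + \<epsilon> / 2 * (norm p)\<^sup>2"
      using xc pc by (simp add: dissipation_eps_def k_def)
    then have "m \<bullet> (p - x) \<le> \<epsilon> * (x \<bullet> (p - x)) + \<epsilon> / 2 * (norm (p - x))\<^sup>2"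
      unfolding sq[of p x] gm by (simp add: algebra_simps)
    moreover have "m \<bullet> (p - x) \<ge> \<epsilon> * (p \<bullet> (p - x))"
      using proj[OF xc] by (simp add: algebra_simps)
    moreover have "\<epsilon> * (p \<bullet> (p - x)) = \<epsilon> * (x \<bullet> (p - x)) + \<epsilon> * (norm (p - x))\<^sup>2"
      by (simp add: power2_norm_eq_inner algebra_simps)
    ultimately have "\<epsilon> * (norm (p - x))\<^sup>2 \<le> \<epsilon> / 2 * (norm (p - x))\<^sup>2" by linarith
    then have "(norm (p - x))\<^sup>2 \<le> 0" using \<epsilon> by simp
    then show "x = p" by simp
  next
    assume x: "x = p"
    show "g \<in> subdifferential (dissipation_eps \<kappa> \<epsilon> \<zeta>) x"
      unfolding subdifferential_def x
    proof (intro CollectI conjI allI)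
      show "\<bar>dissipation_eps \<kappa> \<epsilon> \<zeta> p\<bar> \<noteq> \<infinity>" using pc by (simp add: dissipation_eps_def)
      fix y
      show "dissipation_eps \<kappa> \<epsilon> \<zeta> p + ereal (g \<bullet> (y - p)) \<le> dissipation_eps \<kappa> \<epsilon> \<zeta> y"
      proof (cases "y \<in> nonneg_cone")
        case True
        have "m \<bullet> (y - p) \<le> \<epsilon> * (p \<bullet> (y - p))"
          using proj[OF True] by (simp add: inner_diff_left)
        moreover have "0 \<le> \<epsilon> / 2 * (norm (y - p))\<^sup>2" using \<epsilon> by simp
        ultimately have "k \<bullet> p + \<epsilon> / 2 * (norm p)\<^sup>2 + g \<bullet> (y - p) \<le> k \<bullet> y + \<epsilon> / 2 * (norm y)\<^sup>2"
          unfolding sq[of y p] gm by (simp add: algebra_simps)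
        then show ?thesis using True pc by (simp add: dissipation_eps_def k_def)
      qed (simp add: dissipation_eps_def)
    qed
  qed
qed

lemma history_eq: "t \<in> {0..T} \<Longrightarrow> history y0 q t = y0 + prim T q t"
  by (simp add: history_def prim_eq_integral)

locale viscous_evolution =
  fixes T \<alpha> \<epsilon> L :: real and \<kappa> :: "real \<Rightarrow> real" and y0 :: "real ^ 'n"
  assumes T: "0 < T" and \<alpha>: "0 < \<alpha>" and \<epsilon>: "0 < \<epsilon>"
    and \<kappa>_Lipschitz: "\<And>x y. \<bar>\<kappa> x - \<kappa> y\<bar> \<le> L * \<bar>x - y\<bar>"
    and \<kappa>_differentiable: "\<And>x. \<kappa> differentiable (at x)"
begin

abbreviation I :: "real set" where
  "I \<equiv> {0<..<T}"

section \<open>Composition of \<kappa> with the history operator\<close>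

lemma T0: "0 \<le> T"
  using T by simp

lemma L0: "0 \<le> L"
  using \<kappa>_Lipschitz[of 1 0] by simp

lemma norm_componentwise_diff: "norm (componentwise \<kappa> x - componentwise \<kappa> y) \<le> L * norm (x - y)"
proof -
  have "norm (componentwise \<kappa> x - componentwise \<kappa> y) \<le> norm (L *\<^sub>R (x - y))"
    using \<kappa>_Lipschitz L0 by (intro norm_le_componentwise_cart) (simp add: componentwise_def abs_mult)
  then show ?thesis using L0 by simp
qed

lemma \<kappa>_continuous: "continuous_on X \<kappa>"
  using \<kappa>_differentiable by (intro continuous_at_imp_continuous_on ballI differentiable_imp_continuous_within)

lemma abs_deriv_\<kappa>_le: "\<bar>deriv \<kappa> x\<bar> \<le> L"
proof -
  let ?h = "\<lambda>n. inverse (real (Suc n))"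
  have "(\<lambda>n. \<bar>(\<kappa> (x + ?h n) - \<kappa> x) / ?h n\<bar>) \<longlonglongrightarrow> \<bar>deriv \<kappa> x\<bar>"
    by (intro tendsto_rabs difference_quotient_limit \<kappa>_differentiable LIMSEQ_inverse_real_of_nat) simp
  then show ?thesis
  proof (rule LIMSEQ_le_const2, intro exI allI impI)
    fix n
    have "\<bar>\<kappa> (x + ?h n) - \<kappa> x\<bar> \<le> L * ?h n" using \<kappa>_Lipschitz[of "x + ?h n" x] by simp
    then show "\<bar>(\<kappa> (x + ?h n) - \<kappa> x) / ?h n\<bar> \<le> L"
      by (simp only: abs_divide) (simp add: field_simps)
  qed
qed

lemma continuous_componentwise_\<kappa>:
  assumes "continuous_on X f"
  shows "continuous_on X (\<lambda>t. componentwise \<kappa> (f t))"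
  unfolding componentwise_def
  by (intro continuous_intros continuous_on_compose2[OF \<kappa>_continuous[of UNIV]] assms) auto

lemma continuous_history:
  assumes "continuous_on {0..T} q"
  shows "continuous_on {0..T} (history y0 q)"
proof -
  have "continuous_on {0..T} (\<lambda>t. y0 + prim T q t)"
    by (intro continuous_intros continuous_on_prim L2_integrable continuous_on_L2 assms)
  then show ?thesis by (rule continuous_on_eq) (simp add: history_eq[where T = T])
qed

lemma deriv_\<kappa>_history_measurable:
  assumes "continuous_on {0..T} q"
  shows "(\<lambda>t. deriv \<kappa> (history y0 q t $ i)) \<in> borel_measurable (LM T)"
proof -
  have "(\<lambda>t. history y0 q t $ i) \<in> borel_measurable (LM T)"
    by (intro L2_measurable L2_nth continuous_on_L2 continuous_history assms)
  then show ?thesis by (rule measurable_compose[OF _ borel_measurable_deriv[OF \<kappa>_differentiable]])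
qed

text \<open>For continuous q the history is continuously differentiable, so the chain rule holds
  pointwise, and \<open>prim_FTC\<close> copes with the density. Together with
  \<open>H1_positive_part\<close> this gives the second derivative of the state.\<close>

lemma H1_\<kappa>_history:
  assumes q: "continuous_on {0..T} q"
  shows "(\<lambda>t. componentwise \<kappa> (history y0 q t)) \<in> H1 T"
proof -
  have qL: "q \<in> L2 I" by (rule continuous_on_L2[OF q])
  have qi: "integrable (LM T) q" by (rule L2_integrable[OF qL])
  define g where "g t = (\<chi> i. deriv \<kappa> (history y0 q t $ i) * q t $ i)" for t
  have gn: "(\<lambda>t. g t $ i) \<in> L2 I" for i
  proof (rule L2_bound[OF _ L2_nth[OF qL], of _ L i])
    show "(\<lambda>t. g t $ i) \<in> borel_measurable (LM T)"
      using deriv_\<kappa>_history_measurable[OF q, of i] L2_measurable[OF L2_nth[OF qL, of i]]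
      by (simp add: g_def)
  qed (use abs_deriv_\<kappa>_le in \<open>simp add: g_def abs_mult mult_right_mono\<close>)
  have gL: "g \<in> L2 I" by (rule L2_vec[OF gn])
  show ?thesis
  proof (rule H1_I[OF gL])
    fix t assume t: "t \<in> {0..T}"
    show "componentwise \<kappa> (history y0 q t) = componentwise \<kappa> y0 + prim T g t"
    proof (subst vec_eq_iff, rule allI)
      fix i
      have "\<kappa> (history y0 q t $ i) = \<kappa> (history y0 q 0 $ i) + prim T (\<lambda>s. g s $ i) t"
      proof (rule prim_FTC[OF L2_integrable[OF gn] _ _ t])
        show "continuous_on {0..T} (\<lambda>t. \<kappa> (history y0 q t $ i))"
          by (intro continuous_on_compose2[OF \<kappa>_continuous[of UNIV]] continuous_intros continuous_history q) auto
        fix s assume s: "s \<in> I"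
        have "(prim T (\<lambda>s. q s $ i) has_real_derivative q s $ i) (at s)"
          by (intro prim_has_derivative continuous_intros q s)
        then have "((\<lambda>t. y0 $ i + prim T (\<lambda>s. q s $ i) t) has_real_derivative q s $ i) (at s)"
          by (auto intro!: derivative_eq_intros)
        then have "((\<lambda>t. history y0 q t $ i) has_real_derivative q s $ i) (at s)"
          by (rule has_field_derivative_transform_within_open[OF _ open_greaterThanLessThan s])
            (simp add: history_eq[where T = T] prim_nth[OF qi])
        then have "((\<lambda>t. \<kappa> (history y0 q t $ i)) has_real_derivative g s $ i) (at s)"
          unfolding g_def vec_lambda_beta
          by (intro DERIV_chain2) (auto simp: DERIV_deriv_iff_real_differentiable \<kappa>_differentiable)
        then show "((\<lambda>t. \<kappa> (history y0 q t $ i)) has_vector_derivative g s $ i) (at s)"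
          by (simp add: has_real_derivative_iff_has_vector_derivative)
      qed
      moreover have "history y0 q 0 = y0" using history_eq[of 0 T y0 q] T by simp
      ultimately show "componentwise \<kappa> (history y0 q t) $ i = (componentwise \<kappa> y0 + prim T g t) $ i"
        by (simp add: componentwise_def prim_nth[OF L2_integrable[OF gL]])
    qed
  qed
qed

section \<open>The state equation in integrated form\<close>

definition driving_force :: "(real \<Rightarrow> real ^ 'n) \<Rightarrow> (real \<Rightarrow> real ^ 'n) \<Rightarrow> real \<Rightarrow> real ^ 'n" where
  "driving_force l q t = - \<alpha> *\<^sub>R q t + l t - componentwise \<kappa> (history y0 q t)"

abbreviation state :: "(real \<Rightarrow> real ^ 'n) \<Rightarrow> (real \<Rightarrow> real ^ 'n) \<Rightarrow> bool" where
  "state \<equiv> is_state T \<alpha> y0 (dissipation_eps \<kappa> \<epsilon>)"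

lemma driving_force_L2:
  assumes "l \<in> L2 I" "continuous_on {0..T} q"
  shows "driving_force l q \<in> L2 I"
  unfolding driving_force_def
  by (intro L2_intros assms continuous_on_L2 continuous_componentwise_\<kappa> continuous_history)

lemma state_iff_AE:
  "state l q \<longleftrightarrow> q \<in> H10 T \<and>
     (AE t in LM T. weak_deriv I q t = (1 / \<epsilon>) *\<^sub>R positive_part (driving_force l q t))"
  by (simp only: is_state_def subdifferential_dissipation_eps[OF \<epsilon>] driving_force_def)

lemma stateD:
  assumes l: "l \<in> L2 I" and q: "state l q"
  shows "continuous_on {0..T} q"
    and "(\<lambda>s. (1 / \<epsilon>) *\<^sub>R positive_part (driving_force l q s)) \<in> L2 I"
    and "t \<in> {0..T} \<Longrightarrow> q t = prim T (\<lambda>s. (1 / \<epsilon>) *\<^sub>R positive_part (driving_force l q s)) t"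
proof -
  have qH: "q \<in> H10 T" and ae: "AE t in LM T. weak_deriv I q t = (1 / \<epsilon>) *\<^sub>R positive_part (driving_force l q t)"
    using q unfolding state_iff_AE by blast+
  show qc: "continuous_on {0..T} q" by (rule H1_continuous[OF H10_H1[OF qH]])
  show g: "(\<lambda>s. (1 / \<epsilon>) *\<^sub>R positive_part (driving_force l q s)) \<in> L2 I"
    by (intro L2_scaleR L2_positive_part driving_force_L2 l qc)
  assume t: "t \<in> {0..T}"
  have "q 0 = 0" using qH by (simp add: H10_def)
  then have "q t = prim T (weak_deriv I q) t"
    using H1_eq_prim[OF H10_H1[OF qH] t] by simp
  also have "\<dots> = prim T (\<lambda>s. (1 / \<epsilon>) *\<^sub>R positive_part (driving_force l q s)) t"
    by (rule prim_cong_AE[OF L2_measurable[OF H1_weak_deriv(1)[OF H10_H1[OF qH]]] L2_measurable[OF g] ae])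
  finally show "q t = prim T (\<lambda>s. (1 / \<epsilon>) *\<^sub>R positive_part (driving_force l q s)) t" .
qed

text \<open>Here the driving force y is the datum and q is a plain integral of it; the load only has
  to be adjusted so that its driving force is y. No fixed point problem arises.\<close>

lemma stateI:
  assumes y: "y \<in> L2 I"
    and q: "\<And>t. t \<in> {0..T} \<Longrightarrow> q t = prim T (\<lambda>s. (1 / \<epsilon>) *\<^sub>R positive_part (y s)) t"
    and l: "\<And>t. t \<in> I \<Longrightarrow> driving_force l q t = y t"
  shows "state l q"
proof -
  have g: "(\<lambda>s. (1 / \<epsilon>) *\<^sub>R positive_part (y s)) \<in> L2 I"
    by (intro L2_scaleR L2_positive_part y)
  have q': "q t = 0 + prim T (\<lambda>s. (1 / \<epsilon>) *\<^sub>R positive_part (y s)) t" if "t \<in> {0..T}" for t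
    using q[OF that] by simp
  have "q \<in> H10 T" using H1_I[OF g q'] q[of 0] T by (simp add: H10_def)
  moreover have "AE t in LM T. weak_deriv I q t = (1 / \<epsilon>) *\<^sub>R positive_part (y t)"
    by (rule weak_deriv_unique[OF T0 g q'])
  then have "AE t in LM T. weak_deriv I q t = (1 / \<epsilon>) *\<^sub>R positive_part (driving_force l q t)"
    using AE_space by eventually_elim (simp add: l)
  ultimately show ?thesis by (simp add: state_iff_AE)
qed

lemma prim_exp:
  assumes c: "c \<noteq> 0" and t: "t \<in> {0..T}"
  shows "prim T (\<lambda>s. exp (c * s)) t = (exp (c * t) - 1) / c"
proof -
  have "exp (c * t) / c = exp (c * 0) / c + prim T (\<lambda>s. exp (c * s)) t"
  proof (rule prim_FTC[OF _ _ _ t])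
    show "integrable (LM T) (\<lambda>s. exp (c * s))"
      by (intro L2_integrable continuous_on_L2 continuous_intros)
    show "continuous_on {0..T} (\<lambda>s. exp (c * s) / c)"
      using c by (intro continuous_intros) auto
    show "((\<lambda>s. exp (c * s) / c) has_vector_derivative exp (c * s)) (at s)" for s
      unfolding has_real_derivative_iff_has_vector_derivative[symmetric]
      using c by (auto intro!: derivative_eq_intros)
  qed
  then show ?thesis using c by (simp add: field_simps)
qed

text \<open>The exponential undoes the weight of the supremum norm at the final time, the factor 2
  comes from absorbing the contraction constant 1/2, and sqrt(T) / \<epsilon> bounds the time
  integral of the load difference by its L2 norm.\<close>

definition Lipschitz_const :: real where
  "Lipschitz_const = exp ((1 + 2 * (\<alpha> + L) / \<epsilon>) * T) * (2 * (sqrt T / \<epsilon>))"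

lemma Lipschitz_const_nonneg: "0 \<le> Lipschitz_const"
  using T \<epsilon> by (simp add: Lipschitz_const_def)

text \<open>
  Gronwall's argument with the weighted supremum \<open>sup e\<^bsup>-ct\<^esup> \<bar>q1 t - q2 t\<bar>\<close>: for the chosen \<open>c\<close>
  the integral operator is a contraction with constant \<open>1/2\<close>.
\<close>

lemma state_Lipschitz:
  assumes l1: "l1 \<in> L2 I" and l2: "l2 \<in> L2 I" and q1: "state l1 q1" and q2: "state l2 q2"
    and t: "t \<in> {0..T}"
  shows "norm (q1 t - q2 t) \<le> Lipschitz_const * L2_norm I (\<lambda>s. l1 s - l2 s)"
proof -
  let ?\<kappa> = "\<lambda>q s. componentwise \<kappa> (history y0 q s)"
  let ?f = "\<lambda>l q s. (1 / \<epsilon>) *\<^sub>R positive_part (driving_force l q s)"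
  \<comment> \<open>Integrating exp(c s) gains 1/c, so 2 (\<alpha> + L) / \<epsilon> in
    \<open>c\<close> makes the contraction constant 1/2. The summand 1 gives c \<ge> 1, by which the
    history difference obeys the same bound as the state difference.\<close>
  define c where "c = 1 + 2 * (\<alpha> + L) / \<epsilon>"
  have "1 \<le> c" using \<alpha> L0 \<epsilon> by (simp add: c_def)
  have c\<epsilon>: "(\<alpha> + L) / \<epsilon> \<le> c / 2" by (simp add: c_def field_simps)
  note c1 = stateD[OF l1 q1] and c2 = stateD[OF l2 q2]
  define D where "D s = norm (q1 s - q2 s)" for s
  have Dc: "continuous_on {0..T} D" unfolding D_def by (intro continuous_intros c1(1) c2(1))
  have "\<exists>x\<in>{0..T}. \<forall>y\<in>{0..T}. exp (- c * y) * D y \<le> exp (- c * x) * D x"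
    using T by (intro continuous_attains_sup continuous_intros Dc) auto
  then obtain ts where ts: "ts \<in> {0..T}" and max: "\<And>y. y \<in> {0..T} \<Longrightarrow> exp (- c * y) * D y \<le> exp (- c * ts) * D ts"
    by blast
  define M where "M = exp (- c * ts) * D ts"
  have M0: "0 \<le> M" by (simp add: M_def D_def)
  have DM: "D s \<le> M * exp (c * s)" if "s \<in> {0..T}" for s
  proof -
    have "exp (c * s) * (exp (- c * s) * D s) \<le> exp (c * s) * M"
      using max[OF that] by (intro mult_left_mono) (auto simp: M_def)
    moreover have "exp (c * s) * (exp (- c * s) * D s) = D s"
      by (simp only: mult.assoc[symmetric] mult_minus_left exp_minus_inverse mult_1_left)
    ultimately show ?thesis by (simp only: mult.commute)
  qed
  have ei: "integrable (LM T) (\<lambda>s. exp (c * s))"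
    by (intro L2_integrable continuous_on_L2 continuous_intros)
  have pe: "prim T (\<lambda>s. exp (c * s)) s \<le> exp (c * s) / c" if "s \<in> {0..T}" for s
    using \<open>1 \<le> c\<close> prim_exp[OF _ that, of c] by (simp add: divide_right_mono)
  have hist: "norm (history y0 q1 s - history y0 q2 s) \<le> M * exp (c * s)" if s: "s \<in> {0..T}" for s
  proof -
    have qi: "integrable (LM T) q1" "integrable (LM T) q2"
      using c1(1) c2(1) by (auto intro: L2_integrable continuous_on_L2)
    have "norm (history y0 q1 s - history y0 q2 s) = norm (prim T (\<lambda>s. q1 s - q2 s) s)"
      by (simp add: history_eq[OF s] prim_diff qi)
    also have "\<dots> \<le> prim T (\<lambda>s. M *\<^sub>R exp (c * s)) s"
    proof (rule norm_prim_le)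
      show "(\<lambda>s. q1 s - q2 s) \<in> borel_measurable (LM T)" using qi by simp
      show "integrable (LM T) (\<lambda>s. M *\<^sub>R exp (c * s))" using ei by simp
      show "AE x in LM T. x \<le> s \<longrightarrow> norm (q1 x - q2 x) \<le> M *\<^sub>R exp (c * x)"
        by (rule AE_I2) (use DM in \<open>simp add: D_def\<close>)
    qed
    also have "\<dots> = M * prim T (\<lambda>s. exp (c * s)) s" by (simp only: prim_scaleR) simp
    also have "\<dots> \<le> M * (exp (c * s) / c)" by (rule mult_left_mono[OF pe[OF s] M0])
    also have "\<dots> \<le> M * exp (c * s)"
      using \<open>1 \<le> c\<close> by (intro mult_left_mono M0) (simp add: divide_le_eq mult_le_cancel_left1)
    finally show ?thesis .
  qed
  have force: "norm (driving_force l1 q1 s - driving_force l2 q2 s)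
      \<le> (\<alpha> + L) * M * exp (c * s) + norm (l1 s - l2 s)" if s: "s \<in> {0..T}" for s
  proof -
    have "driving_force l1 q1 s - driving_force l2 q2 s
        = (l1 s - l2 s) - \<alpha> *\<^sub>R (q1 s - q2 s)
          - (?\<kappa> q1 s - ?\<kappa> q2 s)"
      by (simp add: driving_force_def algebra_simps)
    also have "norm \<dots> \<le> norm (l1 s - l2 s) + norm (\<alpha> *\<^sub>R (q1 s - q2 s))
        + norm (?\<kappa> q1 s - ?\<kappa> q2 s)"
      by (intro order_trans[OF norm_triangle_ineq4] add_mono norm_triangle_ineq4 order_refl)
    also have "\<dots> \<le> norm (l1 s - l2 s) + \<alpha> * (M * exp (c * s)) + L * (M * exp (c * s))"
    proof (intro add_mono order_refl)
      show "norm (\<alpha> *\<^sub>R (q1 s - q2 s)) \<le> \<alpha> * (M * exp (c * s))"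
        using DM[OF s] \<alpha> by (simp add: D_def)
      show "norm (?\<kappa> q1 s - ?\<kappa> q2 s) \<le> L * (M * exp (c * s))"
        by (rule order_trans[OF norm_componentwise_diff mult_left_mono[OF hist[OF s] L0]])
    qed
    also have "\<dots> = (\<alpha> + L) * M * exp (c * s) + norm (l1 s - l2 s)" by (simp add: algebra_simps)
    finally show ?thesis .
  qed
  let ?g1 = "?f l1 q1" and ?g2 = "?f l2 q2"
  let ?dl = "L2_norm I (\<lambda>s. l1 s - l2 s)"
  have dL: "(\<lambda>s. l1 s - l2 s) \<in> L2 I" by (rule L2_diff[OF l1 l2])
  have ni: "integrable (LM T) (\<lambda>s. norm (l1 s - l2 s))"
    by (intro integrable_norm L2_integrable dL)
  define A where "A = (\<alpha> + L) / \<epsilon> * M"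
  let ?m = "\<lambda>s. A *\<^sub>R exp (c * s) + (1 / \<epsilon>) *\<^sub>R norm (l1 s - l2 s)"
  have "D ts = norm (prim T (\<lambda>s. ?g1 s - ?g2 s) ts)"
    unfolding D_def c1(3)[OF ts] c2(3)[OF ts]
    by (subst prim_diff[OF L2_integrable[OF c1(2)] L2_integrable[OF c2(2)]]) simp
  also have "\<dots> \<le> prim T ?m ts"
  proof (rule norm_prim_le)
    show "(\<lambda>s. ?g1 s - ?g2 s) \<in> borel_measurable (LM T)"
      by (intro L2_measurable L2_diff c1(2) c2(2))
    show "integrable (LM T) ?m"
      using ei ni by simp
    show "AE x in LM T. x \<le> ts \<longrightarrow> norm (?g1 x - ?g2 x) \<le> ?m x"
    proof (rule AE_I2, rule impI)
      fix x assume "x \<in> space (LM T)"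
      then have x: "x \<in> {0..T}" by simp
      have "norm (?g1 x - ?g2 x)
          = (1 / \<epsilon>) * norm (positive_part (driving_force l1 q1 x) - positive_part (driving_force l2 q2 x))"
        using \<epsilon> by (simp add: scaleR_diff_right[symmetric])
      also have "\<dots> \<le> (1 / \<epsilon>) * ((\<alpha> + L) * M * exp (c * x) + norm (l1 x - l2 x))"
        using \<epsilon> by (intro mult_left_mono order_trans[OF norm_positive_part_diff force[OF x]]) simp
      also have "\<dots> = ?m x"
        by (simp add: A_def algebra_simps add_divide_distrib)
      finally show "norm (?g1 x - ?g2 x) \<le> ?m x" .
    qed
  qed
  also have "\<dots> = A * prim T (\<lambda>s. exp (c * s)) ts + (1 / \<epsilon>) * prim T (\<lambda>s. norm (l1 s - l2 s)) ts"
  proof -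
    have i: "integrable (LM T) (\<lambda>s. A *\<^sub>R exp (c * s))" "integrable (LM T) (\<lambda>s. (1 / \<epsilon>) *\<^sub>R norm (l1 s - l2 s))"
      using ei ni by auto
    show ?thesis unfolding prim_add[OF i] prim_scaleR by simp
  qed
  also have "\<dots> \<le> M / 2 * exp (c * ts) + sqrt T / \<epsilon> * ?dl"
  proof (intro add_mono)
    have "A * prim T (\<lambda>s. exp (c * s)) ts \<le> A * (exp (c * ts) / c)"
      using \<alpha> L0 \<epsilon> M0 by (intro mult_left_mono pe ts) (auto simp: A_def)
    also have "\<dots> = A / c * exp (c * ts)" by simp
    also have "\<dots> \<le> M / 2 * exp (c * ts)"
    proof (rule mult_right_mono)
      have "A \<le> c / 2 * M" unfolding A_def by (rule mult_right_mono[OF c\<epsilon> M0])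
      then show "A / c \<le> M / 2" using \<open>1 \<le> c\<close> by (simp add: field_simps)
    qed simp
    finally show "A * prim T (\<lambda>s. exp (c * s)) ts \<le> M / 2 * exp (c * ts)" .
    have "prim T (\<lambda>s. norm (l1 s - l2 s)) ts \<le> (LINT s|LM T. norm (l1 s - l2 s))"
      using norm_prim_le_integral[OF ni, of ts] by simp
    also have "\<dots> \<le> sqrt T * ?dl" by (rule L2_integral_norm_le[OF T0 dL])
    finally show "(1 / \<epsilon>) * prim T (\<lambda>s. norm (l1 s - l2 s)) ts \<le> sqrt T / \<epsilon> * ?dl"
      using \<epsilon> by (simp add: divide_right_mono)
  qed
  finally have "D ts \<le> M / 2 * exp (c * ts) + sqrt T / \<epsilon> * ?dl" .
  \<comment> \<open>Weighting the estimate at the maximiser \<open>ts\<close> makes its left side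
    \<open>M\<close>; the term \<open>M / 2\<close> on the right is then absorbed.\<close>
  then have "exp (- c * ts) * D ts \<le> exp (- c * ts) * (M / 2 * exp (c * ts) + sqrt T / \<epsilon> * ?dl)"
    by (intro mult_left_mono) auto
  also have "\<dots> = M / 2 + exp (- c * ts) * (sqrt T / \<epsilon> * ?dl)"
    by (simp add: distrib_left exp_minus field_simps)
  also have "\<dots> \<le> M / 2 + 1 * (sqrt T / \<epsilon> * ?dl)"
    using \<open>1 \<le> c\<close> ts \<epsilon> T by (intro add_left_mono mult_right_mono) (auto simp: L2_norm_nonneg)
  finally have M: "M \<le> 2 * (sqrt T / \<epsilon> * ?dl)" unfolding M_def[symmetric] by simp
  have "norm (q1 t - q2 t) \<le> M * exp (c * t)" using DM[OF t] by (simp add: D_def)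
  also have "\<dots> \<le> M * exp (c * T)" using \<open>1 \<le> c\<close> t M0 by (intro mult_left_mono) auto
  also have "\<dots> \<le> 2 * (sqrt T / \<epsilon> * ?dl) * exp (c * T)" by (rule mult_right_mono[OF M]) simp
  also have "\<dots> = Lipschitz_const * ?dl" by (simp add: Lipschitz_const_def c_def mult_ac)
  finally show ?thesis .
qed

end

section \<open>One-sided derivatives of the nonsmooth terms\<close>

text \<open>The one-sided directional derivative of max(x, 0). At x = 0 it is positively homogeneous
  but not linear in w, which is the origin of the interval condition on the multiplier.\<close>

definition max_deriv :: "real \<Rightarrow> real \<Rightarrow> real" where
  "max_deriv x w = (if 0 < x then w else if x = 0 then max w 0 else 0)"

definition positive_part_deriv :: "real ^ 'n \<Rightarrow> real ^ 'n \<Rightarrow> real ^ 'n" where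
  "positive_part_deriv x w = (\<chi> i. max_deriv (x $ i) (w $ i))"

lemma norm_positive_part_deriv: "norm (positive_part_deriv x w) \<le> norm w"
  by (rule norm_le_componentwise_cart) (auto simp: positive_part_deriv_def max_deriv_def)

text \<open>The quotient is eventually equal to its limit: away from 0 the sign of the argument
  stabilises, and at 0 the maximum is positively homogeneous.\<close>

lemma max_deriv_tendsto:
  assumes \<tau>: "\<tau> \<longlonglongrightarrow> 0" and pos: "\<And>n. 0 < \<tau> n"
  shows "(\<lambda>n. (max (x + \<tau> n * w) 0 - max x 0) / \<tau> n) \<longlonglongrightarrow> max_deriv x w"
proof -
  have lim: "(\<lambda>n. x + \<tau> n * w) \<longlonglongrightarrow> x"
    using tendsto_add[OF tendsto_const tendsto_mult_left_zero[OF \<tau>], of x w] by simp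
  consider "0 < x" | "x = 0" | "x < 0" by linarith
  then have "\<forall>\<^sub>F n in sequentially. (max (x + \<tau> n * w) 0 - max x 0) / \<tau> n = max_deriv x w"
  proof cases
    case 1
    from order_tendstoD(1)[OF lim 1] show ?thesis
    proof eventually_elim
      case (elim n)
      then show ?case using 1 pos[of n] by (simp add: max_deriv_def)
    qed
  next
    case 2
    have "max (\<tau> n * w) 0 = \<tau> n * max w 0" for n
      using pos[of n] by (simp add: max_def mult_le_0_iff)
    then have "(max (x + \<tau> n * w) 0 - max x 0) / \<tau> n = max_deriv x w" for n
      using 2 pos[of n] by (simp add: max_deriv_def)
    then show ?thesis by simp
  next
    case 3
    from order_tendstoD(2)[OF lim 3] show ?thesis
    proof eventually_elim
      case (elim n)
      then show ?case using 3 by (simp add: max_deriv_def)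
    qed
  qed
  then show ?thesis by (rule tendsto_eventually)
qed

lemma positive_part_deriv_tendsto:
  assumes \<tau>: "\<tau> \<longlonglongrightarrow> 0" and pos: "\<And>n. 0 < \<tau> n"
  shows "(\<lambda>n. (1 / \<tau> n) *\<^sub>R (positive_part (x + \<tau> n *\<^sub>R w) - positive_part x)) \<longlonglongrightarrow> positive_part_deriv x w"
proof (rule vec_tendstoI)
  fix i
  show "(\<lambda>n. ((1 / \<tau> n) *\<^sub>R (positive_part (x + \<tau> n *\<^sub>R w) - positive_part x)) $ i) \<longlonglongrightarrow> positive_part_deriv x w $ i"
    using max_deriv_tendsto[OF assms, of "x $ i" "w $ i"]
    by (simp add: positive_part_def positive_part_deriv_def)
qed

text \<open>Hadamard differentiability: with the Lipschitz bound the direction may vary with n. This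
  is needed because the perturbed histories move along directions that only converge.\<close>

lemma Lipschitz_difference_quotient_tendsto:
  fixes f :: "real \<Rightarrow> real"
  assumes lip: "\<And>x y. \<bar>f x - f y\<bar> \<le> L * \<bar>x - y\<bar>" and f: "f differentiable (at x)"
    and \<tau>: "\<tau> \<longlonglongrightarrow> 0" and pos: "\<And>n. 0 < \<tau> n" and b: "b \<longlonglongrightarrow> c"
  shows "(\<lambda>n. (f (x + \<tau> n * b n) - f x) / \<tau> n) \<longlonglongrightarrow> deriv f x * c"
proof -
  have 1: "(\<lambda>n. (f (x + \<tau> n * c) - f x) / \<tau> n) \<longlonglongrightarrow> deriv f x * c"
  proof (cases "c = 0")
    case True
    then show ?thesis by simp
  next
    case False
    have "(\<lambda>n. (f (x + \<tau> n * c) - f x) / (\<tau> n * c)) \<longlonglongrightarrow> deriv f x"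
      using False pos less_imp_neq[OF pos, symmetric]
      by (intro difference_quotient_limit f tendsto_mult_left_zero \<tau>) auto
    from tendsto_mult_right[OF this, of c] show ?thesis
      using False by (simp add: mult.commute)
  qed
  have 2: "(\<lambda>n. (f (x + \<tau> n * b n) - f (x + \<tau> n * c)) / \<tau> n) \<longlonglongrightarrow> 0"
  proof (rule LIMSEQ_bounded_by_null)
    show "norm ((f (x + \<tau> n * b n) - f (x + \<tau> n * c)) / \<tau> n - 0) \<le> L * \<bar>b n - c\<bar>" for n
    proof -
      have "\<bar>f (x + \<tau> n * b n) - f (x + \<tau> n * c)\<bar> \<le> L * \<bar>\<tau> n * (b n - c)\<bar>"
        using lip[of "x + \<tau> n * b n" "x + \<tau> n * c"] by (simp add: right_diff_distrib)
      also have "\<dots> = (L * \<bar>b n - c\<bar>) * \<tau> n" using pos[of n] by (simp add: abs_mult)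
      finally show ?thesis using pos[of n] by (simp add: pos_divide_le_eq)
    qed
    show "(\<lambda>n. L * \<bar>b n - c\<bar>) \<longlonglongrightarrow> 0"
      by (intro tendsto_mult_right_zero tendsto_rabs_zero) (rule LIM_zero[OF b])
  qed
  have "(\<lambda>n. (f (x + \<tau> n * b n) - f (x + \<tau> n * c)) / \<tau> n + (f (x + \<tau> n * c) - f x) / \<tau> n) \<longlonglongrightarrow> 0 + deriv f x * c"
    by (rule tendsto_add[OF 2 1])
  then show ?thesis by (simp add: add_divide_distrib[symmetric])
qed

context viscous_evolution
begin

section \<open>The linearised history operator and its adjoint\<close>

lemma kappa_history_deriv_eq:
  assumes "t \<in> {0..T}"
  shows "kappa_history_deriv \<kappa> y0 q v t = (\<chi> i. deriv \<kappa> (history y0 q t $ i) * prim T v t $ i)"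
  by (simp add: kappa_history_deriv_def prim_eq_integral[OF assms])

lemma norm_kappa_history_deriv_le:
  assumes "t \<in> {0..T}"
  shows "norm (kappa_history_deriv \<kappa> y0 q v t) \<le> L * norm (prim T v t)"
proof -
  have "norm (kappa_history_deriv \<kappa> y0 q v t) \<le> norm (L *\<^sub>R prim T v t)"
    using abs_deriv_\<kappa>_le L0
    by (intro norm_le_componentwise_cart)
      (simp add: kappa_history_deriv_eq[OF assms] abs_mult mult_right_mono)
  then show ?thesis using L0 by simp
qed

lemma kappa_history_deriv_L2:
  assumes q: "continuous_on {0..T} q" and v: "integrable (LM T) v"
  shows "kappa_history_deriv \<kappa> y0 q v \<in> L2 I"
proof (rule L2_bound[OF _ prim_L2[OF v], of _ L])
  have "(\<lambda>t. (\<chi> i. deriv \<kappa> (history y0 q t $ i) * prim T v t $ i) $ i) \<in> borel_measurable (LM T)" for i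
    using deriv_\<kappa>_history_measurable[OF q, of i] L2_measurable[OF L2_nth[OF prim_L2[OF v], of i]]
    by simp
  then have m: "(\<lambda>t. \<chi> i. deriv \<kappa> (history y0 q t $ i) * prim T v t $ i) \<in> borel_measurable (LM T)"
    by (rule borel_measurable_vec)
  show "kappa_history_deriv \<kappa> y0 q v \<in> borel_measurable (LM T)"
    by (subst measurable_cong[OF _ ]) (use m in \<open>auto simp: kappa_history_deriv_eq\<close>)
  show "AE t in LM T. norm (kappa_history_deriv \<kappa> y0 q v t) \<le> L * norm (prim T v t)"
    by (rule AE_I2) (simp add: norm_kappa_history_deriv_le)
qed

text \<open>\<open>L2_adjoint\<close> is a choice and says nothing until an adjoint is known to
  exist. The Riesz theorem on all of L2 provides one, as \<open>A\<close> is linear on the interval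
  and bounded by the sup estimate for primitives.\<close>

lemma L2_adjoint_kappa_history:
  assumes q: "continuous_on {0..T} q" and p: "p \<in> L2 I"
  defines "A \<equiv> kappa_history_deriv \<kappa> y0 q"
  shows "L2_adjoint I A p \<in> L2 I"
    and "v \<in> L2 I \<Longrightarrow> L2_inner I (A v) p = L2_inner I v (L2_adjoint I A p)"
proof -
  have AL: "A v \<in> L2 I" if "v \<in> L2 I" for v
    unfolding A_def by (rule kappa_history_deriv_L2[OF q L2_integrable[OF that]])
  have Aadd: "L2_inner I (A (\<lambda>t. u t + v t)) p = L2_inner I (A u) p + L2_inner I (A v) p"
    if u: "u \<in> L2 I" and v: "v \<in> L2 I" for u v
  proof -
    have "A (\<lambda>t. u t + v t) t = A u t + A v t" if "t \<in> I" for t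
      using that u v
      by (simp add: A_def kappa_history_deriv_eq vec_eq_iff prim_add L2_integrable algebra_simps)
    then have "L2_inner I (A (\<lambda>t. u t + v t)) p = L2_inner I (\<lambda>t. A u t + A v t) p"
      unfolding L2_inner_def by (intro Bochner_Integration.integral_cong) auto
    then show ?thesis by (simp add: L2_inner_add_left AL u v p)
  qed
  have Ascale: "L2_inner I (A (\<lambda>t. c *\<^sub>R v t)) p = c * L2_inner I (A v) p" for v c
  proof -
    have "A (\<lambda>t. c *\<^sub>R v t) t = c *\<^sub>R A v t" if "t \<in> I" for t
      using that by (simp add: A_def kappa_history_deriv_eq vec_eq_iff prim_scaleR)
    then have "L2_inner I (A (\<lambda>t. c *\<^sub>R v t)) p = L2_inner I (\<lambda>t. c *\<^sub>R A v t) p"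
      unfolding L2_inner_def by (intro Bochner_Integration.integral_cong) auto
    then show ?thesis by (simp add: L2_inner_scaleR_left)
  qed
  have Abound: "L2_inner I (A v) p \<le> (sqrt T * (L * sqrt T) * L2_norm I p) * L2_norm I v"
    if v: "v \<in> L2 I" for v
  proof -
    let ?C = "L * (sqrt T * L2_norm I v)"
    have C: "0 \<le> ?C" using L0 T by (simp add: L2_norm_nonneg)
    have "L2_norm I (A v) \<le> L2_norm I (\<lambda>_. ?C)"
    proof (rule L2_norm_mono[OF L2_measurable[OF AL[OF v]] continuous_on_L2], simp, rule AE_I2)
      fix t assume "t \<in> space (LM T)"
      then have t: "t \<in> {0..T}" by simp
      have "norm (A v t) \<le> L * norm (prim T v t)"
        unfolding A_def by (rule norm_kappa_history_deriv_le[OF t])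
      also have "\<dots> \<le> ?C" by (rule mult_left_mono[OF norm_prim_le_L2[OF T0 v] L0])
      finally show "norm (A v t) \<le> norm ?C" by simp
    qed
    also have "\<dots> = sqrt T * ?C" using L2_norm_const[OF T0, of ?C] C by simp
    finally have "L2_norm I (A v) * L2_norm I p \<le> sqrt T * ?C * L2_norm I p"
      by (rule mult_right_mono) (rule L2_norm_nonneg)
    moreover have "sqrt T * ?C * L2_norm I p = (sqrt T * (L * sqrt T) * L2_norm I p) * L2_norm I v"
      by (simp only: mult_ac)
    ultimately show ?thesis using L2_Cauchy_Schwarz[OF AL[OF v] p] by linarith
  qed
  obtain w where w: "w \<in> L2 I" "\<And>v. v \<in> L2 I \<Longrightarrow> L2_inner I (A v) p = L2_inner I w v"
  proof (rule L2_Riesz[of "L2 I" I "\<lambda>v. L2_inner I (A v) p" "sqrt T * (L * sqrt T) * L2_norm I p"])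
  qed (auto intro: L2_intros Aadd Ascale Abound)
  have "\<exists>w. w \<in> L2 I \<and> (\<forall>v\<in>L2 I. L2_inner I (A v) p = L2_inner I v w)"
    using w by (auto simp: L2_inner_commute[of I w])
  then have *: "L2_adjoint I A p \<in> L2 I \<and> (\<forall>v\<in>L2 I. L2_inner I (A v) p = L2_inner I v (L2_adjoint I A p))"
    unfolding L2_adjoint_def by (rule someI_ex)
  show "L2_adjoint I A p \<in> L2 I" using * by blast
  show "L2_inner I (A v) p = L2_inner I v (L2_adjoint I A p)" if "v \<in> L2 I" using * that by blast
qed

text \<open>The direction w is a variation of the driving force, not of the load; hence the formula
  is explicit in w.\<close>

definition rate_deriv :: "(real \<Rightarrow> real ^ 'n) \<Rightarrow> (real \<Rightarrow> real ^ 'n) \<Rightarrow> (real \<Rightarrow> real ^ 'n) \<Rightarrow> real \<Rightarrow> real ^ 'n" where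
  "rate_deriv l q w s = (1 / \<epsilon>) *\<^sub>R positive_part_deriv (driving_force l q s) (w s)"

lemma norm_rate_deriv: "norm (rate_deriv l q w s) \<le> 1 / \<epsilon> * norm (w s)"
  using \<epsilon> by (simp add: rate_deriv_def divide_right_mono norm_positive_part_deriv)

lemma rate_deriv_L2:
  assumes l: "l \<in> L2 I" and q: "continuous_on {0..T} q" and w: "w \<in> L2 I"
  shows "rate_deriv l q w \<in> L2 I"
proof (rule L2_bound[OF _ w])
  have m: "(\<lambda>s. positive_part_deriv (driving_force l q s) (w s)) \<in> borel_measurable (LM T)"
  proof (rule borel_measurable_vec)
    fix i
    have [measurable]: "(\<lambda>s. driving_force l q s $ i) \<in> borel_measurable (LM T)" "(\<lambda>s. w s $ i) \<in> borel_measurable (LM T)"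
      by (intro L2_measurable L2_nth driving_force_L2 l q w)+
    show "(\<lambda>s. positive_part_deriv (driving_force l q s) (w s) $ i) \<in> borel_measurable (LM T)"
      unfolding positive_part_deriv_def max_deriv_def vec_lambda_beta by measurable
  qed
  then show "rate_deriv l q w \<in> borel_measurable (LM T)"
    unfolding rate_deriv_def by measurable
  show "AE t in LM T. norm (rate_deriv l q w t) \<le> 1 / \<epsilon> * norm (w t)"
    by (rule AE_I2) (rule norm_rate_deriv)
qed

text \<open>
  Perturbing the driving force \<open>z\<close> instead of the load makes the state explicit: \<open>z + \<tau> w\<close> is the
  driving force of the load \<open>k\<close> below. So no linearised equation has to be solved.
\<close>

lemma perturbation:
  fixes \<tau> :: "nat \<Rightarrow> real"
  assumes l: "l \<in> L2 I" and q: "state l q" and w: "w \<in> L2 I"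
    and \<tau>: "\<tau> \<longlonglongrightarrow> 0" and pos: "\<And>n. 0 < \<tau> n"
    and \<delta>: "\<delta> = prim T (rate_deriv l q w)"
    and v: "v = (\<lambda>t. w t + \<alpha> *\<^sub>R \<delta> t + kappa_history_deriv \<kappa> y0 q \<delta> t)"
  obtains k p b where "\<And>n. k n \<in> L2 I" "\<And>n. state (k n) (p n)" "b \<longlonglongrightarrow> 0"
    "\<And>n t. t \<in> {0..T} \<Longrightarrow> norm (p n t - q t - \<tau> n *\<^sub>R \<delta> t) \<le> \<tau> n * b n"
    "(\<lambda>n. L2_norm I (\<lambda>t. (1 / \<tau> n) *\<^sub>R (k n t - l t) - v t)) \<longlonglongrightarrow> 0"
proof -
  define z where "z = driving_force l q"
  let ?A = "kappa_history_deriv \<kappa> y0 q \<delta>"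
  let ?\<kappa> = "\<lambda>p t. componentwise \<kappa> (history y0 p t)"
  let ?y = "\<lambda>n s. (1 / \<epsilon>) *\<^sub>R positive_part (z s + \<tau> n *\<^sub>R w s)"
  note qc = stateD(1)[OF l q]
  have zL: "z \<in> L2 I" unfolding z_def by (rule driving_force_L2[OF l qc])
  have zn: "(\<lambda>s. z s + \<tau> n *\<^sub>R w s) \<in> L2 I" for n by (intro L2_intros zL w)
  define D where "D = rate_deriv l q w"
  have DL: "D \<in> L2 I" unfolding D_def by (rule rate_deriv_L2[OF l qc w])
  have Di: "integrable (LM T) D" by (rule L2_integrable[OF DL])
  have \<delta>D: "\<delta> = prim T D" by (simp add: \<delta> D_def)
  define e where "e n s = (1 / \<tau> n) *\<^sub>R (?y n s - (1 / \<epsilon>) *\<^sub>R positive_part (z s))" for n s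
  have yL: "(?y n) \<in> L2 I" for n
    by (rule L2_scaleR[OF L2_positive_part[OF zn]])
  have y0L: "(\<lambda>s. (1 / \<epsilon>) *\<^sub>R positive_part (z s)) \<in> L2 I"
    by (rule L2_scaleR[OF L2_positive_part[OF zL]])
  have eL: "e n \<in> L2 I" for n
    unfolding e_def by (rule L2_scaleR[OF L2_diff[OF yL y0L]])
  have ei: "integrable (LM T) (e n)" for n by (rule L2_integrable[OF eL])
  have e_eq: "e n s = (1 / \<epsilon>) *\<^sub>R ((1 / \<tau> n) *\<^sub>R (positive_part (z s + \<tau> n *\<^sub>R w s) - positive_part (z s)))" for n s
    by (simp add: e_def scaleR_diff_right mult.commute)
  have elim: "(\<lambda>n. e n s) \<longlonglongrightarrow> D s" for s
    unfolding e_eq D_def rate_deriv_def z_def[symmetric]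
    by (intro tendsto_scaleR tendsto_const positive_part_deriv_tendsto \<tau> pos)
  have eb: "norm (e n s) \<le> 1 / \<epsilon> * norm (w s)" for n s
  proof -
    have "norm (positive_part (z s + \<tau> n *\<^sub>R w s) - positive_part (z s)) \<le> \<tau> n * norm (w s)"
      using norm_positive_part_diff[of "z s + \<tau> n *\<^sub>R w s" "z s"] pos[of n] by simp
    then have "(1 / \<tau> n) * norm (positive_part (z s + \<tau> n *\<^sub>R w s) - positive_part (z s)) \<le> norm (w s)"
      using pos[of n] by (simp add: pos_divide_le_eq mult.commute)
    then have "1 / \<epsilon> * ((1 / \<tau> n) * norm (positive_part (z s + \<tau> n *\<^sub>R w s) - positive_part (z s))) \<le> 1 / \<epsilon> * norm (w s)"
      using \<epsilon> by (intro mult_left_mono) auto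
    then show ?thesis unfolding e_eq norm_scaleR using \<epsilon> pos[of n] by simp
  qed
  have wi: "integrable (LM T) (\<lambda>s. norm (w s))" by (intro integrable_norm L2_integrable w)
  define B where "B = 1 / \<epsilon> * (LINT s|LM T. norm (w s))"
  let ?B = "L * (T * B)"
  have primB: "norm (prim T f t) \<le> B" if f: "integrable (LM T) f" and le: "\<And>s. norm (f s) \<le> 1 / \<epsilon> * norm (w s)" for f :: "real \<Rightarrow> real ^ 'n" and t
  proof -
    have "norm (prim T f t) \<le> (LINT s|LM T. norm (f s))" by (rule norm_prim_le_integral[OF f])
    also have "\<dots> \<le> (LINT s|LM T. 1 / \<epsilon> * norm (w s))"
      using f wi le by (intro integral_mono) auto
    also have "\<dots> = B" by (simp add: B_def)
    finally show ?thesis .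
  qed
  define a where "a n = prim T (e n)" for n
  have aB: "norm (a n t) \<le> B" for n t unfolding a_def by (rule primB[OF ei eb])
  have \<delta>B: "norm (\<delta> t) \<le> B" for t
    unfolding \<delta>D by (rule primB[OF Di]) (simp only: D_def norm_rate_deriv)
  have B0: "0 \<le> B" using \<delta>B[of 0] norm_ge_zero order_trans by blast
  have ai: "integrable (LM T) (a n)" for n
    unfolding a_def by (rule L2_integrable[OF prim_L2[OF ei]])
  have \<delta>i: "integrable (LM T) \<delta>"
    unfolding \<delta>D by (rule L2_integrable[OF prim_L2[OF Di]])
  \<comment> \<open>The L1 distance of the rate quotient from its limit. It bounds the error of the
    state quotient uniformly in t, which the statement requires.\<close>
  define b where "b n = (LINT s|LM T. norm (e n s - D s))" for n
  have b0: "b \<longlonglongrightarrow> 0"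
  proof -
    have "(\<lambda>n. LINT s|LM T. norm (e n s - D s)) \<longlonglongrightarrow> (LINT s|LM T. 0)"
    proof (rule integral_dominated_convergence[where w = "\<lambda>s. 2 * (1 / \<epsilon> * norm (w s))"])
      show "integrable (LM T) (\<lambda>s. 2 * (1 / \<epsilon> * norm (w s)))" using wi by simp
      show "(\<lambda>s. norm (e n s - D s)) \<in> borel_measurable (LM T)" for n
        using ei[of n] Di by simp
      show "AE s in LM T. (\<lambda>n. norm (e n s - D s)) \<longlonglongrightarrow> 0"
        by (intro AE_I2 tendsto_norm_zero LIM_zero elim)
      show "AE s in LM T. norm (norm (e n s - D s)) \<le> 2 * (1 / \<epsilon> * norm (w s))" for n
      proof (rule AE_I2)
        fix s
        have "norm (e n s - D s) \<le> norm (e n s) + norm (D s)" by (rule norm_triangle_ineq4)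
        moreover have "norm (D s) \<le> 1 / \<epsilon> * norm (w s)" by (simp only: D_def norm_rate_deriv)
        ultimately show "norm (norm (e n s - D s)) \<le> 2 * (1 / \<epsilon> * norm (w s))"
          using eb[of n s] by simp
      qed
    qed simp
    then show ?thesis by (simp add: b_def[abs_def])
  qed
  have a\<delta>: "norm (a n t - \<delta> t) \<le> b n" for n t
    unfolding a_def \<delta>D b_def prim_diff[OF ei Di, symmetric]
    by (rule norm_prim_le_integral) (simp add: ei Di)
  define p where "p n = prim T (?y n)" for n
  have pc: "continuous_on {0..T} (p n)" for n
    unfolding p_def by (rule continuous_on_prim[OF L2_integrable[OF yL]])
  have pq: "p n t = q t + \<tau> n *\<^sub>R a n t" if t: "t \<in> {0..T}" for n t
  proof -
    have "p n t - q t = prim T (\<lambda>s. ?y n s - (1 / \<epsilon>) *\<^sub>R positive_part (z s)) t"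
      unfolding p_def stateD(3)[OF l q t] z_def[symmetric]
      by (rule prim_diff[OF L2_integrable[OF yL] L2_integrable[OF y0L], symmetric])
    also have "\<dots> = prim T (\<lambda>s. \<tau> n *\<^sub>R e n s) t"
      using pos[of n] by (intro prim_cong) (simp add: e_def)
    also have "\<dots> = \<tau> n *\<^sub>R a n t" by (simp only: prim_scaleR a_def)
    finally show ?thesis by (simp add: algebra_simps)
  qed
  have p\<delta>: "norm (p n t - q t - \<tau> n *\<^sub>R \<delta> t) \<le> \<tau> n * b n" if "t \<in> {0..T}" for n t
  proof -
    have "p n t - q t - \<tau> n *\<^sub>R \<delta> t = \<tau> n *\<^sub>R (a n t - \<delta> t)"
      by (simp add: pq[OF that] scaleR_diff_right)
    then show ?thesis using a\<delta>[of n t] pos[of n] by simp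
  qed
  have hp: "history y0 (p n) t = history y0 q t + \<tau> n *\<^sub>R prim T (a n) t" if t: "t \<in> {0..T}" for n t
  proof -
    have qi: "integrable (LM T) q" by (rule L2_integrable[OF continuous_on_L2[OF qc]])
    have ai': "integrable (LM T) (\<lambda>s. \<tau> n *\<^sub>R a n s)" using ai by simp
    have "prim T (p n) t = prim T (\<lambda>s. q s + \<tau> n *\<^sub>R a n s) t"
      by (rule prim_cong) (simp add: pq)
    also have "\<dots> = prim T q t + \<tau> n *\<^sub>R prim T (a n) t"
      by (simp only: prim_add[OF qi ai'] prim_scaleR)
    finally show ?thesis by (simp add: history_eq[OF t])
  qed
  \<comment> \<open>The definition of the driving force solved for the load, the state
    \<open>p n\<close> being already known.\<close>
  define k where "k n t = z t + \<tau> n *\<^sub>R w t + \<alpha> *\<^sub>R p n t + ?\<kappa> (p n) t" for n t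
  have kL: "k n \<in> L2 I" for n
    unfolding k_def
    by (intro L2_add zL L2_scaleR w continuous_on_L2 pc continuous_componentwise_\<kappa> continuous_history)
  have st: "state (k n) (p n)" for n
  proof (rule stateI[OF zn])
    show "p n t = prim T (?y n) t" for t by (simp add: p_def)
    show "driving_force (k n) (p n) t = z t + \<tau> n *\<^sub>R w t" for t by (simp add: driving_force_def k_def)
  qed
  define Q where "Q n t = (1 / \<tau> n) *\<^sub>R (?\<kappa> (p n) t - ?\<kappa> q t)" for n t
  have Qlim: "(\<lambda>n. Q n t) \<longlonglongrightarrow> ?A t" if t: "t \<in> {0..T}" for t
  proof (rule vec_tendstoI)
    fix i
    have "(\<lambda>n. prim T (a n) t) \<longlonglongrightarrow> prim T \<delta> t"
    proof (rule LIMSEQ_bounded_by_null)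
      show "norm (prim T (a n) t - prim T \<delta> t) \<le> T * b n" for n
        unfolding prim_diff[OF ai \<delta>i, symmetric]
        by (rule norm_prim_le_const[OF T0]) (simp_all add: ai \<delta>i a\<delta>)
      show "(\<lambda>n. T * b n) \<longlonglongrightarrow> 0" by (rule tendsto_mult_right_zero[OF b0])
    qed
    then have "(\<lambda>n. prim T (a n) t $ i) \<longlonglongrightarrow> prim T \<delta> t $ i" by (rule tendsto_vec_nth)
    from Lipschitz_difference_quotient_tendsto[OF \<kappa>_Lipschitz \<kappa>_differentiable \<tau> pos this, of "history y0 q t $ i"]
    show "(\<lambda>n. Q n t $ i) \<longlonglongrightarrow> ?A t $ i"
      by (simp add: Q_def componentwise_def hp[OF t] kappa_history_deriv_eq[OF t])
  qed
  have QB: "norm (Q n t) \<le> ?B" if t: "t \<in> {0..T}" for n t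
  proof -
    have "norm (?\<kappa> (p n) t - ?\<kappa> q t)
        \<le> L * norm (\<tau> n *\<^sub>R prim T (a n) t)"
      using norm_componentwise_diff[of "history y0 (p n) t" "history y0 q t"] by (simp add: hp[OF t])
    also have "\<dots> = \<tau> n * (L * norm (prim T (a n) t))" using pos[of n] by simp
    also have "\<dots> \<le> \<tau> n * ?B"
      using pos[of n] L0 by (intro mult_left_mono norm_prim_le_const[OF T0 ai aB]) auto
    finally show ?thesis using pos[of n] by (simp add: Q_def pos_divide_le_eq mult.commute)
  qed
  have \<kappa>B: "norm (?A t) \<le> ?B" if t: "t \<in> {0..T}" for t
    by (rule order_trans[OF norm_kappa_history_deriv_le[OF t]])
      (intro mult_left_mono norm_prim_le_const[OF T0 \<delta>i \<delta>B] L0)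
  define r where "r n t = (1 / \<tau> n) *\<^sub>R (k n t - l t) - v t" for n t
  \<comment> \<open>The direction w cancels exactly because it was prescribed in the driving force.
    Only the error of the state quotient and that of the quotient of \<kappa> along the history are
    left.\<close>
  have req: "r n t = \<alpha> *\<^sub>R (a n t - \<delta> t) + (Q n t - ?A t)" if t: "t \<in> {0..T}" for n t
  proof -
    have "l t = z t + \<alpha> *\<^sub>R q t + ?\<kappa> q t"
      by (simp add: z_def driving_force_def)
    then have "k n t - l t = \<tau> n *\<^sub>R (w t + \<alpha> *\<^sub>R a n t)
        + (?\<kappa> (p n) t - ?\<kappa> q t)"
      by (simp add: k_def pq[OF t] algebra_simps)
    then have "(1 / \<tau> n) *\<^sub>R (k n t - l t) = w t + \<alpha> *\<^sub>R a n t + Q n t"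
      using pos[of n] by (simp add: Q_def scaleR_add_right)
    then show ?thesis by (simp add: r_def v algebra_simps)
  qed
  have rL: "r n \<in> L2 I" for n
    unfolding r_def v
    by (intro L2_diff L2_add L2_scaleR kL l w kappa_history_deriv_L2 qc \<delta>i)
      (simp add: \<delta>D prim_L2 Di)
  \<comment> \<open>The quotients \<open>Q n\<close> are shown to converge only pointwise in t, so
    L2 convergence comes from dominated convergence. The constant majorant collects the bounds
    \<open>B\<close> for \<open>a\<close> and \<delta> and L * (T * B) for the \<kappa>
    terms.\<close>
  have "(\<lambda>n. L2_inner I (r n) (r n)) \<longlonglongrightarrow> (LINT t|LM T. 0)"
    unfolding L2_inner_self
  proof (rule integral_dominated_convergence[where w = "\<lambda>_. (\<alpha> * (2 * B) + 2 * ?B)\<^sup>2"])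
    show "integrable (LM T) (\<lambda>_. (\<alpha> * (2 * B) + 2 * ?B)\<^sup>2)"
      by (rule finite_measure.integrable_const[OF finite_measure_LM])
    show "(\<lambda>t. (norm (r n t))\<^sup>2) \<in> borel_measurable (LM T)" for n
      using L2_norm_sq_integrable[OF rL] by (rule borel_measurable_integrable)
    show "AE t in LM T. (\<lambda>n. (norm (r n t))\<^sup>2) \<longlonglongrightarrow> 0"
    proof (rule AE_I2)
      fix t assume "t \<in> space (LM T)"
      then have t: "t \<in> {0..T}" by simp
      have al: "(\<lambda>n. a n t) \<longlonglongrightarrow> \<delta> t" by (rule LIMSEQ_bounded_by_null[OF a\<delta> b0])
      have "(\<lambda>n. norm (\<alpha> *\<^sub>R (a n t - \<delta> t) + (Q n t - ?A t)))
          \<longlonglongrightarrow> norm (\<alpha> *\<^sub>R (\<delta> t - \<delta> t) + (?A t - ?A t))"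
        by (intro tendsto_norm tendsto_add tendsto_scaleR tendsto_const tendsto_diff al Qlim t)
      then have "(\<lambda>n. norm (r n t)) \<longlonglongrightarrow> 0" by (simp add: req[OF t])
      from tendsto_power[OF this, of 2] show "(\<lambda>n. (norm (r n t))\<^sup>2) \<longlonglongrightarrow> 0" by simp
    qed
    show "AE t in LM T. norm ((norm (r n t))\<^sup>2) \<le> (\<alpha> * (2 * B) + 2 * ?B)\<^sup>2" for n
    proof (rule AE_I2)
      fix t assume "t \<in> space (LM T)"
      then have t: "t \<in> {0..T}" by simp
      have "norm (r n t) \<le> norm (\<alpha> *\<^sub>R (a n t - \<delta> t)) + norm (Q n t - ?A t)"
        unfolding req[OF t] by (rule norm_triangle_ineq)
      also have "\<dots> \<le> \<alpha> * (2 * B) + 2 * ?B"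
      proof (rule add_mono)
        have "norm (a n t - \<delta> t) \<le> 2 * B"
          using norm_triangle_ineq4[of "a n t" "\<delta> t"] aB[of n t] \<delta>B[of t] by linarith
        then show "norm (\<alpha> *\<^sub>R (a n t - \<delta> t)) \<le> \<alpha> * (2 * B)" using \<alpha> by simp
        show "norm (Q n t - ?A t) \<le> 2 * ?B"
          using norm_triangle_ineq4[of "Q n t" "?A t"] QB[OF t, of n] \<kappa>B[OF t] by linarith
      qed
      finally show "norm ((norm (r n t))\<^sup>2) \<le> (\<alpha> * (2 * B) + 2 * ?B)\<^sup>2"
        by (simp add: power_mono)
    qed
  qed simp
  then have "(\<lambda>n. L2_norm I (r n)) \<longlonglongrightarrow> sqrt 0"
    unfolding L2_norm_def by (intro tendsto_real_sqrt) simp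
  then have kv: "(\<lambda>n. L2_norm I (\<lambda>t. (1 / \<tau> n) *\<^sub>R (k n t - l t) - v t)) \<longlonglongrightarrow> 0"
    by (simp add: r_def[abs_def])
  show ?thesis by (rule that[OF kL st b0 p\<delta> kv])
qed

end

section \<open>The optimal control problem\<close>

locale optimal_control = viscous_evolution T \<alpha> \<epsilon> L \<kappa> y0
  for T \<alpha> \<epsilon> L :: real and \<kappa> :: "real \<Rightarrow> real" and y0 :: "real ^ 'n" +
  fixes j :: "(real \<Rightarrow> real ^ 'n) \<Rightarrow> real"
    and dj :: "(real \<Rightarrow> real ^ 'n) \<Rightarrow> real \<Rightarrow> real ^ 'n"
    and qd :: "real ^ 'n"
    and S :: "(real \<Rightarrow> real ^ 'n) \<Rightarrow> real \<Rightarrow> real ^ 'n"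
    and l_bar l :: "real \<Rightarrow> real ^ 'n"
  assumes j: "L2_continuously_differentiable {0<..<T} j dj"
    and S: "is_solution_operator T \<alpha> y0 (dissipation_eps \<kappa> \<epsilon>) (L2 {0<..<T}) S"
    and l_bar: "l_bar \<in> H10 T"
    and optimal: "locally_optimal T (objective_eps T j qd S l_bar) l"
begin

abbreviation q :: "real \<Rightarrow> real ^ 'n" where
  "q \<equiv> S l"

abbreviation A :: "(real \<Rightarrow> real ^ 'n) \<Rightarrow> real \<Rightarrow> real ^ 'n" where
  "A \<equiv> kappa_history_deriv \<kappa> y0 q"

lemma l_H10: "l \<in> H10 T"
  using optimal by (simp add: locally_optimal_def)

lemma l_L2: "l \<in> L2 I"
  by (rule H10_L2[OF l_H10])

lemma S_state: "k \<in> L2 I \<Longrightarrow> state k (S k)"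
  using S by (simp add: is_solution_operator_def)

lemma S_continuous: "k \<in> L2 I \<Longrightarrow> continuous_on {0..T} (S k)"
  by (rule stateD(1)[OF _ S_state])

lemmas q_continuous = S_continuous[OF l_L2]

lemma q_L2: "q \<in> L2 I"
  by (rule continuous_on_L2[OF q_continuous])

lemma dj_L2: "dj q \<in> L2 I"
  using j q_L2 by (simp add: L2_continuously_differentiable_def)

section \<open>The cost as a function of the state\<close>

definition state_cost :: "(real \<Rightarrow> real ^ 'n) \<Rightarrow> real" where
  "state_cost p = j p + 1 / 2 * (norm (p T - qd))\<^sup>2"

definition state_cost_deriv :: "(real \<Rightarrow> real ^ 'n) \<Rightarrow> real" where
  "state_cost_deriv p = L2_inner I (dj q) p + (q T - qd) \<bullet> p T"

definition load_cost_deriv :: "(real \<Rightarrow> real ^ 'n) \<Rightarrow> real" where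
  "load_cost_deriv v = H1_inner T l v + H1_inner T (\<lambda>t. l t - l_bar t) v"

lemma state_cost_deriv_add_scaleR:
  assumes "f \<in> L2 I" "g \<in> L2 I"
  shows "state_cost_deriv (\<lambda>t. f t + c *\<^sub>R g t) = state_cost_deriv f + c * state_cost_deriv g"
  using assms dj_L2
  by (simp add: state_cost_deriv_def L2_inner_simps L2_scaleR inner_add_right algebra_simps)

text \<open>A bound for the functional \<open>state_cost_deriv\<close> with respect to the supremum
  norm on [0, T].\<close>

definition cost_const :: real where
  "cost_const = L2_norm I (dj q) * sqrt T + norm (q T - qd)"

lemma cost_const_nonneg: "0 \<le> cost_const"
  using T by (simp add: cost_const_def L2_norm_nonneg)

lemma abs_state_cost_deriv_le:
  assumes f: "continuous_on {0..T} f" and le: "\<And>t. t \<in> {0..T} \<Longrightarrow> norm (f t) \<le> c"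
  shows "\<bar>state_cost_deriv f\<bar> \<le> cost_const * c"
proof -
  have fL: "f \<in> L2 I" by (rule continuous_on_L2[OF f])
  have "\<bar>L2_inner I (dj q) f\<bar> \<le> L2_norm I (dj q) * L2_norm I f"
    by (rule L2_Cauchy_Schwarz[OF dj_L2 fL])
  also have "\<dots> \<le> L2_norm I (dj q) * (sqrt T * c)"
    by (intro mult_left_mono L2_norm_le_sup T0 fL le L2_norm_nonneg)
  finally have 1: "\<bar>L2_inner I (dj q) f\<bar> \<le> L2_norm I (dj q) * (sqrt T * c)" .
  have "\<bar>(q T - qd) \<bullet> f T\<bar> \<le> norm (q T - qd) * norm (f T)" by (rule Cauchy_Schwarz_ineq2)
  also have "\<dots> \<le> norm (q T - qd) * c" using le[of T] T by (intro mult_left_mono) auto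
  finally have 2: "\<bar>(q T - qd) \<bullet> f T\<bar> \<le> norm (q T - qd) * c" .
  have "\<bar>state_cost_deriv f\<bar> \<le> \<bar>L2_inner I (dj q) f\<bar> + \<bar>(q T - qd) \<bullet> f T\<bar>"
    unfolding state_cost_deriv_def by (rule abs_triangle_ineq)
  also have "\<dots> \<le> cost_const * c" using add_mono[OF 1 2] by (simp add: cost_const_def algebra_simps)
  finally show ?thesis .
qed

text \<open>Only the upper half of the expansion is stated, since it will be inserted into the lower
  bound supplied by optimality. Uniform closeness of the states controls both the L2 norm in j and
  the value at T.\<close>

lemma state_cost_differentiable:
  assumes e: "0 < e" and p: "\<And>n. continuous_on {0..T} (p n)"
    and le: "\<And>n t. t \<in> {0..T} \<Longrightarrow> norm (p n t - q t) \<le> c n" and c: "c \<longlonglongrightarrow> 0"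
  shows "\<forall>\<^sub>F n in sequentially.
    state_cost (p n) - state_cost q - state_cost_deriv (\<lambda>t. p n t - q t) \<le> e * c n"
proof -
  \<comment> \<open>The factor sqrt(T) passes from the L2 to the supremum norm. With this choice j
    contributes e/2 * c n, and the quadratic end term contributes the other half once c n <
    e.\<close>
  define e' where "e' = e / (2 * sqrt T)"
  have e': "0 < e'" using e T by (simp add: e'_def)
  have "\<forall>e>0. \<exists>d>0. \<forall>v\<in>L2 I. L2_norm I v < d \<longrightarrow>
      \<bar>j (\<lambda>t. q t + v t) - j q - L2_inner I (dj q) v\<bar> \<le> e * L2_norm I v"
    using j q_L2 unfolding L2_continuously_differentiable_def by fast
  from this[rule_format, OF e'] obtain d where d: "0 < d"
    and jd: "\<And>v. v \<in> L2 I \<Longrightarrow> L2_norm I v < d \<Longrightarrow>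
      \<bar>j (\<lambda>t. q t + v t) - j q - L2_inner I (dj q) v\<bar> \<le> e' * L2_norm I v"
    by blast
  show ?thesis
    using order_tendstoD(2)[OF c e] order_tendstoD(2)[OF tendsto_mult_right_zero[OF c] d, of "sqrt T"]
  proof eventually_elim
    case (elim n)
    let ?v = "\<lambda>t. p n t - q t"
    have c0: "0 \<le> c n" by (rule order_trans[OF norm_ge_zero le[of 0]]) (use T in simp)
    have vL: "?v \<in> L2 I" by (intro L2_diff q_L2 continuous_on_L2 p)
    have vn: "L2_norm I ?v \<le> sqrt T * c n" by (rule L2_norm_le_sup[OF T0 vL le])
    also note elim(2)
    finally have "\<bar>j (\<lambda>t. q t + ?v t) - j q - L2_inner I (dj q) ?v\<bar> \<le> e' * L2_norm I ?v"
      by (rule jd[OF vL])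
    also have "\<dots> \<le> e' * (sqrt T * c n)" using vn e' by (intro mult_left_mono) auto
    also have "\<dots> = e / 2 * c n" using T by (simp add: e'_def)
    finally have 1: "\<bar>j (p n) - j q - L2_inner I (dj q) ?v\<bar> \<le> e / 2 * c n" by simp
    have 2: "(norm (p n T - qd))\<^sup>2
        = (norm (q T - qd))\<^sup>2 + 2 * ((q T - qd) \<bullet> (p n T - q T)) + (norm (p n T - q T))\<^sup>2"
      by (simp add: power2_norm_eq_inner inner_diff_left inner_diff_right inner_commute)
    have "(norm (p n T - q T))\<^sup>2 \<le> c n * c n"
      unfolding power2_eq_square using le[of T] T c0 by (intro mult_mono) auto
    also have "\<dots> \<le> e * c n" using elim(1) c0 by (intro mult_right_mono) auto
    finally have 3: "(norm (p n T - q T))\<^sup>2 \<le> e * c n" .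
    have "state_cost (p n) - state_cost q - state_cost_deriv ?v
        = (j (p n) - j q - L2_inner I (dj q) ?v) + (norm (p n T - q T))\<^sup>2 / 2"
      unfolding state_cost_def state_cost_deriv_def 2 by (simp add: field_simps)
    then show ?case using 1 3 unfolding abs_le_iff by linarith
  qed
qed

section \<open>First-order conditions at the local optimum\<close>

lemma perturbed_load_L2: "v \<in> H10 T \<Longrightarrow> (\<lambda>t. l t + \<tau> *\<^sub>R v t) \<in> L2 I"
  by (intro L2_add L2_scaleR l_L2 H10_L2)

lemma perturbed_state_Lipschitz:
  assumes v: "v \<in> H10 T" and \<tau>: "0 < \<tau>" and t: "t \<in> {0..T}"
  shows "norm (S (\<lambda>t. l t + \<tau> *\<^sub>R v t) t - q t) \<le> \<tau> * (Lipschitz_const * L2_norm I v)"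
  using state_Lipschitz[OF perturbed_load_L2[OF v] l_L2 S_state[OF perturbed_load_L2[OF v]] S_state[OF l_L2] t, of \<tau>]
    L2_norm_scaleR[of I \<tau> v] \<tau>
  by (simp add: mult_ac)

text \<open>For a fixed v the loads l + \<tau> v eventually enter the H1 ball of optimality. The two
  H1 terms expand exactly, and each leaves half of the quadratic remainder.\<close>

lemma local_optimality:
  assumes v: "v \<in> H10 T" and \<tau>: "\<tau> \<longlonglongrightarrow> 0"
  shows "\<forall>\<^sub>F n in sequentially. 0 \<le> state_cost (S (\<lambda>t. l t + \<tau> n *\<^sub>R v t)) - state_cost q
    + \<tau> n * load_cost_deriv v + (\<tau> n)\<^sup>2 * (H1_norm T v)\<^sup>2"
proof -
  obtain r where r: "0 < r" and opt: "\<And>k. k \<in> H10 T \<Longrightarrow> H1_norm T (\<lambda>t. k t - l t) < r \<Longrightarrow>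
      objective_eps T j qd S l_bar l \<le> objective_eps T j qd S l_bar k"
    using optimal unfolding locally_optimal_def by blast
  have lH: "l \<in> H1 T" and lbH: "(\<lambda>t. l t - l_bar t) \<in> H1 T" and vH: "v \<in> H1 T"
    using l_H10 l_bar v by (auto simp: H10_def H1_diff)
  have arith: "0 \<le> e + f - (a + b) + x * (g + h) + k"
    if "a + b + 1 / 2 * c + 1 / 2 * d \<le> e + f + 1 / 2 * (c + 2 * x * g + k) + 1 / 2 * (d + 2 * x * h + k)"
    for a b c d e f g h k x :: real
    using that by (simp add: field_simps)
  show ?thesis
    using order_tendstoD(2)[OF tendsto_mult_left_zero[OF tendsto_rabs_zero[OF \<tau>]] r, of "H1_norm T v"]
  proof eventually_elim
    case (elim n)
    let ?k = "\<lambda>t. l t + \<tau> n *\<^sub>R v t"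
    have "objective_eps T j qd S l_bar l \<le> objective_eps T j qd S l_bar ?k"
    proof (rule opt)
      show "?k \<in> H10 T" by (intro H10_add H10_scaleR l_H10 v)
      show "H1_norm T (\<lambda>t. ?k t - l t) < r" using H1_norm_scaleR[OF T0 vH, of "\<tau> n"] elim by simp
    qed
    moreover have eq: "(\<lambda>t. ?k t - l_bar t) = (\<lambda>t. (l t - l_bar t) + \<tau> n *\<^sub>R v t)"
      by (rule ext) simp
    ultimately show ?case
      unfolding objective_eps_def state_cost_def load_cost_deriv_def eq
        H1_norm_add_scaleR[OF T0 lH vH, of "\<tau> n"] H1_norm_add_scaleR[OF T0 lbH vH, of "\<tau> n"]
      by (intro arith)
  qed
qed

text \<open>The increment of the state is deliberately not expanded: for a general v in
  \<open>H10\<close> only its Lipschitz bound is at hand. It is later compared with the explicit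
  perturbation of \<open>perturbation\<close>.\<close>

lemma first_order_condition:
  assumes v: "v \<in> H10 T" and \<tau>: "\<tau> \<longlonglongrightarrow> 0" and pos: "\<And>n. 0 < \<tau> n" and e: "0 < e"
  shows "\<forall>\<^sub>F n in sequentially.
    0 \<le> state_cost_deriv (\<lambda>t. S (\<lambda>t. l t + \<tau> n *\<^sub>R v t) t - q t) + \<tau> n * (load_cost_deriv v + e)"
proof -
  let ?P = "\<lambda>n. S (\<lambda>t. l t + \<tau> n *\<^sub>R v t)"
  define N where "N = Lipschitz_const * L2_norm I v"
  have N: "0 \<le> N" by (simp add: N_def Lipschitz_const_nonneg L2_norm_nonneg)
  \<comment> \<open>One half of e pays for the remainder of the state cost, the other for the
    quadratic H1 term; N + 1 avoids a division by 0.\<close>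
  define e' where "e' = e / (2 * (N + 1))"
  have e': "0 < e'" "e' * N \<le> e / 2" using e N by (auto simp: e'_def field_simps add_pos_nonneg)
  have "\<forall>\<^sub>F n in sequentially.
      state_cost (?P n) - state_cost q - state_cost_deriv (\<lambda>t. ?P n t - q t) \<le> e' * (\<tau> n * N)"
    unfolding N_def
    by (intro state_cost_differentiable e' S_continuous perturbed_load_L2 v perturbed_state_Lipschitz pos
        tendsto_mult_left_zero \<tau>)
  moreover have "\<forall>\<^sub>F n in sequentially. \<tau> n * (H1_norm T v)\<^sup>2 < e / 2"
    using order_tendstoD(2)[OF tendsto_mult_left_zero[OF \<tau>], of "e / 2"] e by simp
  ultimately show ?thesis using local_optimality[OF v \<tau>]
  proof eventually_elim
    case (elim n)
    have "e' * (\<tau> n * N) \<le> \<tau> n * (e / 2)"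
      using mult_left_mono[OF e'(2), of "\<tau> n"] pos[of n] by (simp add: mult_ac)
    moreover have "(\<tau> n)\<^sup>2 * (H1_norm T v)\<^sup>2 \<le> \<tau> n * (e / 2)"
      using mult_left_mono[OF less_imp_le[OF elim(2)], of "\<tau> n"] pos[of n]
      by (simp add: power2_eq_square mult.assoc)
    moreover have "\<tau> n * (load_cost_deriv v + e) = \<tau> n * load_cost_deriv v + \<tau> n * (e / 2) + \<tau> n * (e / 2)"
      by (simp add: distrib_left)
    ultimately show ?case using elim(1,3) by linarith
  qed
qed

text \<open>By optimality a decrease of the load cost must be paid for by the state cost, which
  changes by at most \<tau> times the L2 norm of v; dividing by \<tau> gives the bound. It is
  one-sided, as \<open>L2_Riesz\<close> asks.\<close>

lemma load_cost_deriv_bound: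
  assumes v: "v \<in> H10 T"
  shows "- load_cost_deriv v \<le> cost_const * Lipschitz_const * L2_norm I v"
proof (rule field_le_epsilon)
  fix e :: real assume e: "0 < e"
  let ?\<tau> = "\<lambda>n. inverse (real (Suc n))"
  have "\<forall>\<^sub>F n in sequentially.
      0 \<le> state_cost_deriv (\<lambda>t. S (\<lambda>t. l t + ?\<tau> n *\<^sub>R v t) t - q t) + ?\<tau> n * (load_cost_deriv v + e)"
    by (rule first_order_condition[OF v LIMSEQ_inverse_real_of_nat _ e]) simp
  then obtain n where n: "0 \<le> state_cost_deriv (\<lambda>t. S (\<lambda>t. l t + ?\<tau> n *\<^sub>R v t) t - q t) + ?\<tau> n * (load_cost_deriv v + e)"
    by (auto dest: eventually_happens)
  have "\<bar>state_cost_deriv (\<lambda>t. S (\<lambda>t. l t + ?\<tau> n *\<^sub>R v t) t - q t)\<bar>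
      \<le> cost_const * (?\<tau> n * (Lipschitz_const * L2_norm I v))"
    by (intro abs_state_cost_deriv_le continuous_on_diff S_continuous perturbed_load_L2 v q_continuous
        perturbed_state_Lipschitz) simp_all
  with n have "0 \<le> ?\<tau> n * (cost_const * Lipschitz_const * L2_norm I v + load_cost_deriv v + e)"
    unfolding abs_le_iff distrib_left by (simp only: mult_ac) linarith
  then show "- load_cost_deriv v \<le> cost_const * Lipschitz_const * L2_norm I v + e"
    by (simp add: zero_le_mult_iff)
qed

lemma load_cost_deriv_add_scaleR:
  assumes "u \<in> H10 T" "v \<in> H10 T"
  shows "load_cost_deriv (\<lambda>t. u t + v t) = load_cost_deriv u + load_cost_deriv v"
    and "load_cost_deriv (\<lambda>t. c *\<^sub>R v t) = c * load_cost_deriv v"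
  using assms l_H10 l_bar
  by (simp_all add: load_cost_deriv_def H1_inner_add_right H1_inner_scaleR_right T0 H10_H1 H1_diff algebra_simps)

lemma multiplier_exists:
  obtains lam where "lam \<in> L2 I" "\<And>v. v \<in> H10 T \<Longrightarrow> - load_cost_deriv v = L2_inner I lam v"
proof -
  show ?thesis
  proof (rule L2_Riesz[of "H10 T" I "\<lambda>v. - load_cost_deriv v" "cost_const * Lipschitz_const"])
    fix u v assume "u \<in> L2 I" "\<And>w. w \<in> H10 T \<Longrightarrow> - load_cost_deriv w = L2_inner I u w"
    then show ?thesis by (rule that)
  qed (auto simp: H10_L2 H10_zero H10_add H10_scaleR load_cost_deriv_add_scaleR intro: load_cost_deriv_bound)
qed

text \<open>The load quotient v of the explicit perturbation is only in L2, so optimality is tested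
  with some u in \<open>H10\<close> close to v. The loads l + \<tau> u and \<open>k n\<close> then
  differ by O(\<tau> e) in L2, hence so do their states, and the second state is q + \<tau> \<delta>
  up to o(\<tau>). Dividing the first-order condition by \<tau> leaves an error proportional to
  e.\<close>

lemma variational_inequality:
  assumes lam: "lam \<in> L2 I" and rep: "\<And>v. v \<in> H10 T \<Longrightarrow> - load_cost_deriv v = L2_inner I lam v"
    and w: "w \<in> L2 I"
    and \<delta>: "\<delta> = prim T (rate_deriv l q w)"
    and v: "v = (\<lambda>t. w t + \<alpha> *\<^sub>R \<delta> t + A \<delta> t)"
  shows "0 \<le> state_cost_deriv \<delta> - L2_inner I lam v"
proof -
  note qs = S_state[OF l_L2]
  define \<tau> where "\<tau> n = inverse (real (Suc n))" for n
  have \<tau>: "\<tau> \<longlonglongrightarrow> 0" unfolding \<tau>_def by (rule LIMSEQ_inverse_real_of_nat)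
  have pos: "0 < \<tau> n" for n by (simp add: \<tau>_def)
  obtain k p b where kL: "\<And>n. k n \<in> L2 I" and st: "\<And>n. state (k n) (p n)" and b: "b \<longlonglongrightarrow> 0"
    and p\<delta>: "\<And>n t. t \<in> {0..T} \<Longrightarrow> norm (p n t - q t - \<tau> n *\<^sub>R \<delta> t) \<le> \<tau> n * b n"
    and kv: "(\<lambda>n. L2_norm I (\<lambda>t. (1 / \<tau> n) *\<^sub>R (k n t - l t) - v t)) \<longlonglongrightarrow> 0"
    using perturbation[OF l_L2 qs w \<tau> pos \<delta> v] by blast
  have Di: "integrable (LM T) (rate_deriv l q w)"
    by (rule L2_integrable[OF rate_deriv_L2[OF l_L2 q_continuous w]])
  have \<delta>c: "continuous_on {0..T} \<delta>" unfolding \<delta> by (rule continuous_on_prim[OF Di])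
  have \<delta>L: "\<delta> \<in> L2 I" by (rule continuous_on_L2[OF \<delta>c])
  have vL: "v \<in> L2 I"
    unfolding v by (intro L2_add L2_scaleR w \<delta>L kappa_history_deriv_L2 q_continuous L2_integrable)
  define c where "c n = L2_norm I (\<lambda>t. (1 / \<tau> n) *\<^sub>R (k n t - l t) - v t)" for n
  have c0: "c \<longlonglongrightarrow> 0" using kv by (simp add: c_def[abs_def])
  define X where "X = state_cost_deriv \<delta> - L2_inner I lam v"
  \<comment> \<open>All errors of size e: 2 * \<open>Lipschitz_const\<close> for the two load
    deviations (u against v, the quotient of \<open>k n\<close> against v), 1 for the state error
    \<open>b n\<close>, 1 for the slack in the first-order condition, and
    \<open>L2_norm I lam\<close> for u against v under lam.\<close>
  define C where "C = cost_const * (Lipschitz_const * 2 + 1) + 1 + L2_norm I lam"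
  have "0 \<le> cost_const * (Lipschitz_const * 2 + 1)"
    by (simp add: cost_const_nonneg Lipschitz_const_nonneg)
  then have C: "0 < C" using L2_norm_nonneg[of I lam] unfolding C_def by linarith
  have approx: "0 \<le> X + e * C" if e: "0 < e" for e
  proof -
    obtain u where u: "u \<in> H10 T" and uv: "L2_norm I (\<lambda>t. u t - v t) < e"
      by (rule H10_dense[OF T vL e])
    note uL = H10_L2[OF u]
    have "\<forall>\<^sub>F n in sequentially. c n < e \<and> b n < e \<and>
        0 \<le> state_cost_deriv (\<lambda>t. S (\<lambda>t. l t + \<tau> n *\<^sub>R u t) t - q t) + \<tau> n * (load_cost_deriv u + e)"
      by (intro eventually_conj order_tendstoD(2)[OF c0 e] order_tendstoD(2)[OF b e] first_order_condition u \<tau> pos e)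
    \<comment> \<open>The order of choices matters: the H1 norm of u is not controlled as e tends to
      0, so the step \<tau> n has to be chosen after u.\<close>
    then obtain n where n: "c n < e" "b n < e"
        "0 \<le> state_cost_deriv (\<lambda>t. S (\<lambda>t. l t + \<tau> n *\<^sub>R u t) t - q t) + \<tau> n * (load_cost_deriv u + e)"
      by (auto dest: eventually_happens)
    let ?P = "S (\<lambda>t. l t + \<tau> n *\<^sub>R u t)"
    note PL = perturbed_load_L2[OF u, of "\<tau> n"]
    have Pc: "continuous_on {0..T} ?P" by (rule S_continuous[OF PL])
    have Pp: "norm (?P t - p n t) \<le> \<tau> n * (Lipschitz_const * (e + e))" if t: "t \<in> {0..T}" for t
    proof -
      let ?f = "\<lambda>t. u t - v t" and ?g = "\<lambda>t. (1 / \<tau> n) *\<^sub>R (k n t - l t) - v t"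
      have gL: "?g \<in> L2 I" by (intro L2_diff L2_scaleR kL l_L2 vL)
      have eq: "(\<lambda>s. l s + \<tau> n *\<^sub>R u s - k n s) = (\<lambda>s. \<tau> n *\<^sub>R (?f s - ?g s))"
        using pos[of n] by (simp add: fun_eq_iff scaleR_diff_right scaleR_add_right)
      have "norm (?P t - p n t) \<le> Lipschitz_const * L2_norm I (\<lambda>s. l s + \<tau> n *\<^sub>R u s - k n s)"
        by (rule state_Lipschitz[OF PL kL S_state[OF PL] st t])
      also have "\<dots> = Lipschitz_const * (\<tau> n * L2_norm I (\<lambda>s. ?f s - ?g s))"
        unfolding eq L2_norm_scaleR using pos[of n] by simp
      also have "\<dots> \<le> Lipschitz_const * (\<tau> n * (e + e))"
        using L2_norm_triangle_diff[OF L2_diff[OF uL vL] gL] uv n(1) Lipschitz_const_nonneg pos[of n]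
        by (intro mult_left_mono) (auto simp: c_def)
      finally show ?thesis by (simp only: mult_ac)
    qed
    let ?R = "\<lambda>t. ?P t - q t - \<tau> n *\<^sub>R \<delta> t"
    have R: "norm (?R t) \<le> \<tau> n * (Lipschitz_const * (e + e) + e)" if t: "t \<in> {0..T}" for t
    proof -
      have "?R t = (?P t - p n t) + (p n t - q t - \<tau> n *\<^sub>R \<delta> t)" by simp
      also have "norm \<dots> \<le> norm (?P t - p n t) + norm (p n t - q t - \<tau> n *\<^sub>R \<delta> t)"
        by (rule norm_triangle_ineq)
      also have "\<dots> \<le> \<tau> n * (Lipschitz_const * (e + e)) + \<tau> n * b n"
        by (rule add_mono[OF Pp[OF t] p\<delta>[OF t]])
      also have "\<dots> \<le> \<tau> n * (Lipschitz_const * (e + e) + e)"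
        using n(2) pos[of n] by (simp add: distrib_left)
      finally show ?thesis .
    qed
    have Rc: "continuous_on {0..T} ?R"
      by (intro continuous_intros Pc q_continuous \<delta>c)
    have "state_cost_deriv (\<lambda>t. ?R t + \<tau> n *\<^sub>R \<delta> t) = state_cost_deriv ?R + \<tau> n * state_cost_deriv \<delta>"
      by (rule state_cost_deriv_add_scaleR[OF continuous_on_L2[OF Rc] \<delta>L])
    then have "state_cost_deriv (\<lambda>t. ?P t - q t) = state_cost_deriv ?R + \<tau> n * state_cost_deriv \<delta>" by simp
    moreover have "\<bar>state_cost_deriv ?R\<bar> \<le> cost_const * (\<tau> n * (Lipschitz_const * (e + e) + e))"
      by (rule abs_state_cost_deriv_le[OF Rc R])
    moreover have "load_cost_deriv u = - L2_inner I lam u" using rep[OF u] by simp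
    ultimately have "0 \<le> cost_const * (\<tau> n * (Lipschitz_const * (e + e) + e)) + \<tau> n * state_cost_deriv \<delta>
        + \<tau> n * (e - L2_inner I lam u)"
      using n(3) unfolding abs_le_iff by simp
    also have "\<dots> = \<tau> n * (cost_const * (Lipschitz_const * (e + e) + e) + state_cost_deriv \<delta> + (e - L2_inner I lam u))"
      by (simp add: algebra_simps)
    finally have "0 \<le> cost_const * (Lipschitz_const * (e + e) + e) + state_cost_deriv \<delta> + (e - L2_inner I lam u)"
      using pos[of n] by (simp add: zero_le_mult_iff)
    moreover have "L2_inner I lam v - L2_inner I lam u \<le> L2_norm I lam * e"
    proof -
      have "L2_inner I lam v - L2_inner I lam u = L2_inner I lam (\<lambda>t. v t - u t)"
        by (simp add: L2_inner_diff_right lam vL uL)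
      also have "\<dots> \<le> L2_norm I lam * L2_norm I (\<lambda>t. v t - u t)"
        using L2_Cauchy_Schwarz[OF lam L2_diff[OF vL uL]] by simp
      also have "\<dots> \<le> L2_norm I lam * e"
        using uv L2_norm_minus_commute[of I v u] by (intro mult_left_mono L2_norm_nonneg) simp
      finally show ?thesis .
    qed
    ultimately show ?thesis by (simp add: X_def C_def algebra_simps)
  qed
  have "0 \<le> X"
  proof (rule field_le_epsilon)
    fix e :: real assume "0 < e"
    then show "0 \<le> X + e" using approx[of "e / C"] C by simp
  qed
  then show ?thesis by (simp add: X_def)
qed

end

text \<open>
  The direction for which the integrand of the variational inequality becomes minus a square; \<open>h\<close>
  stands for \<open>\<xi> / \<epsilon>\<close>.
\<close>

definition residual :: "real \<Rightarrow> real \<Rightarrow> real \<Rightarrow> real" where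
  "residual z h lam = (if 0 < z then lam - h else if z < 0 then lam
     else if lam < 0 then lam else max (lam - h) 0)"

text \<open>At z = 0 the sign of the direction selects the branch: for lam < 0 it is negative and
  \<open>max_deriv\<close> discards it, leaving -lam^2; otherwise it is nonnegative and kept, and
  lam - h may be replaced by its positive part.\<close>

lemma residual_identity: "h * max_deriv z (residual z h lam) - lam * residual z h lam = - (residual z h lam)\<^sup>2"
  by (auto simp: residual_def max_deriv_def max_def power2_eq_square algebra_simps)

lemma residual_eq_0_D:
  assumes "residual z h lam = 0"
  shows "0 < z \<Longrightarrow> lam = h" and "z < 0 \<Longrightarrow> lam = 0" and "z = 0 \<Longrightarrow> 0 \<le> lam \<and> lam \<le> h"
  using assms by (auto simp: residual_def max_def split: if_splits)

lemma residual_eq_0_abs_le: "residual z h lam = 0 \<Longrightarrow> \<bar>lam\<bar> \<le> \<bar>h\<bar>"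
  by (auto simp: residual_def max_def split: if_splits)

lemma abs_residual_le: "\<bar>residual z h lam\<bar> \<le> \<bar>lam\<bar> + \<bar>h\<bar>"
  by (auto simp: residual_def max_def)

context optimal_control
begin

section \<open>The adjoint state and the pointwise conditions\<close>

definition adjoint_rate :: "(real \<Rightarrow> real ^ 'n) \<Rightarrow> real \<Rightarrow> real ^ 'n" where
  "adjoint_rate lam t = \<alpha> *\<^sub>R lam t + L2_adjoint I A lam t - dj q t"

text \<open>With lam already known, \<xi> enters the adjoint equation only through its derivative. A
  single integration solves it, and the constant is adjusted to the terminal value.\<close>

definition adjoint_state :: "(real \<Rightarrow> real ^ 'n) \<Rightarrow> real \<Rightarrow> real ^ 'n" where
  "adjoint_state lam t = (q T - qd - prim T (adjoint_rate lam) T) + prim T (adjoint_rate lam) t"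

lemma adjoint_rate_L2: "lam \<in> L2 I \<Longrightarrow> adjoint_rate lam \<in> L2 I"
  unfolding adjoint_rate_def
  by (intro L2_diff L2_add L2_scaleR L2_adjoint_kappa_history(1) q_continuous dj_L2)

lemma adjoint_state_H1: "lam \<in> L2 I \<Longrightarrow> adjoint_state lam \<in> H1 T"
  by (rule H1_I[OF adjoint_rate_L2]) (auto simp: adjoint_state_def)

text \<open>Integration by parts against \<delta>, which starts at 0; the terminal value of the
  adjoint state produces the end term of the cost, and the adjoint equation cancels every term in
  \<delta>. What remains involves only the rate \<open>D\<close> and w. The rate is left arbitrary
  here, so no linearity in w is presupposed.\<close>

lemma adjoint_identity:
  assumes lam: "lam \<in> L2 I" and w: "w \<in> L2 I" and D: "D \<in> L2 I"
    and \<delta>: "\<delta> = prim T D" and v: "v = (\<lambda>t. w t + \<alpha> *\<^sub>R \<delta> t + A \<delta> t)"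
  shows "state_cost_deriv \<delta> - L2_inner I lam v
    = L2_inner I (adjoint_state lam) D - L2_inner I lam w"
proof -
  let ?g = "adjoint_rate lam"
  let ?c = "q T - qd - prim T ?g T"
  have Di: "integrable (LM T) D" by (rule L2_integrable[OF D])
  have \<delta>L: "\<delta> \<in> L2 I" unfolding \<delta> by (rule prim_L2[OF Di])
  have A\<delta>: "A \<delta> \<in> L2 I" by (rule kappa_history_deriv_L2[OF q_continuous L2_integrable[OF \<delta>L]])
  have gL: "?g \<in> L2 I" by (rule adjoint_rate_L2[OF lam])
  have adjL: "L2_adjoint I A lam \<in> L2 I" by (rule L2_adjoint_kappa_history(1)[OF q_continuous lam])
  have cL: "(\<lambda>_. ?c) \<in> L2 I" by (rule continuous_on_L2) simp
  have pgL: "prim T ?g \<in> L2 I" by (rule prim_L2[OF L2_integrable[OF gL]])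
  have "L2_inner I (adjoint_state lam) D = L2_inner I (\<lambda>_. ?c) D + L2_inner I (prim T ?g) D"
    unfolding adjoint_state_def by (rule L2_inner_add_left[OF cL pgL D])
  also have "L2_inner I (\<lambda>_. ?c) D = ?c \<bullet> \<delta> T"
    using Di by (simp add: L2_inner_def \<delta> prim_T[of T D])
  also have "L2_inner I (prim T ?g) D = prim T ?g T \<bullet> \<delta> T - L2_inner I ?g \<delta>"
    using prim_parts[OF gL D] by (simp add: \<delta>)
  also have "?c \<bullet> \<delta> T + (prim T ?g T \<bullet> \<delta> T - L2_inner I ?g \<delta>) = (q T - qd) \<bullet> \<delta> T - L2_inner I ?g \<delta>"
    by (simp add: inner_diff_left)
  also have "L2_inner I ?g \<delta> = \<alpha> * L2_inner I lam \<delta> + L2_inner I (L2_adjoint I A lam) \<delta> - L2_inner I (dj q) \<delta>"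
    unfolding adjoint_rate_def
    by (simp add: L2_inner_diff_left L2_inner_add_left L2_inner_scaleR_left L2_add L2_scaleR lam adjL dj_L2 \<delta>L)
  also have "L2_inner I (L2_adjoint I A lam) \<delta> = L2_inner I lam (A \<delta>)"
    using L2_adjoint_kappa_history(2)[OF q_continuous lam \<delta>L] by (simp add: L2_inner_commute)
  finally have "L2_inner I (adjoint_state lam) D
    = (q T - qd) \<bullet> \<delta> T - (\<alpha> * L2_inner I lam \<delta> + L2_inner I lam (A \<delta>) - L2_inner I (dj q) \<delta>)" .
  moreover have "L2_inner I lam v = L2_inner I lam w + \<alpha> * L2_inner I lam \<delta> + L2_inner I lam (A \<delta>)"
    unfolding v by (simp add: L2_inner_add_right L2_inner_scaleR_right L2_add L2_scaleR lam w \<delta>L A\<delta>)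
  ultimately show ?thesis by (simp add: state_cost_deriv_def)
qed

text \<open>All components are tested at once by the direction w made of the residuals. It is
  admissible because lam and the adjoint state lie in L2; by \<open>residual_identity\<close> the
  variational inequality then says that minus the squared norm of w is nonnegative.\<close>

lemma residual_AE:
  assumes lam: "lam \<in> L2 I" and rep: "\<And>v. v \<in> H10 T \<Longrightarrow> - load_cost_deriv v = L2_inner I lam v"
  shows "AE t in LM T. \<forall>i. residual (driving_force l q t $ i) (1 / \<epsilon> * adjoint_state lam t $ i) (lam t $ i) = 0"
proof -
  let ?x = "adjoint_state lam" and ?z = "driving_force l q"
  define w where "w t = (\<chi> i. residual (?z t $ i) (1 / \<epsilon> * ?x t $ i) (lam t $ i))" for t
  have xL: "?x \<in> L2 I" by (rule H1_L2[OF adjoint_state_H1[OF lam]])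
  have zL: "?z \<in> L2 I" by (rule driving_force_L2[OF l_L2 q_continuous])
  have wL: "w \<in> L2 I"
  proof (rule L2_vec)
    fix i
    have [measurable]: "(\<lambda>t. ?z t $ i) \<in> borel_measurable (LM T)" "(\<lambda>t. ?x t $ i) \<in> borel_measurable (LM T)"
        "(\<lambda>t. lam t $ i) \<in> borel_measurable (LM T)"
      by (intro L2_measurable L2_nth zL xL lam)+
    have "(\<lambda>t. \<bar>lam t $ i\<bar> + \<bar>1 / \<epsilon> * ?x t $ i\<bar>) \<in> L2 I"
    proof (rule L2_add)
      show "(\<lambda>t. \<bar>lam t $ i\<bar>) \<in> L2 I"
        by (rule L2_bound[OF _ L2_nth[OF lam], of _ 1 i]) auto
      show "(\<lambda>t. \<bar>1 / \<epsilon> * ?x t $ i\<bar>) \<in> L2 I"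
        by (rule L2_bound[OF _ L2_nth[OF xL], of _ "1 / \<epsilon>" i]) (use \<epsilon> in \<open>auto simp: abs_mult\<close>)
    qed
    moreover have "(\<lambda>t. w t $ i) \<in> borel_measurable (LM T)"
      unfolding w_def residual_def vec_lambda_beta by measurable
    moreover have "AE t in LM T. norm (w t $ i) \<le> 1 * norm (\<bar>lam t $ i\<bar> + \<bar>1 / \<epsilon> * ?x t $ i\<bar>)"
    proof (rule AE_I2)
      fix t
      show "norm (w t $ i) \<le> 1 * norm (\<bar>lam t $ i\<bar> + \<bar>1 / \<epsilon> * ?x t $ i\<bar>)"
        using abs_residual_le[of "?z t $ i" "1 / \<epsilon> * ?x t $ i" "lam t $ i"] by (simp add: w_def)
    qed
    ultimately show "(\<lambda>t. w t $ i) \<in> L2 I" using L2_bound by blast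
  qed
  let ?D = "rate_deriv l q w"
  have DL: "?D \<in> L2 I" by (rule rate_deriv_L2[OF l_L2 q_continuous wL])
  have pointwise: "?x t \<bullet> ?D t - lam t \<bullet> w t = - (w t \<bullet> w t)" for t
  proof -
    have "?x t \<bullet> ?D t - lam t \<bullet> w t
        = (\<Sum>i\<in>UNIV. (1 / \<epsilon> * ?x t $ i) * max_deriv (?z t $ i) (w t $ i) - lam t $ i * w t $ i)"
      by (simp add: inner_vec_def rate_deriv_def positive_part_deriv_def sum_subtractf mult_ac)
    also have "\<dots> = (\<Sum>i\<in>UNIV. - (w t $ i)\<^sup>2)"
      unfolding w_def vec_lambda_beta residual_identity ..
    also have "\<dots> = - (w t \<bullet> w t)" by (simp add: inner_vec_def sum_negf power2_eq_square)
    finally show ?thesis .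
  qed
  have "0 \<le> L2_inner I ?x ?D - L2_inner I lam w"
    using variational_inequality[OF lam rep wL refl refl] adjoint_identity[OF lam wL DL refl refl] by simp
  also have "\<dots> = (LINT t|LM T. ?x t \<bullet> ?D t - lam t \<bullet> w t)"
    unfolding L2_inner_def
    by (rule Bochner_Integration.integral_diff[symmetric]) (rule L2_inner_integrable[OF xL DL], rule L2_inner_integrable[OF lam wL])
  also have "\<dots> = - L2_inner I w w" by (simp add: pointwise L2_inner_def)
  finally have "L2_inner I w w = 0" using L2_inner_nonneg[of I w] by simp
  then have "AE t in LM T. w t = 0" by (rule L2_norm_zero_AE[OF wL])
  then show ?thesis by eventually_elim (simp add: w_def vec_eq_iff)
qed

text \<open>The rate is a multiple of the positive part of an H1 function. Since
  \<open>weak_deriv I q\<close> agrees with it only a.e., membership in \<open>W12\<close> is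
  transferred through the test integrals, which do not see null sets.\<close>

lemma state_H20: "q \<in> H20 T"
proof -
  let ?y = "\<lambda>t. (1 / \<epsilon>) *\<^sub>R positive_part (driving_force l q t)"
  have qH: "q \<in> H10 T" and ae: "AE t in LM T. weak_deriv I q t = ?y t"
    using S_state[OF l_L2] unfolding state_iff_AE by blast+
  have wL: "weak_deriv I q \<in> L2 I" by (rule H1_weak_deriv(1)[OF H10_H1[OF qH]])
  have zH: "driving_force l q \<in> H1 T"
    unfolding driving_force_def
    by (intro H1_diff H1_add H1_scaleR H10_H1[OF qH] H10_H1[OF l_H10] H1_\<kappa>_history q_continuous)
  have yH: "?y \<in> H1 T" by (intro H1_scaleR H1_positive_part T zH)
  note g = H1_weak_deriv[OF yH]
  have "has_weak_derivative I (weak_deriv I q) (weak_deriv I ?y)"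
    unfolding has_weak_derivative_def
  proof
    fix \<phi> assume \<phi>: "\<phi> \<in> test_functions I"
    note [measurable] = continuous_on_borel_LM[OF test_function_prim(1)[OF \<phi>]] L2_measurable[OF wL] L2_measurable[OF H1_L2[OF yH]]
    have "(LINT t|LM T. deriv \<phi> t *\<^sub>R weak_deriv I q t) = (LINT t|LM T. deriv \<phi> t *\<^sub>R ?y t)"
    proof (rule integral_cong_AE)
      show "AE t in LM T. deriv \<phi> t *\<^sub>R weak_deriv I q t = deriv \<phi> t *\<^sub>R ?y t"
        using ae by eventually_elim simp
    qed measurable
    also have "\<dots> = - (LINT t|LM T. \<phi> t *\<^sub>R weak_deriv I ?y t)"
      using g(2) \<phi> by (simp add: has_weak_derivative_def)
    finally show "(LINT t|LM T. deriv \<phi> t *\<^sub>R weak_deriv I q t) = - (LINT t|LM T. \<phi> t *\<^sub>R weak_deriv I ?y t)" .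
  qed
  then show ?thesis using qH wL g(1) by (auto simp: H20_def W12_def)
qed

section \<open>Existence and uniqueness of the optimality system\<close>

abbreviation system :: "(real \<Rightarrow> real ^ 'n) \<Rightarrow> (real \<Rightarrow> real ^ 'n) \<Rightarrow> bool" where
  "system \<equiv> optimality_system T \<alpha> \<epsilon> \<kappa> y0 dj qd l_bar l q"

lemma system_exists:
  obtains lam where "lam \<in> Linf I" "system (adjoint_state lam) lam"
    "\<And>v. v \<in> H10 T \<Longrightarrow> - load_cost_deriv v = L2_inner I lam v"
proof -
  obtain lam where lam: "lam \<in> L2 I" and rep: "\<And>v. v \<in> H10 T \<Longrightarrow> - load_cost_deriv v = L2_inner I lam v"
    using multiplier_exists by blast
  let ?x = "adjoint_state lam"
  have xH: "?x \<in> H1 T" by (rule adjoint_state_H1[OF lam])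
  have res: "AE t in LM T. \<forall>i. residual (driving_force l q t $ i) (1 / \<epsilon> * ?x t $ i) (lam t $ i) = 0"
    by (rule residual_AE[OF lam rep])
  \<comment> \<open>A vanishing residual bounds each component of lam by that of the adjoint state
    divided by \<epsilon>, and the adjoint state is continuous on a compact interval.\<close>
  have lin: "lam \<in> Linf I"
  proof -
    have "bounded (?x ` {0..T})"
      by (intro compact_imp_bounded compact_continuous_image H1_continuous xH compact_Icc)
    then obtain C where C: "\<forall>x\<in>?x ` {0..T}. norm x \<le> C" unfolding bounded_iff by blast
    have "AE t in LM T. norm (lam t) \<le> 1 / \<epsilon> * C"
      using res AE_space
    proof eventually_elim
      case (elim t)
      have "norm (lam t) \<le> norm ((1 / \<epsilon>) *\<^sub>R ?x t)"
      proof (rule norm_le_componentwise_cart)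
        fix i
        have r: "residual (driving_force l q t $ i) (1 / \<epsilon> * ?x t $ i) (lam t $ i) = 0" using elim by blast
        show "norm (lam t $ i) \<le> norm (((1 / \<epsilon>) *\<^sub>R ?x t) $ i)"
          using residual_eq_0_abs_le[OF r] by simp
      qed
      also have "\<dots> = 1 / \<epsilon> * norm (?x t)" using \<epsilon> by simp
      also have "\<dots> \<le> 1 / \<epsilon> * C" using elim(2) \<epsilon> C by (intro mult_left_mono) auto
      finally show ?case .
    qed
    then show ?thesis using L2_measurable[OF lam] by (auto simp: Linf_def)
  qed
  have sys: "system ?x lam"
    unfolding optimality_system_def Let_def driving_force_def[symmetric]
  proof (intro conjI allI ballI)
    have "AE t in LM T. weak_deriv I ?x t = adjoint_rate lam t"
      by (rule weak_deriv_unique[OF T0 adjoint_rate_L2[OF lam], of _ "q T - qd - prim T (adjoint_rate lam) T"])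
        (simp add: adjoint_state_def)
    then show "AE t in LM T. - weak_deriv I ?x t + \<alpha> *\<^sub>R lam t + L2_adjoint I A lam t = dj q t"
      by eventually_elim (simp add: adjoint_rate_def)
    show "?x T = q T - qd" by (simp add: adjoint_state_def)
    fix i
    show "AE t in LM T. driving_force l q t $ i \<noteq> 0 \<longrightarrow>
        lam t $ i = 1 / \<epsilon> * indicator {s. driving_force l q s $ i > 0} t * ?x t $ i"
      using res
    proof eventually_elim
      case (elim t)
      then have r: "residual (driving_force l q t $ i) (1 / \<epsilon> * ?x t $ i) (lam t $ i) = 0" by blast
      show ?case using residual_eq_0_D[OF r] by (auto simp: indicator_def neq_iff)
    qed
    show "AE t in LM T. driving_force l q t $ i = 0 \<longrightarrow> 0 \<le> lam t $ i \<and> lam t $ i \<le> 1 / \<epsilon> * ?x t $ i"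
      using res
    proof eventually_elim
      case (elim t)
      then have r: "residual (driving_force l q t $ i) (1 / \<epsilon> * ?x t $ i) (lam t $ i) = 0" by blast
      show ?case using residual_eq_0_D(3)[OF r] by blast
    qed
  next
    fix v :: "real \<Rightarrow> real ^ 'n" assume "v \<in> H10 T"
    from rep[OF this] show "L2_inner I lam v + H1_inner T l v + H1_inner T (\<lambda>t. l t - l_bar t) v = 0"
      by (simp add: load_cost_deriv_def)
  qed
  show ?thesis by (rule that[OF lin sys rep])
qed

text \<open>The variational equation prescribes the pairing of lam with all of \<open>H10\<close>,
  so \<open>H10_fundamental\<close> determines lam. The adjoint equation then determines the
  derivative of \<xi>, and the terminal condition its constant.\<close>

lemma system_unique:
  assumes x1: "x1 \<in> H1 T" and x2: "x2 \<in> H1 T"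
    and lam1: "lam1 \<in> Linf I" and lam2: "lam2 \<in> Linf I"
    and s1: "system x1 lam1" and s2: "system x2 lam2"
  shows "AE t in LM T. lam2 t = lam1 t" and "t \<in> {0..T} \<Longrightarrow> x2 t = x1 t"
proof -
  have L: "lam1 \<in> L2 I" "lam2 \<in> L2 I" using lam1 lam2 by (auto intro: Linf_L2)
  have "AE t in LM T. lam2 t - lam1 t = 0"
  proof (rule H10_fundamental[OF T L2_diff[OF L(2) L(1)]])
    fix v :: "real \<Rightarrow> real ^ 'n" assume v: "v \<in> H10 T"
    have "L2_inner I lam1 v + H1_inner T l v + H1_inner T (\<lambda>t. l t - l_bar t) v = 0"
      "L2_inner I lam2 v + H1_inner T l v + H1_inner T (\<lambda>t. l t - l_bar t) v = 0"
      using s1 s2 v unfolding optimality_system_def Let_def by blast+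
    then show "L2_inner I (\<lambda>t. lam2 t - lam1 t) v = 0"
      by (simp add: L2_inner_diff_left L H10_L2[OF v])
  qed
  then show ae: "AE t in LM T. lam2 t = lam1 t" by eventually_elim simp
  have "L2_inner I (A v) lam2 = L2_inner I (A v) lam1" if "v \<in> L2 I" for v
  proof -
    have m: "A v \<in> borel_measurable (LM T)"
      by (intro L2_measurable kappa_history_deriv_L2 q_continuous L2_integrable that)
    show ?thesis
      by (rule L2_inner_cong_AE[OF m L2_measurable[OF L(2)] m L2_measurable[OF L(1)] _ ae]) simp
  qed
  \<comment> \<open>The multipliers agree only a.e., but the properties from which
    \<open>L2_adjoint\<close> chooses coincide; hence the chosen adjoints are equal as
    functions.\<close>
  then have adj: "L2_adjoint I A lam2 = L2_adjoint I A lam1"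
    unfolding L2_adjoint_def by (simp cong: conj_cong ball_cong)
  have "AE t in LM T. - weak_deriv I x1 t + \<alpha> *\<^sub>R lam1 t + L2_adjoint I A lam1 t = dj q t"
    using s1 unfolding optimality_system_def Let_def by blast
  moreover have "AE t in LM T. - weak_deriv I x2 t + \<alpha> *\<^sub>R lam2 t + L2_adjoint I A lam1 t = dj q t"
    using s2 unfolding optimality_system_def Let_def adj by blast
  ultimately have wd: "AE t in LM T. weak_deriv I x2 t = weak_deriv I x1 t"
    using ae
  proof eventually_elim
    case (elim t)
    then have "weak_deriv I x2 t = \<alpha> *\<^sub>R lam1 t + L2_adjoint I A lam1 t - dj q t"
      "weak_deriv I x1 t = \<alpha> *\<^sub>R lam1 t + L2_adjoint I A lam1 t - dj q t"
      by (auto simp: algebra_simps)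
    then show ?case by simp
  qed
  have p: "prim T (weak_deriv I x2) t = prim T (weak_deriv I x1) t" for t
    by (rule prim_cong_AE[OF L2_measurable[OF H1_weak_deriv(1)[OF x2]] L2_measurable[OF H1_weak_deriv(1)[OF x1]] wd])
  have "x1 T = q T - qd" "x2 T = q T - qd"
    using s1 s2 unfolding optimality_system_def Let_def by blast+
  moreover have "x1 0 = x1 T - prim T (weak_deriv I x1) T" "x2 0 = x2 T - prim T (weak_deriv I x2) T"
    using H1_eq_prim[OF x1, of T] H1_eq_prim[OF x2, of T] T by auto
  ultimately have "x2 0 = x1 0" by (simp only: p)
  then show "x2 t = x1 t" if "t \<in> {0..T}"
    using H1_eq_prim[OF x1 that] H1_eq_prim[OF x2 that] p[of t] by simp
qed

end

theorem lemma3p4: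
  fixes T \<alpha> \<epsilon> :: real
    and \<kappa> :: "real \<Rightarrow> real"
    and y0 qd :: "real ^ 'n"
    and j :: "(real \<Rightarrow> real ^ 'n) \<Rightarrow> real"
    and dj :: "(real \<Rightarrow> real ^ 'n) \<Rightarrow> real \<Rightarrow> real ^ 'n"
    and S S_eps :: "(real \<Rightarrow> real ^ 'n) \<Rightarrow> real \<Rightarrow> real ^ 'n"
    and l_bar l_eps q_eps :: "real \<Rightarrow> real ^ 'n"
  assumes "T > 0" and "\<alpha> > 0" and "\<epsilon> > 0"
    and "\<And>x. \<kappa> x \<ge> 0"
    and "\<exists>L. L-lipschitz_on UNIV \<kappa>"
    and "\<And>x. \<kappa> differentiable at x"
    and "deriv \<kappa> \<in> W12 UNIV"
    and "L2_continuously_differentiable {0<..<T} j dj"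
    and "\<And>i. qd $ i \<ge> 0"
    and "is_solution_operator T \<alpha> y0 (dissipation \<kappa>) (H10 T) S"
    and "is_solution_operator T \<alpha> y0 (dissipation_eps \<kappa> \<epsilon>) (L2 {0<..<T}) S_eps"
    and "locally_optimal T (objective T j qd S) l_bar"
    and "locally_optimal T (objective_eps T j qd S_eps l_bar) l_eps"
    and "q_eps = S_eps l_eps"
  shows "q_eps \<in> H20 T \<and>
    (\<exists>\<xi>\<in>H1 T. \<exists>lam\<in>Linf {0<..<T}.
      optimality_system T \<alpha> \<epsilon> \<kappa> y0 dj qd l_bar l_eps q_eps \<xi> lam \<and>
      (\<forall>\<xi>2\<in>H1 T. \<forall>lam2\<in>Linf {0<..<T}.
        optimality_system T \<alpha> \<epsilon> \<kappa> y0 dj qd l_bar l_eps q_eps \<xi>2 lam2 \<longrightarrow>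
          (\<forall>t\<in>{0..T}. \<xi>2 t = \<xi> t) \<and> (AE t in lebesgue_on {0<..<T}. lam2 t = lam t)))"
proof -
  obtain L where L: "L-lipschitz_on UNIV \<kappa>" using assms(5) by blast
  have lip: "\<bar>\<kappa> x - \<kappa> y\<bar> \<le> L * \<bar>x - y\<bar>" for x y
    using lipschitz_onD[OF L, of x y] by (simp add: dist_real_def)
  have "l_bar \<in> H10 T" using assms(12) by (simp add: locally_optimal_def)
  then interpret optimal_control T \<alpha> \<epsilon> L \<kappa> y0 j dj qd S_eps l_bar l_eps
    by unfold_locales (use assms lip in auto)
  obtain lam where lam: "lam \<in> Linf {0<..<T}" and sys: "system (adjoint_state lam) lam"
    using system_exists by blast
  have x: "adjoint_state lam \<in> H1 T" by (rule adjoint_state_H1[OF Linf_L2[OF lam]])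
  show ?thesis
    unfolding assms(14)
    using state_H20 x lam sys system_unique[OF x _ lam _ sys] by blast
qed

end
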